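(* Let $N\ge2$, $0<R_1<R_2$, $\Omega=B_{R_2}\setminus\overline{B_{R_1}}\subset\mathbb{R}^N$, $\Gamma_0=\partial B_{R_2}$ and $\Gamma_1=\partial B_{R_1}$, and let $\lambda_1$ be the smallest eigenvalue of the problem $$-\Delta u=\lambda u\ \text{ in }\Omega,\qquad u=0\ \text{ on }\Gamma_0,\qquad -\Delta_\Gamma u+\partial_\nu u=\lambda u\ \text{ on }\Gamma_1. \qquad (\mathrm{P}_\lambda)$$ Then any weak solution of $(\mathrm{P}_{\lambda_1})$ is radially symmetric. Moreover, if $u_1$ is a real-valued eigenfunction corresponding to $\lambda_1$ chosen to be positive in $\Omega\cup\Gamma_1$, then $u_1$ is strictly decreasing in the radius $|x|$.
   Context: Notation. $B_R$ is the open ball of $\mathbb{R}^N$ of radius $R$ centered at the origin. $\Gamma=\partial\Omega=\Gamma_0\cup\Gamma_1$. $\nu$ is the outward normal to $\Omega$, and $\Delta_\Gamma$ is the Laplace–Beltrami operator on $\Gamma$. Functions are complex-valued unless stated otherwise. Integrals over $\Gamma_1$ are with respect to the Hausdorff measure $\mathcal{H}^{N-1}$. $\nabla_\Gamma$ is the Riemannian gradient on $\Gamma$ (with the metric inherited from $\mathbb{R}^N$), and $(\cdot,\cdot)_\Gamma$ is the Hermitian extension (linear in the first argument, conjugate-linear in the second) of the Riemannian metric to the complexified tangent bundle. $u_{|\Gamma}$ denotes the trace of $u\in H^1(\Omega)$ on $\Gamma$. Space. $H^1=\{(u,v)\in H^1(\Omega)\times H^1(\Gamma): v=u_{|\Gamma},\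 v=0 \text{ on }\Gamma_0\}$, identified with $\{u\in H^1(\Omega): u_{|\Gamma}\in H^1(\Gamma),\ u_{|\Gamma}=0\text{ a.e. on }\Gamma_0\}$ through $u\mapsto(u,u_{|\Gamma})$; so elements of $H^1$ are written as functions $u$ on $\Omega$. Weak solutions. For $\lambda\in\mathbb{C}$, a weak solution of $(\mathrm{P}_\lambda)$ is $u\in H^1$ such that $$\int_\Omega\nabla u\cdot\nabla\phi+\int_{\Gamma_1}(\nabla_\Gamma u,\nabla_\Gamma\overline{\phi})_\Gamma=\lambda\Big(\int_\Omega u\phi+\int_{\Gamma_1}u\phi\Big)\quad\text{for all }\phi\in H^1$$ (products without conjugation). An eigenvalue is $\lambda\in\mathbb{C}$ for which a nontrivial weak solution (called an eigenfunction) exists. The eigenvalues are real, positive, of finite multiplicity, and, repeated according to multiplicity, form a sequence $0<\lambda_1\le\lambda_2\le\cdots$ with $\lambda_n\to\infty$. In this setting $\lambda_1$ is simple and its real-valued eigenfunctions, which are continuous on $\overline{\Omega}$, have constant (strict) sign in $\Omega\cup\Gamma_1$, so a positive $u_1$ can be chosen. *)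

theory Defs
  imports "HOL-Analysis.Analysis"
begin

section \<open>Hausdorff measure\<close>

text \<open>
  The $k$-dimensional Hausdorff outer measure for an integer $k \ge 1$, normalised by the volume of
  the $k$-dimensional unit ball.  The boundedness condition on the covering sets is
  needed because \<^const>\<open>diameter\<close> is meaningful for bounded sets only.
\<close>

definition hausdorff_outer :: "nat \<Rightarrow> 'a::metric_space set \<Rightarrow> ennreal" where
  "hausdorff_outer k A =
     (SUP \<delta>\<in>{0::real<..}.
        INF C\<in>{C :: nat \<Rightarrow> 'a set. A \<subseteq> (\<Union>i. C i) \<and> (\<forall>i. bounded (C i) \<and> diameter (C i) \<le> \<delta>)}.
          \<Sum>i. ennreal (unit_ball_vol (real k) * (diameter (C i) / 2) ^ k))"

text \<open>
  This is a metric outer measure, hence countably additive on the Borel sets, so the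
  value of the following measure on a Borel set is that of the outer measure.
\<close>

definition hausdorff_measure :: "nat \<Rightarrow> 'a::metric_space measure" where
  "hausdorff_measure k = measure_of UNIV (sets borel) (hausdorff_outer k)"

definition surface_measure :: "(real^'n) set \<Rightarrow> (real^'n) measure" where
  "surface_measure S = restrict_space (hausdorff_measure (CARD('n) - 1)) S"


section \<open>Smooth functions\<close>

definition pderivative :: "'n \<Rightarrow> (real^'n \<Rightarrow> complex) \<Rightarrow> real^'n \<Rightarrow> complex" where
  "pderivative i f x = frechet_derivative f (at x) (axis i 1)"

definition grad :: "(real^'n \<Rightarrow> complex) \<Rightarrow> real^'n \<Rightarrow> complex^'n" where
  "grad f x = (\<chi> i. pderivative i f x)"

primrec C_k :: "nat \<Rightarrow> (real^'n \<Rightarrow> complex) \<Rightarrow> bool" where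
  "C_k 0 f \<longleftrightarrow> continuous_on UNIV f"
| "C_k (Suc k) f \<longleftrightarrow> f differentiable_on UNIV \<and> (\<forall>i. C_k k (pderivative i f))"

definition smooth :: "(real^'n \<Rightarrow> complex) \<Rightarrow> bool" where
  "smooth f \<longleftrightarrow> (\<forall>k. C_k k f)"

definition test_function :: "(real^'n) set \<Rightarrow> (real^'n \<Rightarrow> complex) \<Rightarrow> bool" where
  "test_function \<Omega> f \<longleftrightarrow>
     smooth f \<and> compact (closure {x. f x \<noteq> 0}) \<and> closure {x. f x \<noteq> 0} \<subseteq> \<Omega>"

definition tangential_grad ::
  "(real^'n \<Rightarrow> real^'n) \<Rightarrow> (real^'n \<Rightarrow> complex) \<Rightarrow> real^'n \<Rightarrow> complex^'n" where
  "tangential_grad \<nu> f x =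
     (\<chi> i. grad f x $ i - (\<Sum>j\<in>UNIV. grad f x $ j * of_real (\<nu> x $ j)) * of_real (\<nu> x $ i))"


section \<open>Sobolev spaces\<close>

text \<open>
  Elements of Lebesgue and Sobolev spaces are represented by functions; all conditions are
  invariant under modification on null sets.  Weak gradients, traces and tangential
  gradients are relations, since they are determined only up to null sets.
\<close>

definition L2 :: "'a measure \<Rightarrow> ('a \<Rightarrow> 'b::{real_normed_vector,second_countable_topology}) \<Rightarrow> bool" where
  "L2 M f \<longleftrightarrow> f \<in> borel_measurable M \<and> integrable M (\<lambda>x. (norm (f x))\<^sup>2)"

definition L2_tendsto ::
  "'a measure \<Rightarrow> (nat \<Rightarrow> 'a \<Rightarrow> 'b::real_normed_vector) \<Rightarrow> ('a \<Rightarrow> 'b) \<Rightarrow> bool" where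
  "L2_tendsto M F f \<longleftrightarrow> (\<lambda>n. \<integral>\<^sup>+x. ennreal ((norm (F n x - f x))\<^sup>2) \<partial>M) \<longlonglongrightarrow> 0"

definition weak_grad ::
  "(real^'n) set \<Rightarrow> (real^'n \<Rightarrow> complex) \<Rightarrow> (real^'n \<Rightarrow> complex^'n) \<Rightarrow> bool" where
  "weak_grad \<Omega> u g \<longleftrightarrow>
     (\<forall>f i. test_function \<Omega> f \<longrightarrow>
        (LINT x|lebesgue_on \<Omega>. u x * pderivative i f x) = - (LINT x|lebesgue_on \<Omega>. g x $ i * f x))"

text \<open>\<open>H1_dom \<Omega> u g\<close>: \<open>u\<close> belongs to $H^1(\Omega)$, with gradient \<open>g\<close>.\<close>

definition H1_dom ::
  "(real^'n) set \<Rightarrow> (real^'n \<Rightarrow> complex) \<Rightarrow> (real^'n \<Rightarrow> complex^'n) \<Rightarrow> bool" where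
  "H1_dom \<Omega> u g \<longleftrightarrow> L2 (lebesgue_on \<Omega>) u \<and> L2 (lebesgue_on \<Omega>) g \<and> weak_grad \<Omega> u g"

text \<open>
  \<open>has_trace \<Omega> \<Gamma> u g v\<close>: \<open>v\<close> is the trace on \<open>\<Gamma>\<close> of \<open>u\<close>, where \<open>u\<close> has gradient \<open>g\<close>.  The trace
  operator is the continuous extension to $H^1(\Omega)$, with values in $L^2(\Gamma)$, of the
  restriction map on smooth functions.
\<close>

definition has_trace ::
  "(real^'n) set \<Rightarrow> (real^'n) set \<Rightarrow> (real^'n \<Rightarrow> complex) \<Rightarrow> (real^'n \<Rightarrow> complex^'n)
     \<Rightarrow> (real^'n \<Rightarrow> complex) \<Rightarrow> bool" where
  "has_trace \<Omega> \<Gamma> u g v \<longleftrightarrow>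
     L2 (surface_measure \<Gamma>) v \<and>
     (\<exists>F. (\<forall>n. smooth (F n)) \<and>
          L2_tendsto (lebesgue_on \<Omega>) F u \<and>
          L2_tendsto (lebesgue_on \<Omega>) (\<lambda>n. grad (F n)) g \<and>
          L2_tendsto (surface_measure \<Gamma>) F v)"

text \<open>
  \<open>H1_surf \<Gamma> \<nu> v G\<close>: \<open>v\<close> belongs to $H^1(\Gamma)$, with Riemannian gradient \<open>G\<close>, where \<open>\<nu>\<close> is a unit
  normal field to the compact hypersurface \<open>\<Gamma>\<close>.  As usual, $H^1(\Gamma)$ is the completion of
  the smooth functions on \<open>\<Gamma>\<close>, which are the restrictions of smooth functions
  on the ambient space.
\<close>

definition H1_surf ::
  "(real^'n) set \<Rightarrow> (real^'n \<Rightarrow> real^'n) \<Rightarrow> (real^'n \<Rightarrow> complex) \<Rightarrow> (real^'n \<Rightarrow> complex^'n)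
     \<Rightarrow> bool" where
  "H1_surf \<Gamma> \<nu> v G \<longleftrightarrow>
     L2 (surface_measure \<Gamma>) v \<and> L2 (surface_measure \<Gamma>) G \<and>
     (\<exists>F. (\<forall>n. smooth (F n)) \<and>
          L2_tendsto (surface_measure \<Gamma>) F v \<and>
          L2_tendsto (surface_measure \<Gamma>) (\<lambda>n. tangential_grad \<nu> (F n)) G)"

text \<open>
  \<open>in_H1 \<Omega> \<Gamma>\<^sub>0 \<Gamma>\<^sub>1 \<nu> u g v G\<close>: the pair \<open>(u, v)\<close> belongs to the space $H^1$ of pairs with
  $v = u_{|\Gamma}$ and $v = 0$ on $\Gamma_0$; \<open>g\<close> is the gradient of \<open>u\<close> and \<open>G\<close> the Riemannian gradient
  of \<open>v\<close>.
\<close>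

definition in_H1 ::
  "(real^'n) set \<Rightarrow> (real^'n) set \<Rightarrow> (real^'n) set \<Rightarrow> (real^'n \<Rightarrow> real^'n)
     \<Rightarrow> (real^'n \<Rightarrow> complex) \<Rightarrow> (real^'n \<Rightarrow> complex^'n)
     \<Rightarrow> (real^'n \<Rightarrow> complex) \<Rightarrow> (real^'n \<Rightarrow> complex^'n) \<Rightarrow> bool" where
  "in_H1 \<Omega> \<Gamma>\<^sub>0 \<Gamma>\<^sub>1 \<nu> u g v G \<longleftrightarrow>
     H1_dom \<Omega> u g \<and> has_trace \<Omega> (\<Gamma>\<^sub>0 \<union> \<Gamma>\<^sub>1) u g v \<and> H1_surf (\<Gamma>\<^sub>0 \<union> \<Gamma>\<^sub>1) \<nu> v G \<and>
     (AE x in surface_measure \<Gamma>\<^sub>0. v x = 0)"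


section \<open>Weak solutions and eigenvalues\<close>

definition herm :: "complex^'n \<Rightarrow> complex^'n \<Rightarrow> complex" where
  "herm a b = (\<Sum>i\<in>UNIV. a $ i * cnj (b $ i))"

definition vec_cnj :: "complex^'n \<Rightarrow> complex^'n" where
  "vec_cnj a = (\<chi> i. cnj (a $ i))"

text \<open>
  The pair \<open>(u, v)\<close> is a weak solution.  The Riemannian gradient of the conjugate
  of a function is the conjugate of its Riemannian gradient.
\<close>

definition weak_solution ::
  "(real^'n) set \<Rightarrow> (real^'n) set \<Rightarrow> (real^'n) set \<Rightarrow> (real^'n \<Rightarrow> real^'n) \<Rightarrow> complex
     \<Rightarrow> (real^'n \<Rightarrow> complex) \<Rightarrow> (real^'n \<Rightarrow> complex) \<Rightarrow> bool" where
  "weak_solution \<Omega> \<Gamma>\<^sub>0 \<Gamma>\<^sub>1 \<nu> \<mu> u v \<longleftrightarrow>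
     (\<exists>g G. in_H1 \<Omega> \<Gamma>\<^sub>0 \<Gamma>\<^sub>1 \<nu> u g v G \<and>
       (\<forall>\<phi> h \<psi> H. in_H1 \<Omega> \<Gamma>\<^sub>0 \<Gamma>\<^sub>1 \<nu> \<phi> h \<psi> H \<longrightarrow>
          (LINT x|lebesgue_on \<Omega>. (\<Sum>i\<in>UNIV. g x $ i * h x $ i))
            + (LINT x|surface_measure \<Gamma>\<^sub>1. herm (G x) (vec_cnj (H x)))
          = \<mu> * ((LINT x|lebesgue_on \<Omega>. u x * \<phi> x) + (LINT x|surface_measure \<Gamma>\<^sub>1. v x * \<psi> x))))"

definition eigenfunction ::
  "(real^'n) set \<Rightarrow> (real^'n) set \<Rightarrow> (real^'n) set \<Rightarrow> (real^'n \<Rightarrow> real^'n) \<Rightarrow> complex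
     \<Rightarrow> (real^'n \<Rightarrow> complex) \<Rightarrow> (real^'n \<Rightarrow> complex) \<Rightarrow> bool" where
  "eigenfunction \<Omega> \<Gamma>\<^sub>0 \<Gamma>\<^sub>1 \<nu> \<mu> u v \<longleftrightarrow>
     weak_solution \<Omega> \<Gamma>\<^sub>0 \<Gamma>\<^sub>1 \<nu> \<mu> u v \<and> \<not> (AE x in lebesgue_on \<Omega>. u x = 0)"

definition eigenvalue ::
  "(real^'n) set \<Rightarrow> (real^'n) set \<Rightarrow> (real^'n) set \<Rightarrow> (real^'n \<Rightarrow> real^'n) \<Rightarrow> complex \<Rightarrow> bool" where
  "eigenvalue \<Omega> \<Gamma>\<^sub>0 \<Gamma>\<^sub>1 \<nu> \<mu> \<longleftrightarrow> (\<exists>u v. eigenfunction \<Omega> \<Gamma>\<^sub>0 \<Gamma>\<^sub>1 \<nu> \<mu> u v)"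

definition smallest_eigenvalue ::
  "(real^'n) set \<Rightarrow> (real^'n) set \<Rightarrow> (real^'n) set \<Rightarrow> (real^'n \<Rightarrow> real^'n) \<Rightarrow> real \<Rightarrow> bool" where
  "smallest_eigenvalue \<Omega> \<Gamma>\<^sub>0 \<Gamma>\<^sub>1 \<nu> \<mu> \<longleftrightarrow>
     eigenvalue \<Omega> \<Gamma>\<^sub>0 \<Gamma>\<^sub>1 \<nu> (of_real \<mu>) \<and>
     (\<forall>\<mu>'. eigenvalue \<Omega> \<Gamma>\<^sub>0 \<Gamma>\<^sub>1 \<nu> (of_real \<mu>') \<longrightarrow> \<mu> \<le> \<mu>')"

text \<open>Outward unit normal of an annulus centred at the origin with inner radius \<open>r\<close>.\<close>

definition annulus_normal :: "real \<Rightarrow> real^'n \<Rightarrow> real^'n" where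
  "annulus_normal r x = (if norm x = r then - (x /\<^sub>R norm x) else x /\<^sub>R norm x)"

end

theory Submission
  imports Defs
begin

text \<open>
  Let \<open>\<phi> l\<close> be the solution of the radial equation \<open>(r\<^sup>m \<phi>')' = - l r\<^sup>m \<phi>\<close>, \<open>m = N - 1\<close>, that equals \<open>1\<close> at
  \<open>R1\<close> and satisfies the boundary condition there, and let \<open>l0\<close> be the first \<open>l\<close> for which it has a zero on
  \<open>{R1..R2}\<close>. For positive \<open>l\<close> the solution is strictly decreasing where it is positive, so the zero for
  \<open>l0\<close> is at \<open>R2\<close>, and \<open>u0 x = \<phi> l0 |x|\<close> is an eigenfunction; hence the smallest eigenvalue is at most \<open>l0\<close>.
  For \<open>l < l0\<close> put \<open>\<beta> = \<phi>' / \<phi>\<close> and \<open>b = \<beta>(|x|) x / |x|\<close>. Picone's identity says that the integral of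
  \<open>|grad u - u b|\<^sup>2\<close> is the integral of \<open>|grad u|\<^sup>2\<close> minus \<open>l\<close> times the squared norm of \<open>u\<close> in the bulk and
  on the inner sphere. For a weak solution with eigenvalue at most \<open>l0\<close> the limit \<open>l = l0\<close> yields
  \<open>grad u = u b\<close>, so that \<open>u / u0\<close> has zero gradient and is constant on the connected annulus.
  The spheres carry the Hausdorff measure only through its rotation invariance, finiteness and positivity,
  which force it to be a multiple of the cone measure in polar coordinates.
\<close>


section \<open>Hausdorff measure\<close>

text \<open>Three obstacles shape the details. The ratio of surface measure to cone measure stays an
  undetermined positive constant, so it is carried into the radial problem: the slope at
  \<open>R1\<close> is \<open>- l / c1\<close>, chosen so that the inner boundary term of the
  divergence theorem becomes exactly \<open>l\<close> times the integral over the inner sphere. The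
  radial solutions are built as power series in \<open>l\<close>, because joint continuity in
  \<open>l\<close> and the radius lets compactness pick the first \<open>l\<close> with a zero.
  Elements of H1 are handled only through smooth approximation: \<open>has_trace\<close> supplies
  one sequence of smooth functions converging to the function, its gradient and its trace at once.
  So Picone's identity, the weak equation for \<open>u0\<close> and the quotient by
  \<open>u0\<close> are computed for smooth functions and passed to the limit; for the quotient the
  limit rests on a Poincare inequality on small balls, where the smooth approximants divided by
  \<open>u0\<close> have gradients tending to 0 in the mean. The tangential part of the energy
  enters only through its sign, and it vanishes for radial functions.\<close>

definition fine_covers :: "real \<Rightarrow> 'a::metric_space set \<Rightarrow> (nat \<Rightarrow> 'a set) set" where
  "fine_covers \<delta> A = {C. A \<subseteq> (\<Union>i. C i) \<and> (\<forall>i. bounded (C i) \<and> diameter (C i) \<le> \<delta>)}"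

definition set_cost :: "nat \<Rightarrow> 'a::metric_space set \<Rightarrow> ennreal" where
  "set_cost k C = ennreal (unit_ball_vol (real k) * (diameter C / 2) ^ k)"

definition hausdorff_pre :: "nat \<Rightarrow> real \<Rightarrow> 'a::metric_space set \<Rightarrow> ennreal" where
  "hausdorff_pre k \<delta> A = (INF C\<in>fine_covers \<delta> A. \<Sum>i. set_cost k (C i))"

lemma hausdorff_outer_eq: "hausdorff_outer k A = (SUP \<delta>\<in>{0<..}. hausdorff_pre k \<delta> A)"
  by (simp add: hausdorff_outer_def hausdorff_pre_def fine_covers_def set_cost_def)

text \<open>For \<open>k = 0\<close> the empty set would cost 1, because its diameter is 0 and
  \<open>0 ^ 0 = 1\<close>. This is the source of the condition \<open>k \<ge> 1\<close> in what
  follows.\<close>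

lemma set_cost_empty: "k \<ge> 1 \<Longrightarrow> set_cost k {} = 0"
  by (simp add: set_cost_def power_0_left)

lemma hausdorff_pre_le:
  "C \<in> fine_covers \<delta> A \<Longrightarrow> hausdorff_pre k \<delta> A \<le> (\<Sum>i. set_cost k (C i))"
  unfolding hausdorff_pre_def by (rule INF_lower)

lemma hausdorff_pre_mono: "A \<subseteq> B \<Longrightarrow> hausdorff_pre k \<delta> A \<le> hausdorff_pre k \<delta> B"
  unfolding hausdorff_pre_def by (rule INF_superset_mono) (auto simp: fine_covers_def)

lemma hausdorff_pre_antimono: "\<delta> \<le> \<epsilon> \<Longrightarrow> hausdorff_pre k \<epsilon> A \<le> hausdorff_pre k \<delta> A"
  unfolding hausdorff_pre_def
  by (rule INF_superset_mono) (auto simp: fine_covers_def intro: order_trans)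

lemma hausdorff_pre_le_outer: "0 < \<delta> \<Longrightarrow> hausdorff_pre k \<delta> A \<le> hausdorff_outer k A"
  unfolding hausdorff_outer_eq by (rule SUP_upper) auto

lemma hausdorff_outer_mono: "A \<subseteq> B \<Longrightarrow> hausdorff_outer k A \<le> hausdorff_outer k B"
  unfolding hausdorff_outer_eq by (rule SUP_mono) (auto intro: hausdorff_pre_mono)

lemma hausdorff_outer_empty: "k \<ge> 1 \<Longrightarrow> hausdorff_outer k {} = 0"
proof -
  assume k: "k \<ge> 1"
  have "hausdorff_pre k \<delta> ({}::'a set) \<le> 0" if "\<delta> > 0" for \<delta>
    using hausdorff_pre_le[of "\<lambda>_. {}" \<delta> "{}::'a set" k] that k
    by (simp add: fine_covers_def set_cost_empty)
  then show ?thesis unfolding hausdorff_outer_eq by (intro SUP_eq_const) auto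
qed

text \<open>The usual geometric-series argument: the n-th piece gets a cover with excess below
  \<open>e * (1/2)^Suc n\<close>, and \<open>prod_decode\<close> merges the countably many covers
  into one sequence.\<close>

lemma hausdorff_pre_UN:
  assumes "\<delta> > 0"
  shows "hausdorff_pre k \<delta> (\<Union>i. A i) \<le> (\<Sum>i. hausdorff_pre k \<delta> (A i :: 'a::metric_space set))"
proof (rule ennreal_le_epsilon)
  let ?O = "hausdorff_pre k \<delta>"
  fix e :: real assume e: "0 < e" and fin: "(\<Sum>n. ?O (A n)) < top"
  then have *: "?O (A n) < ?O (A n) + e * (1/2)^Suc n" for n
    by (auto simp add: less_top dest!: ennreal_suminf_lessD)
  have "\<exists>C. C \<in> fine_covers \<delta> (A n) \<and> (\<Sum>i. set_cost k (C i)) < ?O (A n) + e * (1/2)^Suc n" for n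
    using *[of n] unfolding hausdorff_pre_def by (subst (asm) INF_less_iff) auto
  then obtain B where B: "\<And>n. B n \<in> fine_covers \<delta> (A n)"
    and Bl: "\<And>n. (\<Sum>i. set_cost k (B n i)) < ?O (A n) + e * (1/2)^Suc n" by metis
  define C where "C = case_prod B o prod_decode"
  have "C \<in> fine_covers \<delta> (\<Union>i. A i)"
    using B unfolding fine_covers_def C_def 
    apply (auto simp: split_def subset_eq)
    by (metis fst_conv prod_encode_inverse snd_conv)
  then have "?O (\<Union>i. A i) \<le> (\<Sum>i. set_cost k (C i))" by (rule hausdorff_pre_le)
  also have "\<dots> = (\<Sum>n. \<Sum>i. set_cost k (B n i))"
    using suminf_ennreal_2dimen[of "\<lambda>n. (\<Sum>i. set_cost k (B n i))" "\<lambda>p. set_cost k (case_prod B p)"] by (simp add: C_def)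
  also have "\<dots> \<le> (\<Sum>n. ?O (A n) + e * (1/2) ^ Suc n)"
    by (intro suminf_le allI less_imp_le[OF Bl]) auto
  also have "... = (\<Sum>n. ?O (A n)) + (\<Sum>n. ennreal e * ennreal ((1/2) ^ Suc n))"
    using \<open>0 < e\<close> by (subst suminf_add[symmetric])
                     (auto simp del: ennreal_suminf_cmult simp add: ennreal_mult[symmetric])
  also have "\<dots> = (\<Sum>n. ?O (A n)) + e"
    unfolding ennreal_suminf_cmult
    by (subst suminf_ennreal_eq[OF zero_le_power power_half_series]) auto
  finally show "?O (\<Union>i. A i) \<le> (\<Sum>n. ?O (A n)) + e" .
qed

lemma hausdorff_outer_UN:
  "hausdorff_outer k (\<Union>i. A i) \<le> (\<Sum>i. hausdorff_outer k (A i :: 'a::metric_space set))"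
  unfolding hausdorff_outer_eq[of k "\<Union>i. A i"]
proof (rule SUP_least)
  fix \<delta> :: real assume "\<delta> \<in> {0<..}"
  then have "hausdorff_pre k \<delta> (\<Union>i. A i) \<le> (\<Sum>i. hausdorff_pre k \<delta> (A i))"
    by (intro hausdorff_pre_UN) auto
  also have "\<dots> \<le> (\<Sum>i. hausdorff_outer k (A i))"
    using \<open>\<delta> \<in> {0<..}\<close> by (intro suminf_le hausdorff_pre_le_outer) auto
  finally show "hausdorff_pre k \<delta> (\<Union>i. A i) \<le> (\<Sum>i. hausdorff_outer k (A i))" .
qed

lemma hausdorff_outer_Un:
  assumes "k \<ge> 1"
  shows "hausdorff_outer k (A \<union> B) \<le> hausdorff_outer k A + hausdorff_outer k (B :: 'a::metric_space set)"
proof -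
  define f where "f i = (if i = 0 then A else if i = 1 then B else {})" for i :: nat
  have "(\<Union>i. f i) = A \<union> B" unfolding f_def by (auto split: if_splits)
  then have "hausdorff_outer k (A \<union> B) \<le> (\<Sum>i. hausdorff_outer k (f i))"
    using hausdorff_outer_UN[of k f] by simp
  also have "\<dots> = (\<Sum>i<2. hausdorff_outer k (f i))"
    by (rule suminf_finite) (auto simp: f_def hausdorff_outer_empty[OF assms])
  also have "\<dots> = hausdorff_outer k A + hausdorff_outer k B"
    by (simp add: f_def numeral_2_eq_2)
  finally show ?thesis .
qed

section \<open>Caratheodory's criterion: Borel sets are measurable for the Hausdorff outer
  measure\<close>

text \<open>At scales below \<open>d\<close> no covering set meets both \<open>A\<close> and
  \<open>B\<close>, so every cover of the union splits into a cover of \<open>A\<close> and one of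
  \<open>B\<close> whose costs add up to at most the original cost.\<close>

lemma hausdorff_outer_separated:
  fixes A B :: "'a::metric_space set"
  assumes k: "k \<ge> 1" and d: "d > 0" "\<And>x y. x \<in> A \<Longrightarrow> y \<in> B \<Longrightarrow> d \<le> dist x y"
  shows "hausdorff_outer k A + hausdorff_outer k B \<le> hausdorff_outer k (A \<union> B)"
proof -
  have pre: "hausdorff_pre k \<delta> A + hausdorff_pre k \<delta> B \<le> hausdorff_pre k \<delta> (A \<union> B)"
    if \<delta>: "0 < \<delta>" "\<delta> < d" for \<delta>
    unfolding hausdorff_pre_def[of k \<delta> "A \<union> B"]
  proof (rule INF_greatest)
    fix C assume C: "C \<in> fine_covers \<delta> (A \<union> B)"
    define CA where "CA i = (if C i \<inter> A \<noteq> {} then C i else {})" for i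
    define CB where "CB i = (if C i \<inter> B \<noteq> {} then C i else {})" for i
    have "hausdorff_pre k \<delta> A \<le> (\<Sum>i. set_cost k (CA i))"
      using C \<delta> by (intro hausdorff_pre_le) (fastforce simp: fine_covers_def CA_def)
    moreover have "hausdorff_pre k \<delta> B \<le> (\<Sum>i. set_cost k (CB i))"
      using C \<delta> by (intro hausdorff_pre_le) (fastforce simp: fine_covers_def CB_def)
    moreover have "(\<Sum>i. set_cost k (CA i)) + (\<Sum>i. set_cost k (CB i)) = (\<Sum>i. set_cost k (CA i) + set_cost k (CB i))"
      by (rule suminf_add) auto
    moreover have "set_cost k (CA i) + set_cost k (CB i) \<le> set_cost k (C i)" for i
    proof -
      have "C i \<inter> A = {} \<or> C i \<inter> B = {}"
      proof (rule ccontr)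
        assume "\<not> ?thesis"
        then obtain x y where "x \<in> C i" "x \<in> A" "y \<in> C i" "y \<in> B" by auto
        moreover have "bounded (C i)" "diameter (C i) \<le> \<delta>" using C by (auto simp: fine_covers_def)
        ultimately have "dist x y \<le> \<delta>" using diameter_bounded_bound by force
        then show False using d(2)[of x y] \<open>x \<in> A\<close> \<open>y \<in> B\<close> \<delta> by auto
      qed
      then show ?thesis by (auto simp: CA_def CB_def set_cost_empty[OF k])
    qed
    ultimately show "hausdorff_pre k \<delta> A + hausdorff_pre k \<delta> B \<le> (\<Sum>i. set_cost k (C i))"
      by (smt (verit, best) add_mono order_trans suminf_le summableI)
  qed
  have *: "hausdorff_pre k \<delta> A + hausdorff_pre k \<epsilon> B \<le> hausdorff_outer k (A \<union> B)"
    if "0 < \<delta>" "0 < \<epsilon>" for \<delta> \<epsilon>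
  proof -
    \<comment> \<open>\<open>hausdorff_pre\<close> grows as the scale shrinks, so two independent
      scales may be replaced by a common one below \<open>d\<close>; afterwards the two suprema can
      be taken separately.\<close>
    define \<eta> where "\<eta> = min (min \<delta> \<epsilon>) (d/2)"
    have \<eta>: "0 < \<eta>" "\<eta> < d" "\<eta> \<le> \<delta>" "\<eta> \<le> \<epsilon>" using that d(1) by (auto simp: \<eta>_def)
    have "hausdorff_pre k \<delta> A + hausdorff_pre k \<epsilon> B \<le> hausdorff_pre k \<eta> A + hausdorff_pre k \<eta> B"
      using \<eta> by (intro add_mono hausdorff_pre_antimono)
    also have "\<dots> \<le> hausdorff_outer k (A \<union> B)"
      using pre[OF \<eta>(1,2)] hausdorff_pre_le_outer[OF \<eta>(1)] order_trans by blast
    finally show ?thesis .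
  qed
  have "hausdorff_outer k A + hausdorff_pre k \<epsilon> B \<le> hausdorff_outer k (A \<union> B)" if "0 < \<epsilon>" for \<epsilon>
    unfolding hausdorff_outer_eq[of k A] using * that
    by (subst ennreal_SUP_add_left[symmetric]) (auto intro!: SUP_least)
  then show ?thesis
    unfolding hausdorff_outer_eq[of k B]
    by (subst ennreal_SUP_add_right) (auto intro!: SUP_least)
qed

text \<open>Caratheodory's argument for metric outer measures. \<open>E n\<close> collects the
  points of \<open>A - C\<close> at distance at least \<open>1 / (n + 1)\<close> from
  \<open>C\<close>, so it is separated from \<open>A \<inter> C\<close>. What \<open>E n\<close>
  misses is a union of layers \<open>D\<close>; layers of the same parity are mutually separated,
  hence their measures are summable and the tail is small.\<close>

lemma hausdorff_outer_closed_split: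
  fixes A C :: "'a::metric_space set"
  assumes k: "k \<ge> 1" and C: "closed C"
  shows "hausdorff_outer k (A \<inter> C) + hausdorff_outer k (A - C) \<le> hausdorff_outer k A"
\<comment> \<open>\<open>infdist\<close> to the empty set is 0 by convention, so the sets
  \<open>E n\<close> would be empty for \<open>C = {}\<close>; this case is split off.\<close>
proof (cases "hausdorff_outer k A = \<infinity> \<or> C = {}")
  case True
  then show ?thesis by (auto simp: hausdorff_outer_empty[OF k])
next
  case False
  let ?H = "hausdorff_outer k"
  have fin: "?H A < \<infinity>" and ne: "C \<noteq> {}" using False by (auto simp: less_top)
  define E where "E n = {x \<in> A - C. 1 / real (Suc n) \<le> infdist x C}" for n
  define D where "D n = E (Suc n) - E n" for n
  have E_mono: "E n \<subseteq> E (Suc n)" for n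
  proof -
    have "1 / real (Suc (Suc n)) \<le> 1 / real (Suc n)" by (rule frac_le) auto
    then show ?thesis unfolding E_def by auto
  qed
  have E_mono': "n \<le> l \<Longrightarrow> E n \<subseteq> E l" for n l
    using E_mono lift_Suc_mono_le[of E] by blast
  have E_sub: "E n \<subseteq> A" "E n \<inter> C = {}" for n by (auto simp: E_def)
  have sepC: "?H (A \<inter> C) + ?H (E n) \<le> ?H A" for n
  proof -
    have "?H (A \<inter> C) + ?H (E n) \<le> ?H (A \<inter> C \<union> E n)"
    proof (rule hausdorff_outer_separated[OF k, of "1 / real (Suc n)"])
      fix x y assume "x \<in> A \<inter> C" "y \<in> E n"
      then show "1 / real (Suc n) \<le> dist x y"
        using infdist_le[of x C y] by (auto simp: E_def dist_commute)
    qed auto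
    also have "\<dots> \<le> ?H A" using E_sub by (intro hausdorff_outer_mono) auto
    finally show ?thesis .
  qed
  have sepD: "1 / real (Suc n) - 1 / real (Suc (Suc n)) \<le> dist x y"
    if "x \<in> E n" "y \<in> D l" "l \<ge> Suc n" for x y n l
  proof -
    have "y \<notin> E (Suc n)" using that E_mono'[of "Suc n" l] by (auto simp: D_def)
    moreover have "y \<in> A - C" using that by (auto simp: D_def E_def)
    ultimately have "infdist y C < 1 / real (Suc (Suc n))" by (auto simp: E_def)
    moreover have "1 / real (Suc n) \<le> infdist x C" using that by (auto simp: E_def)
    moreover have "infdist x C \<le> infdist y C + dist x y" by (rule infdist_triangle)
    ultimately show ?thesis by linarith
  qed
  \<comment> \<open>The parity \<open>p\<close> is 0 or 1. The layer \<open>D (2n + p + 1)\<close>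
    lies in \<open>E (2n + p + 2)\<close> and is at positive distance from
    \<open>E (2n + p)\<close>, so each induction step adds measures exactly as
    \<open>hausdorff_outer_separated\<close> allows.\<close>
  have Dsum: "(\<Sum>j<n. ?H (D (Suc (2 * j + p)))) \<le> ?H (E (2 * n + p))" for n p
  proof (induction n)
    case 0 then show ?case by simp
  next
    case (Suc n)
    have "(\<Sum>j<Suc n. ?H (D (Suc (2 * j + p)))) \<le> ?H (E (2*n+p)) + ?H (D (Suc (2 * n + p)))"
      using Suc by (simp add: add_mono)
    also have "\<dots> \<le> ?H (E (2*n+p) \<union> D (Suc (2 * n + p)))"
    proof (rule hausdorff_outer_separated[OF k])
      show "1 / real (Suc (2*n+p)) - 1 / real (Suc (Suc (2*n+p))) > 0" by (simp add: frac_less2)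
    qed (use sepD in blast)
    also have "\<dots> \<le> ?H (E (2 * Suc n + p))"
      using E_mono'[of "2*n+p" "2 * Suc n + p"] by (intro hausdorff_outer_mono) (auto simp: D_def)
    finally show ?case .
  qed
  define f where "f i = ?H (D (Suc i))" for i
  have "(\<Sum>i<n. f i) \<le> ?H A + ?H A" for n
  proof -
    have "(\<Sum>i<n. f i) \<le> (\<Sum>i<2*n. f i)" by (rule sum_mono2) auto
    also have "\<dots> = (\<Sum>j<n. f (2*j)) + (\<Sum>j<n. f (2*j+1))"
      by (induction n) (auto simp: ac_simps)
    also have "\<dots> \<le> ?H (E (2*n+0)) + ?H (E (2*n+1))"
      unfolding f_def using Dsum[of 0 n] Dsum[of 1 n] by (intro add_mono) auto
    also have "\<dots> \<le> ?H A + ?H A" using E_sub by (intro add_mono hausdorff_outer_mono)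
    finally show ?thesis .
  qed
  then have "(\<Sum>i. f i) \<le> ?H A + ?H A" by (intro suminf_le_const summableI)
  with fin have f_fin: "(\<Sum>i. f i) \<noteq> top" by (auto simp: top_unique)
  define g where "g i = enn2real (f i)" for i
  have fg: "f i = ennreal (g i)" for i
    using f_fin ennreal_suminf_lessD[of f top i] by (auto simp: g_def less_top)
  have g0: "0 \<le> g i" for i by (simp add: g_def)
  have g: "summable g" "\<And>i. 0 \<le> g i"
    using f_fin g0 summable_suminf_not_top[of g] unfolding fg by auto
  show ?thesis
  proof (rule ennreal_le_epsilon)
    fix e :: real assume "0 < e"
    from suminf_exist_split[OF this g(1)] obtain n where n: "norm (\<Sum>i. g (i + n)) < e" by auto
    have sg: "summable (\<lambda>i. g (i + n))" using g(1) by (simp add: summable_iff_shift)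
    have tail: "(\<Sum>i. f (i + n)) \<le> ennreal e"
      using n sg g(2) by (simp add: fg suminf_ennreal2 abs_of_nonneg suminf_nonneg ennreal_leI)
    have "A - C \<subseteq> E (Suc n) \<union> (\<Union>i. D (Suc (i + n)))"
    proof
      fix x assume x: "x \<in> A - C"
      then have "infdist x C > 0"
        using C ne by (metis DiffD2 in_closed_iff_infdist_zero infdist_nonneg less_eq_real_def)
      then obtain l where l: "1 / real (Suc l) < infdist x C"
        using reals_Archimedean by (metis inverse_eq_divide)
      then have "\<exists>l. x \<in> E l" using x by (auto simp: E_def intro!: exI[of _ l])
      define j where "j = (LEAST l. x \<in> E l)"
      have j: "x \<in> E j" "\<And>i. i < j \<Longrightarrow> x \<notin> E i"
        using \<open>\<exists>l. x \<in> E l\<close> not_less_Least by (auto simp: j_def intro: LeastI_ex)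
      show "x \<in> E (Suc n) \<union> (\<Union>i. D (Suc (i + n)))"
      proof (cases "j \<le> Suc n")
        case True then show ?thesis using j(1) E_mono' by blast
      next
        case False
        then have "j = Suc (Suc (j - Suc (Suc n) + n))" by auto
        then have "x \<in> D (Suc (j - Suc (Suc n) + n))" unfolding D_def using j
          by (metis DiffI lessI)
        then show ?thesis by blast
      qed
    qed
    then have "?H (A - C) \<le> ?H (E (Suc n) \<union> (\<Union>i. D (Suc (i + n))))" by (rule hausdorff_outer_mono)
    also have "\<dots> \<le> ?H (E (Suc n)) + (\<Sum>i. f (i + n))"
      unfolding f_def
      by (rule order_trans[OF hausdorff_outer_Un[OF k] add_left_mono[OF hausdorff_outer_UN]])
    also have "\<dots> \<le> ?H (E (Suc n)) + e" using tail by (rule add_left_mono)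
    finally have "?H (A \<inter> C) + ?H (A - C) \<le> ?H (A \<inter> C) + ?H (E (Suc n)) + e"
      by (simp add: add_left_mono add.assoc)
    also have "\<dots> \<le> ?H A + e" by (rule add_right_mono[OF sepC])
    finally show "?H (A \<inter> C) + ?H (A - C) \<le> ?H A + e" .
  qed
qed

text \<open>Caratheodory's construction gives a measure on the \<open>lambda_system\<close>; this
  contains the closed sets by \<open>hausdorff_outer_closed_split\<close>, hence all Borel
  sets.\<close>

lemma measure_space_hausdorff:
  assumes k: "k \<ge> 1"
  shows "measure_space UNIV (sets borel) (hausdorff_outer k :: 'a::metric_space set \<Rightarrow> ennreal)"
proof -
  let ?H = "hausdorff_outer k :: 'a set \<Rightarrow> ennreal"
  interpret P: sigma_algebra "UNIV :: 'a set" UNIV using sigma_algebra_Pow[of UNIV] by simp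
  have "outer_measure_space UNIV ?H"
    by (auto simp: outer_measure_space_def positive_def increasing_def countably_subadditive_def
        hausdorff_outer_empty[OF k] intro: hausdorff_outer_mono hausdorff_outer_UN)
  from P.caratheodory_lemma[OF this]
  have ms: "measure_space UNIV (lambda_system UNIV UNIV ?H) ?H" .
  then interpret L: sigma_algebra UNIV "lambda_system UNIV UNIV ?H" by (simp add: measure_space_def)
  have "C \<in> lambda_system UNIV UNIV ?H" if "closed C" for C
    unfolding P.lambda_system_eq
  proof (intro CollectI conjI ballI)
    fix A :: "'a set"
    show "?H (A \<inter> C) + ?H (A - C) = ?H A"
      using hausdorff_outer_closed_split[OF k that, of A] hausdorff_outer_Un[OF k, of "A \<inter> C" "A - C"]
      by (simp add: Int_Diff_Un antisym)
  qed auto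
  then have "sets borel \<subseteq> lambda_system UNIV UNIV ?H"
    unfolding borel_eq_closed by (subst sets_measure_of) (auto intro!: L.sigma_sets_subset)
  then show ?thesis
    using measure_down[OF ms] sets.sigma_algebra_axioms[of "borel :: 'a measure"] by simp
qed

lemma sets_hausdorff_measure [measurable_cong]: "sets (hausdorff_measure k) = sets borel"
  by (simp add: hausdorff_measure_def sets.sigma_sets_eq[of borel, simplified])

lemma space_hausdorff_measure [simp]: "space (hausdorff_measure k) = UNIV"
  by (simp add: hausdorff_measure_def)

lemma emeasure_hausdorff_measure:
  assumes "k \<ge> 1" "A \<in> sets borel"
  shows "emeasure (hausdorff_measure k) A = hausdorff_outer k A"
proof (rule emeasure_measure_of[OF hausdorff_measure_def])
  show "positive (sets (hausdorff_measure k)) (hausdorff_outer k)"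
    "countably_additive (sets (hausdorff_measure k)) (hausdorff_outer k)"
    using measure_space_hausdorff[OF assms(1)] by (auto simp: measure_space_def sets_hausdorff_measure)
qed (use assms in \<open>auto simp: sets_hausdorff_measure\<close>)

section \<open>Invariance under isometries\<close>

lemma hausdorff_outer_isometry_le:
  fixes T :: "'a::metric_space \<Rightarrow> 'b::metric_space"
  assumes T: "\<And>x y. dist (T x) (T y) = dist x y"
  shows "hausdorff_outer k (T ` A) \<le> hausdorff_outer k A"
proof -
  have d: "diameter (T ` C) = diameter C" for C
    
  proof -
    have "(\<lambda>(x, y). dist x y) ` (T ` C \<times> T ` C) = (\<lambda>(x, y). dist x y) ` (C \<times> C)"
      using T by (force simp: image_iff)
    then show ?thesis by (simp add: diameter_def)
  qed
  have b: "bounded (T ` C)" if "bounded C" for C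
    using that unfolding bounded_def by (metis T imageE)
  have "hausdorff_pre k \<delta> (T ` A) \<le> hausdorff_pre k \<delta> A" for \<delta>
    unfolding hausdorff_pre_def[of k \<delta> A]
  proof (rule INF_greatest)
    fix C assume "C \<in> fine_covers \<delta> A"
    then have "(\<lambda>i. T ` C i) \<in> fine_covers \<delta> (T ` A)"
      using image_mono[of A "\<Union>i. C i" T] unfolding fine_covers_def image_UN mem_Collect_eq
      by (metis (no_types, lifting) b d)
    from hausdorff_pre_le[OF this, of k] show "hausdorff_pre k \<delta> (T ` A) \<le> (\<Sum>i. set_cost k (C i))"
      by (simp add: set_cost_def d)
  qed
  then show ?thesis unfolding hausdorff_outer_eq by (intro SUP_mono) auto
qed

lemma hausdorff_outer_orthogonal:
  fixes T :: "'a::euclidean_space \<Rightarrow> 'a"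
  assumes T: "orthogonal_transformation T"
  shows "hausdorff_outer k (T ` A) = hausdorff_outer k A"
proof (rule antisym)
  have iso: "dist (f x) (f y) = dist x y" if "orthogonal_transformation f" for f :: "'a \<Rightarrow> 'a" and x y
    using that orthogonal_transformation_isometry by blast
  show "hausdorff_outer k (T ` A) \<le> hausdorff_outer k A"
    by (rule hausdorff_outer_isometry_le) (rule iso[OF T])
  have "hausdorff_outer k (inv T ` (T ` A)) \<le> hausdorff_outer k (T ` A)"
    by (rule hausdorff_outer_isometry_le) (rule iso[OF orthogonal_transformation_inv[OF T]])
  then show "hausdorff_outer k A \<le> hausdorff_outer k (T ` A)"
    using orthogonal_transformation_inj[OF T] by (simp add: image_inv_f_f)
qed

section \<open>Spheres have finite and positive Hausdorff measure\<close>

lemma power_diff_le: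
  fixes a b :: real
  assumes "0 \<le> b" "b \<le> a"
  shows "a ^ Suc n - b ^ Suc n \<le> real (Suc n) * (a - b) * a ^ n"
proof (induction n)
  case (Suc n)
  have "a ^ Suc (Suc n) - b ^ Suc (Suc n) = a * (a ^ Suc n - b ^ Suc n) + (a - b) * b ^ Suc n"
    by (simp add: algebra_simps)
  also have "\<dots> \<le> a * (real (Suc n) * (a - b) * a ^ n) + (a - b) * a ^ Suc n"
    using assms Suc by (intro add_mono mult_left_mono power_mono) auto
  also have "\<dots> = real (Suc (Suc n)) * (a - b) * a ^ Suc n" by (simp add: algebra_simps)
  finally show ?case .
qed simp

text \<open>Packing by volume: disjoint balls of radius \<open>\<rho>\<close> centred on the sphere
  lie in a shell of thickness \<open>2 * \<rho>\<close>, whose volume is bounded by a constant times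
  \<open>\<rho>\<close>. Dividing by the volume of one ball leaves the exponent
  \<open>DIM('a) - 1\<close>.\<close>

lemma card_disjoint_cballs_sphere:
  fixes F :: "'a::euclidean_space set" and R \<rho> :: real
  assumes \<rho>: "0 < \<rho>" "\<rho> \<le> R" and F: "finite F" "F \<subseteq> sphere 0 R"
    and disj: "pairwise (\<lambda>x y. disjnt (cball x \<rho>) (cball y \<rho>)) F"
  shows "real (card F) * \<rho> ^ (DIM('a) - 1) \<le> 2 * real DIM('a) * (2 * R) ^ (DIM('a) - 1)"
proof -
  let ?v = "unit_ball_vol (real DIM('a))"
  have v: "?v > 0" by (rule unit_ball_vol_pos) simp
  have D: "DIM('a) = Suc (DIM('a) - 1)" using DIM_positive[where 'a='a] by linarith
  have pw: "\<rho> ^ DIM('a) = \<rho> * \<rho> ^ (DIM('a) - 1)" by (metis D power_Suc)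
  have "real (card F) * (?v * \<rho> ^ DIM('a)) = (\<Sum>x\<in>F. measure lborel (cball x \<rho>))"
    using \<rho> by (simp add: content_cball)
  also have "\<dots> = measure lborel (\<Union>x\<in>F. cball x \<rho>)"
    by (rule measure_UNION'[symmetric]) (use F disj in \<open>auto intro!: fmeasurableI simp: emeasure_bounded_finite[unfolded infinity_ennreal_def]\<close>)
  also have "\<dots> \<le> measure lborel (cball 0 (R + \<rho>) - ball (0::'a) (R - \<rho>))"
  proof (rule measure_mono_fmeasurable)
    show "(\<Union>x\<in>F. cball x \<rho>) \<subseteq> cball 0 (R + \<rho>) - ball (0::'a) (R - \<rho>)"
    proof safe
      fix x y assume x: "x \<in> F" and y: "y \<in> cball x \<rho>"
      then have "norm x = R" "dist x y \<le> \<rho>" using F by auto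
      then show "y \<in> cball 0 (R + \<rho>)" "y \<in> ball 0 (R - \<rho>) \<Longrightarrow> False"
        using norm_triangle_ineq2[of y x] norm_triangle_ineq2[of x y]
        by (auto simp: dist_norm norm_minus_commute)
    qed
    show "(\<Union>x\<in>F. cball x \<rho>) \<in> sets lborel" using F by (intro sets.finite_UN) auto
  qed (auto intro!: fmeasurableI emeasure_bounded_finite[unfolded infinity_ennreal_def] bounded_diff)
  also have "\<dots> = measure lborel (cball (0::'a) (R + \<rho>)) - measure lborel (ball (0::'a) (R - \<rho>))"
    using \<rho> by (intro measure_Diff) (auto intro!: order_trans[OF ball_subset_cball subset_cball] simp: emeasure_cball)
  also have "\<dots> = ?v * ((R + \<rho>) ^ DIM('a) - (R - \<rho>) ^ DIM('a))"
    using \<rho> by (simp add: content_cball content_ball algebra_simps)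
  finally have "real (card F) * \<rho> ^ DIM('a) \<le> (R + \<rho>) ^ DIM('a) - (R - \<rho>) ^ DIM('a)"
    using v by (metis mult.left_commute mult_le_cancel_left_pos)
  also have "\<dots> \<le> real DIM('a) * (2 * \<rho>) * (R + \<rho>) ^ (DIM('a) - 1)"
    using power_diff_le[of "R - \<rho>" "R + \<rho>" "DIM('a) - 1", folded D] \<rho> by simp
  also have "\<dots> \<le> real DIM('a) * (2 * \<rho>) * (2 * R) ^ (DIM('a) - 1)"
    using \<rho> by (intro mult_left_mono power_mono) auto
  finally have "\<rho> * (real (card F) * \<rho> ^ (DIM('a) - 1)) \<le> \<rho> * (2 * real DIM('a) * (2 * R) ^ (DIM('a) - 1))"
    unfolding pw by (simp only: ac_simps)
  then show ?thesis using \<rho> by simp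
qed

text \<open>Vitali's lemma gives disjoint balls centred on the sphere whose fivefold enlargements
  cover it. The packing bound controls their number, so the cost of the cover is bounded
  independently of \<open>\<delta>\<close>.\<close>

lemma hausdorff_outer_sphere_finite:
  assumes "R > 0" and dim: "DIM('a) \<ge> 2"
  shows "hausdorff_outer (DIM('a) - 1) (sphere (0::'a::euclidean_space) R) < \<infinity>"
proof -
  let ?k = "DIM('a) - 1"
  define K where "K = unit_ball_vol (real ?k) * 5 ^ ?k * (2 * real DIM('a) * (2 * R) ^ ?k)"
  have "hausdorff_pre ?k \<delta> (sphere (0::'a) R) \<le> ennreal K" if "\<delta> > 0" for \<delta>
  proof -
    \<comment> \<open>The enlarged balls have diameter \<open>10 * \<rho>\<close>, which must not
      exceed \<open>\<delta>\<close>; the minimum with \<open>R\<close> meets the hypothesis of the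
      packing bound.\<close>
    define \<rho> where "\<rho> = min R (\<delta> / 10)"
    have \<rho>: "0 < \<rho>" "\<rho> \<le> R" "10 * \<rho> \<le> \<delta>" using that \<open>R > 0\<close> by (auto simp: \<rho>_def)
    obtain C where C: "countable C" "C \<subseteq> sphere (0::'a) R"
        "pairwise (\<lambda>i j. disjnt (cball i \<rho>) (cball j \<rho>)) C"
        "sphere 0 R \<subseteq> (\<Union>i\<in>C. cball i (5 * \<rho>))"
      by (rule Vitali_covering_lemma_cballs[where S="sphere (0::'a) R" and K="sphere 0 R" and a="\<lambda>x. x" and r="\<lambda>_. \<rho>" and B=\<rho>])
         (use \<rho> in auto)
    have bound: "real (card F) * \<rho> ^ ?k \<le> 2 * real DIM('a) * (2 * R) ^ ?k" if "finite F" "F \<subseteq> C" for F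
      using that C by (intro card_disjoint_cballs_sphere \<rho>) (auto intro: pairwise_subset)
    have "finite C"
    proof (rule ccontr)
      assume "infinite C"
      define n where "n = nat \<lceil>2 * real DIM('a) * (2 * R) ^ ?k / \<rho> ^ ?k\<rceil> + 1"
      obtain F where "F \<subseteq> C" "card F = n" "finite F"
        using infinite_arbitrarily_large[OF \<open>infinite C\<close>] by blast
      then have "real n * \<rho> ^ ?k \<le> 2 * real DIM('a) * (2 * R) ^ ?k" using bound by blast
      then have "real n \<le> 2 * real DIM('a) * (2 * R) ^ ?k / \<rho> ^ ?k" using \<rho> by (simp add: pos_le_divide_eq)
      then show False unfolding n_def by linarith
    qed
    then obtain f n where f: "C = f ` {i::nat. i < n}" "inj_on f {i. i < n}"
      using finite_imp_nat_seg_image_inj_on by metis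
    have n: "n = card C" using f by (simp add: card_image)
    define B where "B i = (if i < n then cball (f i) (5 * \<rho>) else {})" for i
    have "B \<in> fine_covers \<delta> (sphere 0 R)"
      using C(4) f(1) \<rho> that by (fastforce simp: fine_covers_def B_def)
    then have "hausdorff_pre ?k \<delta> (sphere (0::'a) R) \<le> (\<Sum>i. set_cost ?k (B i))"
      by (rule hausdorff_pre_le)
    also have "\<dots> = (\<Sum>i<n. set_cost ?k (B i))"
      using dim by (intro suminf_finite) (auto simp: B_def set_cost_empty)
    also have "\<dots> = (\<Sum>i<n. ennreal (unit_ball_vol (real ?k) * (5 * \<rho>) ^ ?k))"
      using \<rho> by (intro sum.cong) (auto simp: B_def set_cost_def)
    also have "\<dots> = ennreal (unit_ball_vol (real ?k) * 5 ^ ?k * (real (card C) * \<rho> ^ ?k))"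
      using \<rho> by (simp add: n ennreal_of_nat_eq_real_of_nat ennreal_mult'[symmetric] power_mult_distrib ac_simps)
    also have "\<dots> \<le> ennreal K"
      unfolding K_def using bound[OF \<open>finite C\<close> subset_refl] by (intro ennreal_leI mult_left_mono) auto
    finally show ?thesis .
  qed
  then have "hausdorff_outer ?k (sphere (0::'a) R) \<le> ennreal K"
    unfolding hausdorff_outer_eq by (intro SUP_least) auto
  then show ?thesis by (rule le_less_trans) simp
qed

text \<open>Project along a basis vector \<open>e\<close>: the image of the sphere contains a cube
  of dimension \<open>DIM('a) - 1\<close>, and a covering set of diameter \<open>d\<close> projects
  into a cube of side \<open>2 * d\<close>. To compare volumes with Lebesgue measure in the full
  space, all cubes are thickened by the interval from 0 to 1 in direction \<open>e\<close>; these
  are the sets \<open>box'\<close>.\<close>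

lemma hausdorff_outer_sphere_pos:
  assumes "R > 0" and dim: "DIM('a) \<ge> 2"
  shows "hausdorff_outer (DIM('a) - 1) (sphere (0::'a::euclidean_space) R) > 0"
proof -
  let ?k = "DIM('a) - 1"
  obtain e :: 'a where e: "e \<in> Basis" using nonempty_Basis by blast
  \<comment> \<open>With this half side the cube lies in the projected ball of radius
    \<open>R\<close>, since the norm is at most the sum of the absolute coordinates.\<close>
  define a where "a = R / real DIM('a)"
  have a: "a > 0" using assms by (simp add: a_def)
  define box' where "box' x d = cbox (\<Sum>b\<in>Basis. (if b = e then 0 else x \<bullet> b - d) *\<^sub>R b)
       (\<Sum>b\<in>Basis. (if b = e then 1 else x \<bullet> b + d) *\<^sub>R b)" for x :: 'a and d
  have mem: "y \<in> box' x d \<longleftrightarrow> (0 \<le> y \<bullet> e \<and> y \<bullet> e \<le> 1 \<and> (\<forall>b\<in>Basis - {e}. \<bar>y \<bullet> b - x \<bullet> b\<bar> \<le> d))" for x y d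
    unfolding box'_def mem_box using e by (auto simp: abs_le_iff algebra_simps)
  have vol: "emeasure lborel (box' x d) = ennreal ((2 * d) ^ ?k)" if "d \<ge> 0" for x d
  proof -
    have "emeasure lborel (box' x d) =
       ennreal (\<Prod>b\<in>Basis. ((\<Sum>b\<in>Basis. (if b = e then 1 else x \<bullet> b + d) *\<^sub>R b) -
         (\<Sum>b\<in>Basis. (if b = e then 0 else x \<bullet> b - d) *\<^sub>R b)) \<bullet> b)"
      unfolding box'_def using that by (intro emeasure_lborel_cbox) auto
    also have "(\<Prod>b\<in>Basis. ((\<Sum>b\<in>Basis. (if b = e then 1 else x \<bullet> b + d) *\<^sub>R b) -
         (\<Sum>b\<in>Basis. (if b = e then 0 else x \<bullet> b - d) *\<^sub>R b)) \<bullet> b) = (\<Prod>b\<in>Basis. if b = e then 1 else 2 * d)"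
      by (intro prod.cong) (auto simp: inner_diff_left)
    also have "\<dots> = (2 * d) ^ ?k"
      using e by (subst prod.remove[of _ e]) (auto simp: card_Diff_singleton)
    finally show ?thesis .
  qed
  \<comment> \<open>The constant solves
    \<open>(2 * d) ^ k = c * (unit_ball_vol k * (d / 2) ^ k)\<close>, the ratio of the volume of a
    thickened cube to the cost of the covering set.\<close>
  define c where "c = 4 ^ ?k / unit_ball_vol (real ?k)"
  have up: "unit_ball_vol (real ?k) > 0" by (rule unit_ball_vol_pos) simp
  have c: "c > 0" using up by (simp add: c_def)
  \<comment> \<open>A bound at the single scale 1 suffices, the outer measure being a supremum over
    scales.\<close>
  have "ennreal ((2 * a) ^ ?k / c) \<le> hausdorff_pre ?k 1 (sphere (0::'a) R)"
    unfolding hausdorff_pre_def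
  proof (rule INF_greatest)
    fix C :: "nat \<Rightarrow> 'a set" assume C: "C \<in> fine_covers 1 (sphere 0 R)"
    define Q where "Q i = (if C i = {} then {} else box' (SOME x. x \<in> C i) (diameter (C i)))" for i
    have bd: "bounded (C i)" for i using C by (auto simp: fine_covers_def)
    have "box' 0 a \<subseteq> (\<Union>i. Q i)"
    proof
      fix y :: 'a assume y: "y \<in> box' 0 a"
      define p where "p = y - (y \<bullet> e) *\<^sub>R e"
      have pb: "p \<bullet> b = y \<bullet> b" if "b \<in> Basis - {e}" for b
        using that e by (auto simp: p_def inner_diff_left inner_Basis)
      have pe: "p \<bullet> e = 0" using e by (simp add: p_def inner_diff_left inner_same_Basis)
      have "norm p \<le> (\<Sum>b\<in>Basis. \<bar>p \<bullet> b\<bar>)" by (rule norm_le_l1)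
      also have "\<dots> \<le> (\<Sum>b\<in>(Basis::'a set). a)"
        
      proof (intro sum_mono)
        fix b :: 'a assume "b \<in> Basis"
        then show "\<bar>p \<bullet> b\<bar> \<le> a" using y a pb[of b] pe by (cases "b = e") (auto simp: mem)
      qed
      also have "\<dots> = R" by (simp add: a_def)
      finally have "norm p \<le> R" .
      then have pR: "(norm p)\<^sup>2 \<le> R\<^sup>2" by (intro power_mono) auto
      \<comment> \<open>\<open>s\<close> is the point of the sphere above the projection
        \<open>p\<close> of \<open>y\<close>. It lies in some covering set \<open>C i\<close>, and
        away from direction \<open>e\<close> it has the same coordinates as
        \<open>y\<close>.\<close>
      define s where "s = p + sqrt (R\<^sup>2 - (norm p)\<^sup>2) *\<^sub>R e"
      have "(norm s)\<^sup>2 = (norm p)\<^sup>2 + (R\<^sup>2 - (norm p)\<^sup>2)"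
        using pR pe e unfolding s_def
        by (simp add: power2_norm_eq_inner inner_add_left inner_add_right inner_commute inner_same_Basis
            power2_eq_square[symmetric])
      then have "norm s = R" using \<open>R > 0\<close> by (simp add: power2_eq_iff_nonneg)
      then obtain i where i: "s \<in> C i" using C by (force simp: fine_covers_def)
      define x where "x = (SOME x. x \<in> C i)"
      have x: "x \<in> C i" unfolding x_def using i by (rule someI)
      have "\<bar>y \<bullet> b - x \<bullet> b\<bar> \<le> diameter (C i)" if b: "b \<in> Basis - {e}" for b
      proof -
        have "s \<bullet> b = y \<bullet> b" using b e pb[OF b] by (auto simp: s_def inner_add_left inner_Basis)
        then have "\<bar>y \<bullet> b - x \<bullet> b\<bar> = \<bar>(s - x) \<bullet> b\<bar>" by (simp add: inner_diff_left)
        also have "\<dots> \<le> norm (s - x)" using b by (intro Basis_le_norm) auto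
        also have "\<dots> \<le> diameter (C i)" using diameter_bounded_bound[OF bd i x] by (simp add: dist_norm)
        finally show ?thesis .
      qed
      then have "y \<in> Q i" using y i by (auto simp: Q_def mem x_def)
      then show "y \<in> (\<Union>i. Q i)" by blast
    qed
    then have "emeasure lborel (box' 0 a) \<le> emeasure lborel (\<Union>i. Q i)"
      by (rule emeasure_mono) (auto simp: Q_def box'_def)
    also have "\<dots> \<le> (\<Sum>i. emeasure lborel (Q i))"
      by (rule emeasure_subadditive_countably) (auto simp: Q_def box'_def)
    also have "\<dots> \<le> (\<Sum>i. ennreal c * set_cost ?k (C i))"
    proof (intro suminf_le allI)
      fix i
      have "emeasure lborel (Q i) \<le> ennreal ((2 * diameter (C i)) ^ ?k)"
        using vol diameter_ge_0[OF bd] by (auto simp: Q_def)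
      also have "(2 * diameter (C i)) ^ ?k = c * (unit_ball_vol (real ?k) * (diameter (C i) / 2) ^ ?k)"
      proof -
        have "(2 * diameter (C i)) ^ ?k = (4 * (diameter (C i) / 2)) ^ ?k" by simp
        also have "\<dots> = 4 ^ ?k * (diameter (C i) / 2) ^ ?k" by (rule power_mult_distrib)
        finally have pw: "(2 * diameter (C i)) ^ ?k = 4 ^ ?k * (diameter (C i) / 2) ^ ?k" .
        have scal: "x = y * z \<Longrightarrow> V > 0 \<Longrightarrow> x = y / V * (V * z)" for x y z V :: real by simp
        show ?thesis unfolding c_def by (rule scal[OF pw up])
      qed
      also have "ennreal \<dots> = ennreal c * set_cost ?k (C i)"
        unfolding set_cost_def using c by (simp add: ennreal_mult')
      finally show "emeasure lborel (Q i) \<le> ennreal c * set_cost ?k (C i)" .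
    qed auto
    also have "\<dots> = ennreal c * (\<Sum>i. set_cost ?k (C i))" by (rule ennreal_suminf_cmult)
    finally have le: "ennreal ((2 * a) ^ ?k) \<le> ennreal c * (\<Sum>i. set_cost ?k (C i))"
      using vol a by simp
    show "ennreal ((2 * a) ^ ?k / c) \<le> (\<Sum>i. set_cost ?k (C i))"
    proof (cases "\<Sum>i. set_cost ?k (C i)")
      case (real s)
      then have "(2 * a) ^ ?k \<le> c * s"
        using le c by (simp add: ennreal_mult'[symmetric])
      then show ?thesis using c real by (simp add: pos_divide_le_eq mult.commute ennreal_leI)
    qed simp
  qed
  also have "\<dots> \<le> hausdorff_outer ?k (sphere (0::'a) R)" by (rule hausdorff_pre_le_outer) simp
  finally have "ennreal ((2 * a) ^ ?k / c) \<le> hausdorff_outer ?k (sphere (0::'a) R)" .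
  moreover have "0 < ennreal ((2 * a) ^ ?k / c)" using a c by simp
  ultimately show ?thesis by (rule less_le_trans[rotated])
qed


section \<open>Polar coordinates\<close>

text \<open>Vitali's theorem fills \<open>U\<close> up to a null set with disjoint balls.
  \<open>T\<close> maps them to disjoint balls of the same radii and, being an isometry, maps the
  null rest to a null set; so both volumes are the same sum.\<close>

lemma emeasure_lborel_orthogonal_open:
  fixes T :: "'a::euclidean_space \<Rightarrow> 'a"
  assumes T: "orthogonal_transformation T" and U: "open U"
  shows "emeasure lborel (T ` U) = emeasure lborel U"
proof -
  define K where "K = {(x, r::real). 0 < r \<and> ball x r \<subseteq> U}"
  have "\<exists>i. i \<in> K \<and> x \<in> ball (fst i) (snd i) \<and> snd i < d" if "x \<in> U" "0 < d" for x d
  proof -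
    obtain e where "e > 0" "ball x e \<subseteq> U" using U \<open>x \<in> U\<close> open_contains_ball by blast
    then show ?thesis using \<open>0 < d\<close>
      by (intro exI[of _ "(x, min e (d/2))"]) (auto simp: K_def intro: order_trans[OF subset_ball])
  qed
  from Vitali_covering_theorem_balls[of U K fst snd, OF this]
  obtain C where C: "countable C" "C \<subseteq> K"
    "pairwise (\<lambda>i j. disjnt (ball (fst i) (snd i)) (ball (fst j) (snd j))) C"
    "negligible (U - (\<Union>i\<in>C. ball (fst i) (snd i)))" by blast
  have sub: "(\<Union>i\<in>C. ball (fst i) (snd i)) \<subseteq> U" using C(2) by (force simp: K_def)
  have inj: "inj T" and lin: "linear T" and surj: "surj T"
    using T by (auto simp: orthogonal_transformation_inj orthogonal_transformation_linear orthogonal_transformation_surj)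
  have cont: "continuous_on A T" for A using lin linear_continuous_on linear_conv_bounded_linear by blast
  have op: "open (T ` A)" if "open A" for A
    using that lin surj by (simp add: open_surjective_linear_image)
  \<comment> \<open>Stated for a map \<open>f\<close> of the centres, to be used with
    \<open>T\<close> for the image and with \<open>id\<close> for \<open>U\<close> itself.\<close>
  have *: "emeasure lborel V = (\<integral>\<^sup>+i. ennreal (unit_ball_vol DIM('a) * snd i ^ DIM('a)) \<partial>count_space C)"
    if V: "open V" "(\<Union>i\<in>C. ball (f (fst i)) (snd i)) \<subseteq> V" "negligible (V - (\<Union>i\<in>C. ball (f (fst i)) (snd i)))"
      and disj: "disjoint_family_on (\<lambda>i. ball (f (fst i)) (snd i)) C" for V and f :: "'a \<Rightarrow> 'a"
  proof -
    let ?W = "\<Union>i\<in>C. ball (f (fst i)) (snd i)"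
    have W: "open ?W" by auto
    have "V - ?W \<in> null_sets lborel"
      using V W by (auto simp: negligible_iff_null_sets null_sets_completion_iff)
    then have "emeasure lborel V = emeasure lborel ?W"
      using emeasure_Un_null_set[of ?W lborel "V - ?W"] W V by (simp add: Un_absorb1)
    also have "\<dots> = (\<integral>\<^sup>+i. emeasure lborel (ball (f (fst i)) (snd i)) \<partial>count_space C)"
      by (rule emeasure_UN_countable) (use C disj in auto)
    also have "\<dots> = (\<integral>\<^sup>+i. ennreal (unit_ball_vol DIM('a) * snd i ^ DIM('a)) \<partial>count_space C)"
      using C(2) by (intro nn_integral_cong) (auto simp: emeasure_ball K_def split_beta)
    finally show ?thesis .
  qed
  have d1: "disjoint_family_on (\<lambda>i. ball (id (fst i)) (snd i)) C"
    using C(3) unfolding disjoint_family_on_def pairwise_def disjnt_def by auto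
  have TB: "ball (T (fst i)) (snd i) = T ` ball (fst i) (snd i)" for i
    using T by (simp add: image_orthogonal_transformation_ball)
  have d2: "disjoint_family_on (\<lambda>i. ball (T (fst i)) (snd i)) C"
    using C(3) inj unfolding disjoint_family_on_def pairwise_def disjnt_def TB
    by (metis image_Int image_empty)
  have neg: "negligible (T ` (U - (\<Union>i\<in>C. ball (fst i) (snd i))))"
  proof (rule negligible_locally_Lipschitz_image[OF _ C(4)])
    fix x
    show "\<exists>V B. open V \<and> x \<in> V \<and> (\<forall>y\<in>(U - (\<Union>i\<in>C. ball (fst i) (snd i))) \<inter> V. norm (T y - T x) \<le> B * norm (y - x))"
      using T by (intro exI[of _ UNIV] exI[of _ 1])
        (auto simp: orthogonal_transformation_isometry simp flip: dist_norm)
  qed simp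
  have TU: "T ` U - (\<Union>i\<in>C. ball (T (fst i)) (snd i)) = T ` (U - (\<Union>i\<in>C. ball (fst i) (snd i)))"
    unfolding TB image_set_diff[OF inj] image_UN ..
  have "emeasure lborel (T ` U) = (\<integral>\<^sup>+i. ennreal (unit_ball_vol DIM('a) * snd i ^ DIM('a)) \<partial>count_space C)"
  proof (rule *[OF op[OF U] _ _ d2])
    show "(\<Union>i\<in>C. ball (T (fst i)) (snd i)) \<subseteq> T ` U" using sub by (auto simp: TB)
    show "negligible (T ` U - (\<Union>i\<in>C. ball (T (fst i)) (snd i)))" using neg by (simp only: TU)
  qed
  also have "\<dots> = emeasure lborel U"
    using U d1 C(4) sub by (intro *[of U id, symmetric]) auto
  finally show ?thesis .
qed

lemma borel_measurable_orthogonal: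
  fixes T :: "'a::euclidean_space \<Rightarrow> 'a"
  shows "orthogonal_transformation T \<Longrightarrow> T \<in> borel_measurable borel"
  by (intro borel_measurable_continuous_onI linear_continuous_on)
     (simp add: orthogonal_transformation_linear linear_conv_bounded_linear[symmetric])

lemma distr_lborel_orthogonal:
  fixes T :: "'a::euclidean_space \<Rightarrow> 'a"
  assumes T: "orthogonal_transformation T"
  shows "distr lborel borel T = lborel"
proof (rule lborel_eqI[symmetric])
  note [measurable] = borel_measurable_orthogonal[OF T]
  have bij: "bij T" by (rule orthogonal_transformation_bij[OF T])
  fix l u :: 'a assume le: "\<And>b. b \<in> Basis \<Longrightarrow> l \<bullet> b \<le> u \<bullet> b"
  have "emeasure (distr lborel borel T) (box l u) = emeasure lborel (inv T ` box l u)"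
    by (simp add: emeasure_distr bij_vimage_eq_inv_image[OF bij])
  also have "\<dots> = emeasure lborel (box l u)"
    by (rule emeasure_lborel_orthogonal_open[OF orthogonal_transformation_inv[OF T] open_box])
  finally show "emeasure (distr lborel borel T) (box l u) = (\<Prod>b\<in>Basis. (u - l) \<bullet> b)"
    using le by simp
qed simp

lemma emeasure_lborel_scaleR:
  fixes A :: "'a::euclidean_space set"
  assumes "A \<in> sets borel" "c > 0"
  shows "emeasure lborel {x. x /\<^sub>R c \<in> A} = ennreal (c ^ DIM('a)) * emeasure lborel A"
proof -
  have [measurable]: "A \<in> sets borel" by fact
  have "emeasure lborel A = emeasure (density (distr lborel borel (\<lambda>x. 0 + (1/c) *\<^sub>R x)) (\<lambda>_. \<bar>1/c\<bar> ^ DIM('a))) A"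
    using lborel_affine[of "1/c" "0::'a"] assms(2) by simp
  also have "\<dots> = ennreal ((1/c) ^ DIM('a)) * emeasure lborel {x. x /\<^sub>R c \<in> A}"
    using assms(2) by (simp add: emeasure_density nn_integral_cmult emeasure_distr vimage_def divide_inverse ennreal_power[symmetric])
  finally have "ennreal (c ^ DIM('a)) * emeasure lborel A
      = ennreal (c ^ DIM('a) * (1/c) ^ DIM('a)) * emeasure lborel {x. x /\<^sub>R c \<in> A}"
    using assms(2) by (simp add: ennreal_mult' mult.assoc)
  then show ?thesis using assms(2) by (simp add: power_one_over)
qed

section \<open>Cone measure, radial measure and the polar decomposition of Lebesgue measure\<close>

text \<open>A set of directions is weighed by the volume of the cone over it in the unit ball; the
  classical surface measure of the unit sphere is \<open>DIM('a)\<close> times this. The origin is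
  sent to \<open>sgn 0 = 0\<close>, but it is a null set.\<close>

definition cone_measure :: "'a::euclidean_space measure" where
  "cone_measure = distr (restrict_space lborel (cball 0 1)) borel sgn"

lemma sets_cone_measure [measurable_cong, simp]: "sets cone_measure = sets borel"
  by (simp add: cone_measure_def)

lemma space_cone_measure [simp]: "space cone_measure = UNIV"
  by (simp add: cone_measure_def)

lemma emeasure_cone_measure:
  fixes A :: "'a::euclidean_space set"
  assumes [measurable]: "A \<in> sets borel"
  shows "emeasure cone_measure A = emeasure lborel {x. norm x \<le> 1 \<and> sgn x \<in> A}"
proof -
  have "emeasure cone_measure A = emeasure (restrict_space lborel (cball 0 1)) {x \<in> cball 0 1. sgn x \<in> A}"
    unfolding cone_measure_def
    by (subst emeasure_distr) (auto intro!: arg_cong2[where f=emeasure] measurable_restrict_space1 simp: space_restrict_space)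
  also have "\<dots> = emeasure lborel {x \<in> cball 0 1. sgn x \<in> A}"
    by (rule emeasure_restrict_space) auto
  finally show ?thesis by (simp add: mem_cball dist_norm)
qed

lemma finite_cone_measure: "finite_measure (cone_measure :: 'a::euclidean_space measure)"
proof
  have "emeasure cone_measure (UNIV :: 'a set) = emeasure lborel (cball (0::'a) 1)"
    by (subst emeasure_cone_measure) (auto intro!: arg_cong2[where f=emeasure] simp: dist_norm)
  then show "emeasure (cone_measure :: 'a measure) (space cone_measure) \<noteq> \<infinity>"
    using emeasure_bounded_finite[OF bounded_cball, of "0::'a" 1] by simp
qed

lemma AE_cone_measure: "AE x in (cone_measure :: 'a::euclidean_space measure). norm x = 1"
proof (rule AE_I)
  show "{x \<in> space cone_measure. norm x \<noteq> 1} \<subseteq> {x::'a. norm x \<noteq> 1}" by auto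
  have "{x. norm x \<le> 1 \<and> sgn x \<in> {x::'a. norm x \<noteq> 1}} \<subseteq> {0}" by (auto simp: norm_sgn split: if_splits)
  then have "emeasure lborel {x. norm x \<le> 1 \<and> sgn x \<in> {x::'a. norm x \<noteq> 1}} \<le> emeasure lborel {0::'a}"
    by (intro emeasure_mono) auto
  then show "emeasure cone_measure {x::'a. norm x \<noteq> 1} = 0"
    by (subst emeasure_cone_measure) auto
qed auto

text \<open>The cone over the ball contains a neighbourhood of the point
  \<open>(1/2) *\<^sub>R \<omega>\<close>, because \<open>sgn\<close> is continuous off the
  origin.\<close>

lemma emeasure_cone_measure_ball_pos:
  fixes \<omega> :: "'a::euclidean_space"
  assumes "norm \<omega> = 1" "\<epsilon> > 0"
  shows "emeasure cone_measure (ball \<omega> \<epsilon>) > 0"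
proof -
  have "open {x::'a. x \<noteq> 0}" by (simp add: open_Collect_neq)
  moreover have "continuous_on {x::'a. x \<noteq> 0} sgn" unfolding sgn_div_norm by (intro continuous_intros) auto
  ultimately have "open (sgn -` ball \<omega> \<epsilon> \<inter> {x::'a. x \<noteq> 0})"
    using continuous_open_preimage[OF _ _ open_ball] by (metis Int_commute)
  then have "open (ball 0 1 \<inter> (sgn -` ball \<omega> \<epsilon> \<inter> {x::'a. x \<noteq> 0}))" by auto
  moreover have "(1/2) *\<^sub>R \<omega> \<in> ball 0 1 \<inter> (sgn -` ball \<omega> \<epsilon> \<inter> {x::'a. x \<noteq> 0})"
    using assms by (auto simp: sgn_div_norm)
  ultimately obtain r where r: "r > 0" "ball ((1/2) *\<^sub>R \<omega>) r \<subseteq> ball 0 1 \<inter> (sgn -` ball \<omega> \<epsilon> \<inter> {x::'a. x \<noteq> 0})"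
    using open_contains_ball by meson
  have "0 < emeasure lborel (ball ((1/2) *\<^sub>R \<omega>) r)"
    using r(1) by (simp add: emeasure_ball)
  also have "\<dots> \<le> emeasure lborel {x. norm x \<le> 1 \<and> sgn x \<in> ball \<omega> \<epsilon>}"
    using r(2) by (intro emeasure_mono) (auto simp: dist_norm)
  also have "\<dots> = emeasure cone_measure (ball \<omega> \<epsilon>)" by (subst emeasure_cone_measure) auto
  finally show ?thesis .
qed

lemma distr_cone_measure_orthogonal:
  fixes T :: "'a::euclidean_space \<Rightarrow> 'a"
  assumes T: "orthogonal_transformation T"
  shows "distr cone_measure borel T = cone_measure"
proof (rule measure_eqI)
  note [measurable] = borel_measurable_orthogonal[OF T]
  fix A assume "A \<in> sets (distr cone_measure borel T)"
  then have [measurable]: "A \<in> sets borel" by simp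
  have sgnT: "sgn (T x) = T (sgn x)" for x
    using T by (simp add: sgn_div_norm orthogonal_transformation_norm orthogonal_transformation_linear linear_cmul)
  have "T -` A \<in> sets borel" using measurable_sets_borel[of T borel A] by auto
  then have "emeasure (distr cone_measure borel T) A = emeasure lborel {x. norm x \<le> 1 \<and> T (sgn x) \<in> A}"
    by (simp add: emeasure_distr emeasure_cone_measure)
  also have "{x. norm x \<le> 1 \<and> T (sgn x) \<in> A} = T -` {x. norm x \<le> 1 \<and> sgn x \<in> A} \<inter> space lborel"
    using T by (auto simp: sgnT orthogonal_transformation_norm)
  also have "emeasure lborel \<dots> = emeasure (distr lborel borel T) {x. norm x \<le> 1 \<and> sgn x \<in> A}"
    by (rule emeasure_distr[symmetric]) auto
  also have "\<dots> = emeasure cone_measure A"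
    by (simp add: distr_lborel_orthogonal[OF T] emeasure_cone_measure)
  finally show "emeasure (distr cone_measure borel T) A = emeasure cone_measure A" .
qed simp

text \<open>The factor \<open>n\<close> makes \<open>{..t}\<close> have mass \<open>t ^ n\<close>
  for \<open>t \<ge> 0\<close>; it is the factor by which cone measure falls short of surface
  measure.\<close>

definition radial_measure :: "nat \<Rightarrow> real measure" where
  "radial_measure n = density lborel (\<lambda>r. ennreal (indicator {0<..} r * (real n * r ^ (n - 1))))"

lemma emeasure_radial_measure_atMost:
  assumes "n \<ge> 1"
  shows "emeasure (radial_measure n) {..t} = ennreal (max t 0 ^ n)"
proof -
  let ?t = "max t 0"
  have "emeasure (radial_measure n) {..t} = (\<integral>\<^sup>+r. ennreal (indicator {0<..} r * (real n * r ^ (n - 1))) * indicator {..t} r \<partial>lborel)"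
    unfolding radial_measure_def by (rule emeasure_density) auto
  also have "\<dots> = (\<integral>\<^sup>+r. ennreal (real n * r ^ (n - 1)) * indicator {0..?t} r \<partial>lborel)"
    by (intro nn_integral_cong_AE) (use AE_lborel_singleton[of "0::real"] in \<open>eventually_elim, auto split: split_indicator\<close>)
  also have "\<dots> = ennreal (?t ^ n - 0 ^ n)"
    by (rule nn_integral_FTC_Icc) (auto intro!: derivative_eq_intros)
  finally show ?thesis using assms by (simp add: power_0_left)
qed

lemma sigma_finite_radial_measure:
  assumes "n \<ge> 1"
  shows "sigma_finite_measure (radial_measure n)"
proof
  have "(\<Union>i::nat. {..real i}) = UNIV" using real_arch_simple by auto
  then show "\<exists>A. countable A \<and> A \<subseteq> sets (radial_measure n) \<and> \<Union>A = space (radial_measure n) \<and>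
      (\<forall>a\<in>A. emeasure (radial_measure n) a \<noteq> \<infinity>)"
    by (intro exI[of _ "range (\<lambda>i::nat. {..real i})"])
       (auto simp: emeasure_radial_measure_atMost[OF assms], auto simp: radial_measure_def)
qed

text \<open>For a fixed set \<open>A\<close> of directions both sides are measures in the radius. On
  half-lines \<open>{..t}\<close> they agree by scaling: the cone over \<open>A\<close> cut off at
  radius \<open>t\<close> has \<open>t ^ n\<close> times the volume of the one cut off at 1.\<close>

lemma polar_decomposition:
  "cone_measure \<Otimes>\<^sub>M radial_measure DIM('a) =
     distr lborel (borel \<Otimes>\<^sub>M borel) (\<lambda>x::'a::euclidean_space. (sgn x, norm x))"
proof (rule pair_measure_eqI)
  let ?n = "DIM('a)"
  let ?D = "radial_measure ?n"
  interpret C: finite_measure "cone_measure :: 'a measure" by (rule finite_cone_measure)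
  show "sigma_finite_measure (cone_measure :: 'a measure)" ..
  have n1: "?n \<ge> 1" using DIM_positive[where 'a='a] by linarith
  have sD: "sets ?D = sets borel" by (simp add: radial_measure_def)
  show "sigma_finite_measure ?D" by (rule sigma_finite_radial_measure[OF n1])
  show "sets (cone_measure \<Otimes>\<^sub>M ?D) = sets (distr lborel (borel \<Otimes>\<^sub>M borel) (\<lambda>x::'a. (sgn x, norm x)))"
    by (simp add: sD cong: sets_pair_measure_cong)
  fix A :: "'a set" and B assume "A \<in> sets cone_measure" "B \<in> sets ?D"
  then have [measurable]: "A \<in> sets borel" "B \<in> sets borel" by (simp_all add: sD)
  let ?X = "{x::'a. sgn x \<in> A}"
  define N where "N = distr (density lborel (indicator ?X)) borel (norm :: 'a \<Rightarrow> real)"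
  have N: "emeasure N B' = emeasure lborel {x::'a. sgn x \<in> A \<and> norm x \<in> B'}" if [measurable]: "B' \<in> sets borel" for B'
  proof -
    have "emeasure N B' = emeasure (density lborel (indicator ?X)) {x. norm x \<in> B'}"
      unfolding N_def by (subst emeasure_distr) (auto simp: vimage_def)
    also have "\<dots> = (\<integral>\<^sup>+x. indicator ?X x * indicator {x. norm x \<in> B'} x \<partial>lborel)"
      by (rule emeasure_density) auto
    also have "\<dots> = (\<integral>\<^sup>+x. indicator {x::'a. sgn x \<in> A \<and> norm x \<in> B'} x \<partial>lborel)"
      by (intro nn_integral_cong) (auto split: split_indicator)
    also have "\<dots> = emeasure lborel {x::'a. sgn x \<in> A \<and> norm x \<in> B'}"
      by (rule nn_integral_indicator) auto
    finally show ?thesis .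
  qed
  have "scale_measure (emeasure cone_measure A) ?D = N"
  proof (rule measure_eqI_generator_eq[where E="range atMost" and \<Omega>=UNIV and A="\<lambda>n. {..real n}"])
    show "Int_stable (range atMost :: real set set)" by (auto simp: Int_stable_def)
    show "sets (scale_measure (emeasure cone_measure A) ?D) = sigma_sets UNIV (range atMost)"
      "sets N = sigma_sets UNIV (range atMost)"
      by (simp_all add: sD N_def borel_eq_atMost)
    show "(\<Union>i::nat. {..real i}) = UNIV" using real_arch_simple by auto
    have "emeasure cone_measure A \<noteq> top" by simp
    then show "emeasure (scale_measure (emeasure cone_measure A) ?D) {..real i} \<noteq> \<infinity>" for i
      by (simp add: emeasure_radial_measure_atMost[OF n1] ennreal_mult_eq_top_iff)
    fix X :: "real set" assume "X \<in> range atMost"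
    then obtain t where t: "X = {..t}" by auto
    show "emeasure (scale_measure (emeasure cone_measure A) ?D) X = emeasure N X"
    proof (cases "t > 0")
      case True
      have "emeasure N X = emeasure lborel {x::'a. x /\<^sub>R t \<in> {x. norm x \<le> 1 \<and> sgn x \<in> A}}"
        unfolding t using True
        by (subst N) (auto intro!: arg_cong2[where f=emeasure] simp: sgn_scaleR field_simps)
      also have "\<dots> = ennreal (t ^ ?n) * emeasure cone_measure A"
        using True by (subst emeasure_lborel_scaleR) (auto simp: emeasure_cone_measure)
      finally show ?thesis
        using True by (simp add: t emeasure_radial_measure_atMost[OF n1] mult.commute)
    next
      case False
      have "emeasure lborel {x::'a. sgn x \<in> A \<and> norm x \<in> X} \<le> emeasure lborel {0::'a}"
        
      proof (rule emeasure_mono)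
        have "x = 0" if "norm x \<le> t" for x :: 'a
        proof -
          have "norm x = 0" using that False norm_ge_zero[of x] by linarith
          then show ?thesis by simp
        qed
        then show "{x::'a. sgn x \<in> A \<and> norm x \<in> X} \<subseteq> {0}" by (auto simp: t)
      qed simp
      then have "emeasure N X = 0" by (subst N) (auto simp: t)
      then show ?thesis using False n1 by (simp add: t emeasure_radial_measure_atMost[OF n1] max_absorb2 power_0_left)
    qed
  qed auto
  then have "emeasure cone_measure A * emeasure ?D B = emeasure N B"
    by (metis emeasure_scale_measure)
  also have "\<dots> = emeasure (distr lborel (borel \<Otimes>\<^sub>M borel) (\<lambda>x::'a. (sgn x, norm x))) (A \<times> B)"
    by (subst N) (auto simp: emeasure_distr vimage_def intro!: arg_cong2[where f=emeasure])
  finally show "emeasure cone_measure A * emeasure ?D B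
     = emeasure (distr lborel (borel \<Otimes>\<^sub>M borel) (\<lambda>x::'a. (sgn x, norm x))) (A \<times> B)" .
qed


lemma integral_polar:
  fixes f :: "'a::euclidean_space \<Rightarrow> 'b::{banach, second_countable_topology}"
  assumes f: "integrable lborel f"
  shows "integral\<^sup>L lborel f =
    (\<integral>\<omega>. (\<integral>r. (indicator {0<..} r * (real DIM('a) * r ^ (DIM('a) - 1))) *\<^sub>R f (r *\<^sub>R \<omega>) \<partial>lborel) \<partial>cone_measure)"
proof -
  let ?n = "DIM('a)"
  let ?D = "radial_measure ?n"
  let ?M = "distr lborel (borel \<Otimes>\<^sub>M borel) (\<lambda>x::'a. (sgn x, norm x))"
  interpret C: finite_measure "cone_measure :: 'a measure" by (rule finite_cone_measure)
  interpret D: sigma_finite_measure ?D by (rule sigma_finite_radial_measure) (simp add: Suc_leI)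
  interpret pair_sigma_finite "cone_measure :: 'a measure" ?D ..
  have [measurable]: "f \<in> borel_measurable borel" using f by auto
  define h where "h = (\<lambda>(\<omega>::'a, r). f (r *\<^sub>R \<omega>))"
  have [measurable]: "h \<in> borel_measurable (borel \<Otimes>\<^sub>M borel)" unfolding h_def by measurable
  have h: "h (sgn x, norm x) = f x" for x by (cases "x = 0") (simp_all add: h_def sgn_div_norm)
  have "integrable ?M h" using f by (subst integrable_distr_eq) (auto simp: h)
  then have int: "integrable (cone_measure \<Otimes>\<^sub>M ?D) h" by (simp add: polar_decomposition)
  have "integral\<^sup>L lborel f = integral\<^sup>L ?M h"
    by (subst integral_distr) (auto simp: h)
  also have "\<dots> = integral\<^sup>L (cone_measure \<Otimes>\<^sub>M ?D) h" by (simp add: polar_decomposition)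
  also have "\<dots> = (\<integral>\<omega>. (\<integral>r. f (r *\<^sub>R \<omega>) \<partial>?D) \<partial>cone_measure)"
    using integral_fst'[OF int] by (simp add: h_def)
  also have "\<dots> = (\<integral>\<omega>. (\<integral>r. (indicator {0<..} r * (real DIM('a) * r ^ (DIM('a) - 1))) *\<^sub>R f (r *\<^sub>R \<omega>) \<partial>lborel) \<partial>cone_measure)"
    unfolding radial_measure_def
    by (intro Bochner_Integration.integral_cong refl integral_density) (auto split: split_indicator)
  finally show ?thesis .
qed


section \<open>Surface measure on spheres\<close>

lemma integral_norm_bound_AE:
  fixes f :: "'a \<Rightarrow> 'b::{banach, second_countable_topology}"
  assumes "AE x in M. norm (f x) \<le> g x" "integrable M f" "integrable M g"
  shows "norm (\<integral>x. f x \<partial>M) \<le> (\<integral>x. g x \<partial>M)"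
proof -
  have "norm (\<integral>x. f x \<partial>M) \<le> (\<integral>x. norm (f x) \<partial>M)" by (rule integral_norm_bound)
  also have "\<dots> \<le> (\<integral>x. g x \<partial>M)" using assms by (intro integral_mono_AE) auto
  finally show ?thesis .
qed

text \<open>With \<open>K x y\<close> the indicator of \<open>dist x y < d\<close>, Fubini writes
  the two terms as double integrals of \<open>K x y *\<^sub>R h y\<close> and
  \<open>K x y *\<^sub>R h x\<close>, since all balls centred on the sphere weigh \<open>q\<close>
  under \<open>M\<close> and \<open>p\<close> under \<open>N\<close>. Where \<open>K\<close> is
  nonzero the integrands differ by at most \<open>e\<close>.\<close>

lemma ball_average_estimate:
  fixes M N :: "'a::euclidean_space measure" and h :: "'a \<Rightarrow> 'b::{banach, second_countable_topology}"
  assumes fin: "finite_measure M" "finite_measure N"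
    and sets: "sets M = sets borel" "sets N = sets borel"
    and AE: "AE x in M. norm x = R" "AE x in N. norm x = R"
    and p: "\<And>x. norm x = R \<Longrightarrow> measure N (ball x d) = p"
    and q: "\<And>x. norm x = R \<Longrightarrow> measure M (ball x d) = q"
    and h: "h \<in> borel_measurable borel" "\<And>x. norm (h x) \<le> B"
    and e: "e \<ge> 0" "\<And>x y. norm x = R \<Longrightarrow> norm y = R \<Longrightarrow> dist x y < d \<Longrightarrow> norm (h y - h x) \<le> e"
  shows "norm (q *\<^sub>R integral\<^sup>L N h - p *\<^sub>R integral\<^sup>L M h) \<le> e * p * measure M UNIV"
proof -
  interpret M: finite_measure M by fact
  interpret N: finite_measure N by fact
  interpret pair_sigma_finite M N ..
  interpret P: finite_measure "M \<Otimes>\<^sub>M N" by (intro finite_measure_pair_measure fin)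
  note [measurable_cong] = sets
  note [measurable] = h(1)
  have sp: "space M = UNIV" "space N = UNIV" using sets by (auto dest: sets_eq_imp_space_eq)
  define K where "K x y = (if dist x y < d then 1 else 0 :: real)" for x y :: 'a
  have [measurable]: "case_prod K \<in> borel_measurable (borel \<Otimes>\<^sub>M borel)"
    unfolding K_def by measurable
  have KM: "(\<integral>x. K x y \<partial>M) = measure M (ball y d)" for y
  proof -
    have "(\<lambda>x. K x y) = indicator (ball y d)" by (auto simp: K_def dist_commute split: split_indicator)
    then show ?thesis by (simp add: sp)
  qed
  have KN: "(\<integral>y. K x y \<partial>N) = measure N (ball x d)" for x
  proof -
    have "(\<lambda>y. K x y) = indicator (ball x d)" by (auto simp: K_def split: split_indicator)
    then show ?thesis by (simp add: sp)
  qed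
  have K01: "0 \<le> K x y" "K x y \<le> 1" for x y by (auto simp: K_def)
  have B: "0 \<le> B" using h(2)[of 0] norm_ge_zero[of "h 0"] by linarith
  have Kh: "norm (K x y *\<^sub>R h z) \<le> B" for x y z
    using h(2)[of z] B by (auto simp: K_def)
  have i1: "integrable (M \<Otimes>\<^sub>M N) (\<lambda>(x, y). K x y *\<^sub>R h y)"
    by (rule P.integrable_const_bound[where B=B]) (auto simp: Kh split_beta simp del: norm_scaleR)
  have i2: "integrable (M \<Otimes>\<^sub>M N) (\<lambda>(x, y). K x y *\<^sub>R h x)"
    by (rule P.integrable_const_bound[where B=B]) (auto simp: Kh split_beta simp del: norm_scaleR)
  have Kint: "integrable M (\<lambda>x. K x y)" "integrable N (\<lambda>x. K y x)" for y
    using K01 by (auto intro!: M.integrable_const_bound[where B=1] N.integrable_const_bound[where B=1])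
  have "q *\<^sub>R integral\<^sup>L N h = (\<integral>y. q *\<^sub>R h y \<partial>N)" by simp
  also have "\<dots> = (\<integral>y. (\<integral>x. K x y *\<^sub>R h y \<partial>M) \<partial>N)"
  proof (rule integral_cong_AE)
    show "AE y in N. q *\<^sub>R h y = (\<integral>x. K x y *\<^sub>R h y \<partial>M)"
      using AE(2) by eventually_elim (simp add: Kint KM q)
  qed measurable
  also have "\<dots> = (\<integral>x. (\<integral>y. K x y *\<^sub>R h y \<partial>N) \<partial>M)"
    by (rule Fubini_integral[OF i1])
  finally have 1: "q *\<^sub>R integral\<^sup>L N h = (\<integral>x. (\<integral>y. K x y *\<^sub>R h y \<partial>N) \<partial>M)" .
  have "p *\<^sub>R integral\<^sup>L M h = (\<integral>x. p *\<^sub>R h x \<partial>M)" by simp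
  also have "\<dots> = (\<integral>x. (\<integral>y. K x y *\<^sub>R h x \<partial>N) \<partial>M)"
  proof (rule integral_cong_AE)
    show "AE x in M. p *\<^sub>R h x = (\<integral>y. K x y *\<^sub>R h x \<partial>N)"
      using AE(1) by eventually_elim (simp add: Kint KN p)
  qed measurable
  finally have 2: "p *\<^sub>R integral\<^sup>L M h = (\<integral>x. (\<integral>y. K x y *\<^sub>R h x \<partial>N) \<partial>M)" .
  have j: "integrable N (\<lambda>y. K x y *\<^sub>R h y)" "integrable N (\<lambda>y. K x y *\<^sub>R h x)" for x
    by (auto intro!: N.integrable_const_bound[where B=B] simp: Kh simp del: norm_scaleR)
  have "q *\<^sub>R integral\<^sup>L N h - p *\<^sub>R integral\<^sup>L M h
      = (\<integral>x. (\<integral>y. K x y *\<^sub>R h y \<partial>N) - (\<integral>y. K x y *\<^sub>R h x \<partial>N) \<partial>M)"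
    unfolding 1 2 using integrable_fst'[OF i1] integrable_fst'[OF i2]
    by (subst Bochner_Integration.integral_diff) auto
  also have "\<dots> = (\<integral>x. (\<integral>y. K x y *\<^sub>R (h y - h x) \<partial>N) \<partial>M)"
    using j by (simp add: scaleR_diff_right)
  finally have "norm (q *\<^sub>R integral\<^sup>L N h - p *\<^sub>R integral\<^sup>L M h)
      = norm (\<integral>x. (\<integral>y. K x y *\<^sub>R (h y - h x) \<partial>N) \<partial>M)" by simp
  also have "\<dots> \<le> (\<integral>x. e * p \<partial>M)"
  proof (rule integral_norm_bound_AE)
    show "AE x in M. norm (\<integral>y. K x y *\<^sub>R (h y - h x) \<partial>N) \<le> e * p"
      using AE(1)
    proof eventually_elim
      fix x :: 'a assume x: "norm x = R"
      have "norm (\<integral>y. K x y *\<^sub>R (h y - h x) \<partial>N) \<le> (\<integral>y. e * K x y \<partial>N)"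
      proof (rule integral_norm_bound_AE)
        show "AE y in N. norm (K x y *\<^sub>R (h y - h x)) \<le> e * K x y"
          using AE(2) by eventually_elim (use x e in \<open>auto simp: K_def\<close>)
      qed (use Kint in \<open>auto simp: j scaleR_diff_right\<close>)
      also have "\<dots> = e * p" using p[OF x] Kint by (simp add: KN)
      finally show "norm (\<integral>y. K x y *\<^sub>R (h y - h x) \<partial>N) \<le> e * p" .
    qed
  next
    have "integrable M (\<lambda>x. (\<integral>y. K x y *\<^sub>R h y \<partial>N) - (\<integral>y. K x y *\<^sub>R h x \<partial>N))"
      using integrable_fst'[OF i1] integrable_fst'[OF i2] by auto
    then show "integrable M (\<lambda>x. \<integral>y. K x y *\<^sub>R (h y - h x) \<partial>N)"
      using j by (simp add: scaleR_diff_right)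
  qed auto
  also have "\<dots> = e * p * measure M UNIV" by (simp add: sp mult.commute)
  finally show ?thesis .
qed

lemma rotation_invariant_measure_ball:
  fixes M :: "(real^'n) measure"
  assumes sets: "sets M = sets borel"
    and rot: "\<And>T. orthogonal_transformation T \<Longrightarrow> distr M borel T = M"
    and "norm x = norm y"
  shows "measure M (ball x d) = measure M (ball y d)"
proof -
  obtain T where T: "orthogonal_transformation T" "T y = x"
    using orthogonal_transformation_exists[of y x] assms(3) by metis
  note [measurable_cong] = sets
  note [measurable] = borel_measurable_orthogonal[OF T(1)]
  have "measure M (ball x d) = measure (distr M borel T) (ball x d)" by (simp add: rot[OF T(1)])
  also have "\<dots> = measure M (T -` ball x d \<inter> space M)" by (rule measure_distr) auto
  also have "T -` ball x d \<inter> space M = ball y d"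
    using T sets_eq_imp_space_eq[OF sets] by (auto simp flip: T(2) simp: orthogonal_transformation_isometry)
  finally show ?thesis .
qed

text \<open>Average \<open>f\<close> over balls with respect to \<open>N\<close> and exchange the order of integration: by invariance the
  measure of a ball centred on the sphere does not depend on its centre.\<close>

lemma rotation_invariant_integral_eq:
  fixes M N :: "(real^'n) measure" and f :: "real^'n \<Rightarrow> 'b::{banach, second_countable_topology}"
  assumes fin: "finite_measure M" "finite_measure N"
    and sets: "sets M = sets borel" "sets N = sets borel"
    and R: "R \<ge> 0" and AE: "AE x in M. norm x = R" "AE x in N. norm x = R"
    and rot: "\<And>T. orthogonal_transformation T \<Longrightarrow> distr M borel T = M"
      "\<And>T. orthogonal_transformation T \<Longrightarrow> distr N borel T = N"
    and pos: "\<And>x d. norm x = R \<Longrightarrow> d > 0 \<Longrightarrow> emeasure N (ball x d) > 0"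
    and f: "continuous_on UNIV f"
  shows "measure M UNIV *\<^sub>R integral\<^sup>L N f = measure N UNIV *\<^sub>R integral\<^sup>L M f"
proof -
  interpret M: finite_measure M by fact
  interpret N: finite_measure N by fact
  note [measurable_cong] = sets
  have [measurable]: "f \<in> borel_measurable borel" using f by (rule borel_measurable_continuous_onI)
  have sp: "space M = UNIV" "space N = UNIV" using sets by (auto dest: sets_eq_imp_space_eq)
  let ?m = "measure M UNIV" and ?n = "measure N UNIV"
  obtain x0 :: "real^'n" where x0: "norm x0 = R" using vector_choose_size[OF R] by blast
  \<comment> \<open>Cutting \<open>f\<close> off outside the sphere changes neither integral and
    makes it bounded on the whole space.\<close>
  define g where "g x = (if norm x = R then f x else 0)" for x
  have [measurable]: "g \<in> borel_measurable borel" unfolding g_def by measurable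
  have gf: "integral\<^sup>L M f = integral\<^sup>L M g" "integral\<^sup>L N f = integral\<^sup>L N g"
    using AE by (auto intro!: integral_cong_AE simp: g_def)
  have cf: "compact (f ` sphere 0 R)"
    using f by (intro compact_continuous_image) (auto intro: continuous_on_subset)
  obtain B where B: "\<And>x. norm x = R \<Longrightarrow> norm (f x) \<le> B" "B > 0"
    using compact_imp_bounded[OF cf] unfolding bounded_pos by (metis imageI mem_sphere_0)
  have gB: "norm (g x) \<le> B" for x using B by (auto simp: g_def less_imp_le)
  have "norm (?m *\<^sub>R integral\<^sup>L N g - ?n *\<^sub>R integral\<^sup>L M g) \<le> e * (?n * ?m)" if e: "e > 0" for e
  proof -
    have "uniformly_continuous_on (sphere 0 R) f"
      using f by (intro compact_uniformly_continuous) (auto intro: continuous_on_subset)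
    then obtain d where d: "d > 0" "\<And>x y. norm x = R \<Longrightarrow> norm y = R \<Longrightarrow> dist y x < d \<Longrightarrow> dist (f y) (f x) < e"
      using e unfolding uniformly_continuous_on_def by force
    define p where "p = measure N (ball x0 d)"
    define q where "q = measure M (ball x0 d)"
    have p: "measure N (ball x d) = p" if "norm x = R" for x
      unfolding p_def using that x0 by (intro rotation_invariant_measure_ball sets rot) auto
    have q: "measure M (ball x d) = q" if "norm x = R" for x
      unfolding q_def using that x0 by (intro rotation_invariant_measure_ball sets rot) auto
    have "p > 0" using pos[OF x0 d(1)] by (simp add: p_def N.emeasure_eq_measure)
    have 1: "norm (q *\<^sub>R integral\<^sup>L N g - p *\<^sub>R integral\<^sup>L M g) \<le> e * p * ?m"
    proof (rule ball_average_estimate[OF fin sets AE p q _ gB])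
      fix x y :: "real^'n" assume "norm x = R" "norm y = R" "dist x y < d"
      then show "norm (g y - g x) \<le> e" using d(2)[of x y] by (auto simp: g_def dist_norm norm_minus_commute)
    qed (use e in auto)
    \<comment> \<open>The constant function 1 has oscillation 0, so the same estimate turns into the
      exact relation between the ball masses and the total masses.\<close>
    have "norm (q *\<^sub>R integral\<^sup>L N (\<lambda>_. 1::real) - p *\<^sub>R integral\<^sup>L M (\<lambda>_. 1::real)) \<le> 0 * p * ?m"
      by (rule ball_average_estimate[OF fin sets AE p q, where B=1]) auto
    then have qn: "q * ?n = p * ?m" by (simp add: sp)
    have "p *\<^sub>R (?m *\<^sub>R integral\<^sup>L N g - ?n *\<^sub>R integral\<^sup>L M g) = ?n *\<^sub>R (q *\<^sub>R integral\<^sup>L N g - p *\<^sub>R integral\<^sup>L M g)"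
      by (simp add: scaleR_diff_right qn[symmetric] mult.commute)
    then have "p * norm (?m *\<^sub>R integral\<^sup>L N g - ?n *\<^sub>R integral\<^sup>L M g) = ?n * norm (q *\<^sub>R integral\<^sup>L N g - p *\<^sub>R integral\<^sup>L M g)"
      using \<open>p > 0\<close> by (metis abs_of_nonneg less_imp_le measure_nonneg norm_scaleR)
    also have "\<dots> \<le> ?n * (e * p * ?m)" using 1 by (rule mult_left_mono) simp
    also have "\<dots> = p * (e * (?n * ?m))" by simp
    finally show ?thesis using \<open>p > 0\<close> by simp
  qed
  note main = this
  have "norm (?m *\<^sub>R integral\<^sup>L N g - ?n *\<^sub>R integral\<^sup>L M g) \<le> 0 + e" if "e > 0" for e
  proof -
    have nn: "0 \<le> ?n * ?m" by simp
    have "norm (?m *\<^sub>R integral\<^sup>L N g - ?n *\<^sub>R integral\<^sup>L M g) \<le> e / (?n * ?m + 1) * (?n * ?m)"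
      by (rule main[OF divide_pos_pos[OF that add_nonneg_pos[OF nn zero_less_one]]])
    also have "\<dots> \<le> e" using that nn
      by (simp add: divide_le_eq add_nonneg_pos)
    finally show ?thesis by simp
  qed
  then have "norm (?m *\<^sub>R integral\<^sup>L N g - ?n *\<^sub>R integral\<^sup>L M g) \<le> 0"
    by (rule field_le_epsilon)
  then show ?thesis by (simp add: gf)
qed

lemma sets_surface_measure: "sets (surface_measure S) = sets (restrict_space borel S)"
  by (simp add: surface_measure_def sets_restrict_space sets_hausdorff_measure)

lemma space_surface_measure [simp]: "space (surface_measure S) = S"
  by (simp add: surface_measure_def space_restrict_space)

lemma measurable_surface_measure:
  "f \<in> borel_measurable borel \<Longrightarrow> f \<in> borel_measurable (surface_measure S)"
  unfolding surface_measure_def by (rule measurable_restrict_space1) (simp cong: measurable_cong_sets add: sets_hausdorff_measure)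

lemma emeasure_surface_measure:
  fixes S :: "(real^'n) set"
  assumes "CARD('n) \<ge> 2" "S \<in> sets borel" "A \<in> sets borel" "A \<subseteq> S"
  shows "emeasure (surface_measure S) A = hausdorff_outer (CARD('n) - 1) A"
  using assms unfolding surface_measure_def
  by (subst emeasure_restrict_space) (auto simp: sets_hausdorff_measure emeasure_hausdorff_measure)

lemma emeasure_surface_measure_sphere:
  fixes R :: real
  assumes "CARD('n) \<ge> 2" "R > 0"
  shows "0 < emeasure (surface_measure (sphere (0::real^'n) R)) (sphere 0 R)"
    "emeasure (surface_measure (sphere (0::real^'n) R)) (sphere 0 R) < \<infinity>"
  using assms hausdorff_outer_sphere_pos[of R, where 'a="real^'n"] hausdorff_outer_sphere_finite[of R, where 'a="real^'n"]
  by (auto simp: emeasure_surface_measure)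

lemma finite_surface_measure_sphere:
  "CARD('n) \<ge> 2 \<Longrightarrow> R > 0 \<Longrightarrow> finite_measure (surface_measure (sphere (0::real^'n) R))"
  using emeasure_surface_measure_sphere(2)[of R, where 'n='n] by (intro finite_measureI) auto

text \<open>The constant relating the surface measure to the cone measure. Its value is not needed: it suffices
  that the surface measure of a sphere is finite and nonzero.\<close>

definition sphere_ratio :: "(real^'n) set \<Rightarrow> real" where
  "sphere_ratio S = measure cone_measure (UNIV :: (real^'n) set) / measure (surface_measure S) S"

lemma measure_cone_measure_pos: "measure (cone_measure :: 'a::euclidean_space measure) UNIV > 0"
proof -
  interpret C: finite_measure "cone_measure :: 'a measure" by (rule finite_cone_measure)
  obtain x :: 'a where "norm x = 1" using vector_choose_size[of 1] by auto
  then have "0 < emeasure cone_measure (ball x 1)" by (rule emeasure_cone_measure_ball_pos) simp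
  also have "\<dots> \<le> emeasure cone_measure (UNIV::'a set)" by (rule emeasure_mono) auto
  finally show ?thesis by (simp add: C.emeasure_eq_measure)
qed

lemma sphere_ratio_pos:
  assumes "CARD('n) \<ge> 2" "R > 0"
  shows "sphere_ratio (sphere (0::real^'n) R) > 0"
  using emeasure_surface_measure_sphere[OF assms] measure_cone_measure_pos[where 'a="real^'n"]
  by (simp add: sphere_ratio_def measure_def enn2real_positive_iff)

text \<open>Transported to \<open>real^'n\<close>, the surface measure (\<open>M\<close>) and the
  scaled cone measure (\<open>N\<close>) are finite rotation invariant measures carried by the same
  sphere, so they are proportional. Positive mass of balls is inherited by \<open>N\<close> from the
  cone measure.\<close>

lemma integral_cone_eq_surface:
  fixes f :: "real^'n \<Rightarrow> 'b::{banach, second_countable_topology}"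
  assumes n: "CARD('n) \<ge> 2" and R: "R > 0" and f: "continuous_on UNIV f"
  shows "(\<integral>\<omega>. f (R *\<^sub>R \<omega>) \<partial>cone_measure)
    = sphere_ratio (sphere (0::real^'n) R) *\<^sub>R (\<integral>x. f x \<partial>surface_measure (sphere (0::real^'n) R))"
proof -
  let ?S = "sphere (0::real^'n) R" and ?k = "CARD('n) - 1"
  interpret C: finite_measure "cone_measure :: (real^'n) measure" by (rule finite_cone_measure)
  interpret S: finite_measure "surface_measure ?S" by (rule finite_surface_measure_sphere[OF n R])
  have [measurable]: "f \<in> borel_measurable borel" using f by (rule borel_measurable_continuous_onI)
  have id: "(\<lambda>x. x) \<in> surface_measure ?S \<rightarrow>\<^sub>M borel" by (rule measurable_surface_measure) simp
  define M where "M = distr (surface_measure ?S) borel (\<lambda>x. x)"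
  define N where "N = distr cone_measure borel (\<lambda>\<omega>::real^'n. R *\<^sub>R \<omega>)"
  have eM: "emeasure M A = hausdorff_outer ?k (A \<inter> ?S)" if "A \<in> sets borel" for A
    unfolding M_def using that n
    by (subst emeasure_distr[OF id]) (auto simp: emeasure_surface_measure vimage_def)
  have rotM: "distr M borel T = M" if T: "orthogonal_transformation T" for T
  proof (rule measure_eqI)
    note [measurable] = borel_measurable_orthogonal[OF T]
    fix A assume "A \<in> sets (distr M borel T)"
    then have A: "A \<in> sets borel" by simp
    have TA: "T -` A \<in> sets borel" using measurable_sets_borel[of T borel A] A by auto
    have "T ` (T -` A \<inter> ?S) = A \<inter> ?S"
      using orthogonal_transformation_surj[OF T] orthogonal_transformation_norm[OF T]
      by (force simp: image_iff surj_def)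
    then have "hausdorff_outer ?k (T -` A \<inter> ?S) = hausdorff_outer ?k (A \<inter> ?S)"
      using hausdorff_outer_orthogonal[OF T, of ?k "T -` A \<inter> ?S"] by simp
    then show "emeasure (distr M borel T) A = emeasure M A"
      using A TA by (subst emeasure_distr) (auto simp: M_def[THEN arg_cong, of space] eM, simp add: M_def)
  qed (simp add: M_def)
  have rotN: "distr N borel T = N" if T: "orthogonal_transformation T" for T
  proof -
    note [measurable] = borel_measurable_orthogonal[OF T]
    have "distr N borel T = distr cone_measure borel (\<lambda>\<omega>. R *\<^sub>R T \<omega>)"
      unfolding N_def by (subst distr_distr)
        (auto simp: o_def orthogonal_transformation_linear[OF T] linear_cmul)
    also have "\<dots> = distr (distr cone_measure borel T) borel (\<lambda>\<omega>. R *\<^sub>R \<omega>)"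
      by (subst distr_distr) (auto simp: o_def)
    finally show ?thesis by (simp add: distr_cone_measure_orthogonal[OF T] N_def)
  qed
  have AEM: "AE x in M. norm x = R"
    unfolding M_def by (subst AE_distr_iff[OF id]) auto
  have AEN: "AE x in N. norm x = R"
    unfolding N_def using AE_cone_measure R by (subst AE_distr_iff) auto
  have fin: "finite_measure M" "finite_measure N"
    unfolding M_def N_def by (auto intro!: S.finite_measure_distr C.finite_measure_distr id)
  have pos: "emeasure N (ball x d) > 0" if "norm x = R" "d > 0" for x d
  proof -
    have "0 < emeasure cone_measure (ball (x /\<^sub>R R) (d / R))"
      using that R by (intro emeasure_cone_measure_ball_pos) auto
    also have "ball (x /\<^sub>R R) (d / R) = (\<lambda>\<omega>. R *\<^sub>R \<omega>) -` ball x d \<inter> space cone_measure"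
    proof -
      have "dist (x /\<^sub>R R) y < d / R \<longleftrightarrow> dist x (R *\<^sub>R y) < d" for y
      proof -
        have "x - R *\<^sub>R y = R *\<^sub>R (x /\<^sub>R R - y)" using R by (simp add: scaleR_diff_right)
        then have "dist x (R *\<^sub>R y) = R * dist (x /\<^sub>R R) y" using R by (simp add: dist_norm)
        then show ?thesis using R by (simp add: pos_less_divide_eq mult.commute)
      qed
      then show ?thesis by auto
    qed
    also have "emeasure cone_measure \<dots> = emeasure N (ball x d)"
      unfolding N_def by (rule emeasure_distr[symmetric]) auto
    finally show ?thesis .
  qed
  have e1: "measure M UNIV *\<^sub>R integral\<^sup>L N f = measure N UNIV *\<^sub>R integral\<^sup>L M f"
    by (rule rotation_invariant_integral_eq[OF fin _ _ _ AEM AEN rotM rotN pos f]) (use R in \<open>auto simp: M_def N_def\<close>)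
  have e2: "integral\<^sup>L N f = (\<integral>\<omega>. f (R *\<^sub>R \<omega>) \<partial>cone_measure)"
    unfolding N_def by (rule integral_distr) auto
  have e3: "integral\<^sup>L M f = (\<integral>x. f x \<partial>surface_measure ?S)"
    unfolding M_def by (rule integral_distr[OF id]) auto
  have e4: "measure M UNIV = measure (surface_measure ?S) ?S"
    unfolding M_def by (subst measure_distr[OF id]) auto
  have e5: "measure N UNIV = measure cone_measure (UNIV :: (real^'n) set)"
    unfolding N_def by (subst measure_distr) auto
  have e6: "measure (surface_measure ?S) ?S > 0"
    using emeasure_surface_measure_sphere[OF n R] by (simp add: measure_def enn2real_positive_iff)
  have e7: "a *\<^sub>R X = b *\<^sub>R Y \<Longrightarrow> a > 0 \<Longrightarrow> X = (b / a) *\<^sub>R Y" for a b :: real and X Y :: 'b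
    by (metis (no_types, opaque_lifting) divide_inverse_commute left_inverse less_irrefl scaleR_one scaleR_scaleR)
  have e8: "measure (surface_measure ?S) ?S *\<^sub>R (\<integral>\<omega>. f (R *\<^sub>R \<omega>) \<partial>cone_measure)
      = measure cone_measure (UNIV :: (real^'n) set) *\<^sub>R (\<integral>x. f x \<partial>surface_measure ?S)"
    using e1 by (simp only: e2 e3 e4 e5)
  show ?thesis using e7[OF e8 e6] by (simp only: sphere_ratio_def)
qed

section \<open>The divergence theorem on the annulus\<close>

text \<open>The open annulus differs from the closed one by two spheres, which are null. The closed
  one is compact, so continuity there already gives integrability.\<close>

lemma annulus_null_boundary:
  fixes h :: "'a::euclidean_space \<Rightarrow> 'b::{banach, second_countable_topology}"
  assumes "continuous_on (cball 0 R2 - ball 0 R1) h"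
  shows integral_annulus_lborel: "(LINT x|lebesgue_on (ball 0 R2 - cball 0 R1). h x)
      = (LINT x|lborel. indicator (cball 0 R2 - ball 0 R1) x *\<^sub>R h x)"
    and integrable_annulus: "integrable (lebesgue_on (ball 0 R2 - cball 0 R1)) h"
    and integrable_annulus_lborel: "integrable lborel (\<lambda>x. indicator (cball 0 R2 - ball 0 R1) x *\<^sub>R h x)"
proof -
  let ?K = "cball 0 R2 - ball (0::'a) R1" and ?O = "ball 0 R2 - cball (0::'a) R1"
  have K: "compact ?K" by (intro compact_diff) auto
  have meas: "(\<lambda>x. indicator ?K x *\<^sub>R h x) \<in> borel_measurable borel"
    using assms by (intro borel_measurable_continuous_on_indicator) auto
  show int: "integrable lborel (\<lambda>x. indicator ?K x *\<^sub>R h x)"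
    using borel_integrable_compact[OF K assms] by (simp add: set_integrable_def)
  have il: "integrable lebesgue (\<lambda>x. indicator ?K x *\<^sub>R h x)"
    using int meas by (subst integrable_completion) simp_all
  have null: "sphere 0 R1 \<union> sphere 0 R2 \<in> null_sets (lebesgue :: 'a measure)"
    by (simp add: negligible_iff_null_sets[symmetric] negligible_Un negligible_sphere)
  have ae: "AE x in lebesgue. indicator ?O x *\<^sub>R h x = indicator ?K x *\<^sub>R h x"
    by (rule AE_I'[OF null]) (auto split: split_indicator)
  have measO: "(\<lambda>x. indicator ?O x *\<^sub>R h x) \<in> borel_measurable lebesgue"
  proof -
    have "(\<lambda>x. indicator ?O x *\<^sub>R h x) \<in> borel_measurable borel"
      using assms by (intro borel_measurable_continuous_on_indicator) (auto intro: continuous_on_subset)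
    then show ?thesis by (simp add: measurable_completion)
  qed
  have Os: "?O \<inter> space lebesgue \<in> sets (lebesgue :: 'a measure)" by simp
  show "integrable (lebesgue_on ?O) h"
    using integrable_cong_AE[OF measO _ ae] il
    by (subst integrable_restrict_space[OF Os]) (auto simp: set_integrable_def)
  have "(LINT x|lebesgue_on ?O. h x) = (LINT x|lebesgue. indicator ?O x *\<^sub>R h x)"
    by (rule integral_restrict_space[OF Os])
  also have "\<dots> = (LINT x|lebesgue. indicator ?K x *\<^sub>R h x)"
    by (rule integral_cong_AE[OF measO _ ae]) (use il in auto)
  also have "\<dots> = (LINT x|lborel. indicator ?K x *\<^sub>R h x)"
    by (rule integral_completion) (use meas in auto)
  finally show "(LINT x|lebesgue_on ?O. h x) = (LINT x|lborel. indicator ?K x *\<^sub>R h x)" .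
qed

lemma integral_annulus_polar:
  fixes h G :: "'a::euclidean_space \<Rightarrow> 'b::{banach, second_countable_topology}"
  assumes R: "0 < R1" "R1 < R2" and h: "continuous_on (cball 0 R2 - ball 0 R1) h"
    and G: "G \<in> borel_measurable borel"
      "\<And>\<omega>. norm \<omega> = 1 \<Longrightarrow> (LINT r|lborel. indicator {R1..R2} r *\<^sub>R r ^ (DIM('a) - 1) *\<^sub>R h (r *\<^sub>R \<omega>)) = G \<omega>"
  shows "(LINT x|lebesgue_on (ball 0 R2 - cball 0 R1). h x)
      = real DIM('a) *\<^sub>R (LINT \<omega>|cone_measure. G \<omega>)"
proof -
  let ?K = "cball 0 R2 - ball (0::'a) R1"
  let ?n = "DIM('a)"
  let ?h = "\<lambda>x. indicator ?K x *\<^sub>R h x"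
  have [measurable]: "?h \<in> borel_measurable borel"
    using h by (intro borel_measurable_continuous_on_indicator) auto
  let ?A = "\<lambda>\<omega>. \<integral>r. (r ^ (?n - 1) * indicator {0<..} r) *\<^sub>R ?h (r *\<^sub>R \<omega>) \<partial>lborel"
  have "(LINT x|lebesgue_on (ball 0 R2 - cball 0 R1). h x) = (LINT x|lborel. ?h x)"
    by (rule integral_annulus_lborel[OF h])
  also have "\<dots> = (\<integral>\<omega>. (\<integral>r. (indicator {0<..} r * (real ?n * r ^ (?n - 1))) *\<^sub>R ?h (r *\<^sub>R \<omega>) \<partial>lborel) \<partial>cone_measure)"
    by (rule integral_polar[OF integrable_annulus_lborel[OF h]])
  also have "\<dots> = (\<integral>\<omega>. real ?n *\<^sub>R ?A \<omega> \<partial>cone_measure)"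
    by (intro Bochner_Integration.integral_cong refl)
       (simp only: integral_scaleR_right[symmetric] scaleR_scaleR ac_simps)
  also have "\<dots> = real ?n *\<^sub>R (\<integral>\<omega>. ?A \<omega> \<partial>cone_measure)"
    by (simp only: integral_scaleR_right)
  also have "(\<integral>\<omega>. ?A \<omega> \<partial>cone_measure) = (\<integral>\<omega>. G \<omega> \<partial>cone_measure)"
  proof (rule integral_cong_AE)
    show "?A \<in> borel_measurable cone_measure" by measurable
    show "G \<in> borel_measurable cone_measure" using G(1) by simp
    have "?A \<omega> = G \<omega>" if w: "norm \<omega> = 1" for \<omega>
      unfolding G(2)[OF w, symmetric]
      by (intro Bochner_Integration.integral_cong refl) (use w R in \<open>auto split: split_indicator\<close>)
    then show "AE \<omega> in cone_measure. ?A \<omega> = G \<omega>"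
      using AE_cone_measure by (auto elim!: eventually_mono)
  qed
  finally show ?thesis .
qed

text \<open>The divergence theorem for the field \<open>\<beta>(|x|) f(x) x / |x|\<close>.\<close>

lemma radial_divergence:
  fixes f df :: "'a::euclidean_space \<Rightarrow> 'b::euclidean_space" and \<beta> \<beta>' :: "real \<Rightarrow> real"
  assumes R: "0 < R1" "R1 < R2"
    and f: "continuous_on UNIV f" and df: "continuous_on (cball 0 R2 - ball 0 R1) df"
    and deriv: "\<And>\<omega> r. norm \<omega> = 1 \<Longrightarrow> R1 \<le> r \<Longrightarrow> r \<le> R2 \<Longrightarrow>
      ((\<lambda>r. f (r *\<^sub>R \<omega>)) has_vector_derivative df (r *\<^sub>R \<omega>)) (at r)"
    and \<beta>: "\<And>r. R1 \<le> r \<Longrightarrow> r \<le> R2 \<Longrightarrow> (\<beta> has_real_derivative \<beta>' r) (at r within {R1..R2})"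
    and \<beta>': "continuous_on {R1..R2} \<beta>'"
  defines "m \<equiv> DIM('a) - 1"
  shows "(LINT x|lebesgue_on (ball 0 R2 - cball 0 R1).
        \<beta> (norm x) *\<^sub>R df x + (\<beta>' (norm x) + real m / norm x * \<beta> (norm x)) *\<^sub>R f x)
    = real DIM('a) *\<^sub>R ((R2 ^ m * \<beta> R2) *\<^sub>R (LINT \<omega>|cone_measure. f (R2 *\<^sub>R \<omega>))
        - (R1 ^ m * \<beta> R1) *\<^sub>R (LINT \<omega>|cone_measure. f (R1 *\<^sub>R \<omega>)))"
proof -
  let ?K = "cball 0 R2 - ball (0::'a) R1"
  let ?h = "\<lambda>x. \<beta> (norm x) *\<^sub>R df x + (\<beta>' (norm x) + real m / norm x * \<beta> (norm x)) *\<^sub>R f x"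
  define G where "G \<omega> = (R2 ^ m * \<beta> R2) *\<^sub>R f (R2 *\<^sub>R \<omega>) - (R1 ^ m * \<beta> R1) *\<^sub>R f (R1 *\<^sub>R \<omega>)" for \<omega>
  have \<beta>c: "continuous_on {R1..R2} \<beta>"
    by (rule DERIV_continuous_on[where D=\<beta>']) (use \<beta> in auto)
  have nK: "norm ` ?K \<subseteq> {R1..R2}" by (auto simp: dist_norm)
  have fK: "continuous_on S f" for S using f by (rule continuous_on_subset) auto
  have cont: "continuous_on ?K ?h"
    using R by (intro continuous_intros df fK continuous_on_compose2[OF \<beta>c _ nK] continuous_on_compose2[OF \<beta>' _ nK]) auto
  have f_meas [measurable]: "f \<in> borel_measurable borel" using f by (rule borel_measurable_continuous_onI)
  have "G \<in> borel_measurable borel" unfolding G_def by measurable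
  moreover have "(LINT r|lborel. indicator {R1..R2} r *\<^sub>R r ^ (DIM('a) - 1) *\<^sub>R ?h (r *\<^sub>R \<omega>)) = G \<omega>"
    if w: "norm \<omega> = 1" for \<omega>
  proof -
    let ?F = "\<lambda>r. (r ^ m * \<beta> r) *\<^sub>R f (r *\<^sub>R \<omega>)"
    let ?F' = "\<lambda>r. r ^ m *\<^sub>R ?h (r *\<^sub>R \<omega>)"
    have wK: "(\<lambda>r. r *\<^sub>R \<omega>) ` {R1..R2} \<subseteq> ?K" using w R by auto
    \<comment> \<open>The fundamental theorem on one ray: the derivative of
      \<open>r ^ m * \<beta> r\<close> is \<open>r ^ m\<close> times
      \<open>\<beta>' r + m / r * \<beta> r\<close>, so the weight of polar coordinates produces the
      divergence of the field.\<close>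
    have "has_bochner_integral lborel (\<lambda>r. indicator {R1..R2} r *\<^sub>R ?F' r) (?F R2 - ?F R1)"
    proof (rule has_bochner_integral_FTC_Icc)
      show "R1 \<le> R2" using R by simp
      show "continuous_on {R1..R2} ?F'"
        by (intro continuous_on_scaleR continuous_on_compose2[OF cont _ wK] continuous_intros)
      fix r assume r: "R1 \<le> r" "r \<le> R2"
      have rp: "r > 0" using r R by simp
      have nr: "norm (r *\<^sub>R \<omega>) = r" using w rp by simp
      have d1: "((\<lambda>r. r ^ m * \<beta> r) has_real_derivative (real m * r ^ (m - 1) * \<beta> r + r ^ m * \<beta>' r)) (at r within {R1..R2})"
        using \<beta>[OF r] by (auto intro!: derivative_eq_intros)
      \<comment> \<open>For \<open>m = 0\<close> the exponent \<open>m - 1\<close> is truncated to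
        0, but the factor \<open>real m\<close> makes both sides vanish.\<close>
      have e: "real m * r ^ (m - 1) = r ^ m * (real m / r)"
        using rp by (cases m) auto
      have "(?F has_vector_derivative ((r ^ m * \<beta> r) *\<^sub>R df (r *\<^sub>R \<omega>) + (real m * r ^ (m - 1) * \<beta> r + r ^ m * \<beta>' r) *\<^sub>R f (r *\<^sub>R \<omega>)))
          (at r within {R1..R2})"
        by (rule has_vector_derivative_scaleR[OF d1 has_vector_derivative_at_within[OF deriv[OF w r]]])
      also have "(r ^ m * \<beta> r) *\<^sub>R df (r *\<^sub>R \<omega>) + (real m * r ^ (m - 1) * \<beta> r + r ^ m * \<beta>' r) *\<^sub>R f (r *\<^sub>R \<omega>) = ?F' r"
        unfolding nr e by (simp add: algebra_simps)
      finally show "(?F has_vector_derivative ?F' r) (at r within {R1..R2})" .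
    qed
    then show ?thesis unfolding G_def m_def by (simp add: has_bochner_integral_integral_eq)
  qed
  ultimately have "(LINT x|lebesgue_on (ball 0 R2 - cball 0 R1). ?h x) = real DIM('a) *\<^sub>R (LINT \<omega>|cone_measure. G \<omega>)"
    by (rule integral_annulus_polar[OF R cont])
  moreover have "(LINT \<omega>|cone_measure. G \<omega>) = (R2 ^ m * \<beta> R2) *\<^sub>R (LINT \<omega>|cone_measure. f (R2 *\<^sub>R \<omega>))
        - (R1 ^ m * \<beta> R1) *\<^sub>R (LINT \<omega>|cone_measure. f (R1 *\<^sub>R \<omega>))"
  proof -
    interpret C: finite_measure "cone_measure :: 'a measure" by (rule finite_cone_measure)
    have "integrable cone_measure (\<lambda>\<omega>. f (R *\<^sub>R \<omega>))" for R
    proof -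
      have "compact ((\<lambda>\<omega>. f (R *\<^sub>R \<omega>)) ` sphere 0 1)"
        by (intro compact_continuous_image continuous_on_compose2[OF f] continuous_intros) auto
      from compact_imp_bounded[OF this] have "\<exists>B. \<forall>\<omega>\<in>sphere 0 1. norm (f (R *\<^sub>R \<omega>)) \<le> B"
        unfolding bounded_iff by auto
      then obtain B where "\<And>\<omega>. norm \<omega> = 1 \<Longrightarrow> norm (f (R *\<^sub>R \<omega>)) \<le> B" by (metis mem_sphere_0)
      then show ?thesis
        using AE_cone_measure by (intro C.integrable_const_bound[where B=B]) (auto elim: eventually_mono)
    qed
    then show ?thesis unfolding G_def
      by (subst Bochner_Integration.integral_diff) (auto intro!: integrable_scaleR_right)
  qed
  ultimately show ?thesis by simp
qed


section \<open>The radial equation\<close>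

lemma mvt_within_Icc:
  fixes f f' :: "real \<Rightarrow> real"
  assumes "\<And>r. a \<le> r \<Longrightarrow> r \<le> b \<Longrightarrow> (f has_real_derivative f' r) (at r within {a..b})"
    and "a \<le> c" "c < d" "d \<le> b"
  shows "\<exists>x. c < x \<and> x < d \<and> f d - f c = (d - c) * f' x"
proof -
  have "\<exists>x\<in>{c<..<d}. f d - f c = (\<lambda>h. h * f' x) (d - c)"
  proof (rule mvt_simple[OF \<open>c < d\<close>])
    fix x assume "c \<le> x" "x \<le> d"
    then have "(f has_real_derivative f' x) (at x within {c..d})"
      using assms by (intro has_field_derivative_subset[OF assms(1)]) auto
    then show "(f has_derivative (\<lambda>h. h * f' x)) (at x within {c..d})"
      by (simp add: has_field_derivative_def mult.commute[of _ "f' x"])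
  qed
  then show ?thesis by auto
qed

text \<open>The initial slope involves a parameter \<open>\<kappa>\<close>, later instantiated by
  \<open>1 / c1\<close>, which contains the ratio of cone measure to surface measure on the inner
  sphere.\<close>

locale radial_ode =
  fixes R1 R2 \<kappa> :: real and m :: nat
  assumes R1: "0 < R1" and R12: "R1 < R2" and \<kappa>: "0 < \<kappa>"
begin

text \<open>\<open>\<phi> l = (\<Sum>k. (-l)^k coef k)\<close> solves \<open>(r^m \<phi>')' = -l r^m \<phi>\<close>, \<open>\<phi>(R1) = 1\<close>, \<open>\<phi>'(R1) = -l \<kappa>\<close>.\<close>

primrec coef :: "nat \<Rightarrow> real \<Rightarrow> real" where
  "coef 0 = (\<lambda>r. 1)"
| "coef (Suc k) = (\<lambda>r. integral {R1..r} (\<lambda>t. ((if k = 0 then \<kappa> * R1 ^ m else 0)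
      + integral {R1..t} (\<lambda>s. s ^ m * coef k s)) / t ^ m))"

text \<open>\<open>r ^ m\<close> times the derivative of the next coefficient
  \<open>coef (Suc k)\<close>, not of \<open>coef k\<close>. The initial slope is linear in
  \<open>l\<close>, so it enters only for \<open>k = 0\<close>.\<close>

definition flux :: "nat \<Rightarrow> real \<Rightarrow> real" where
  "flux k t = (if k = 0 then \<kappa> * R1 ^ m else 0) + integral {R1..t} (\<lambda>s. s ^ m * coef k s)"

lemma coef_Suc: "coef (Suc k) r = integral {R1..r} (\<lambda>t. flux k t / t ^ m)"
  by (simp add: flux_def)

declare coef.simps(2) [simp del]

text \<open>A joint induction, because \<open>flux k\<close> integrates \<open>coef k\<close> and
  \<open>coef (Suc k)\<close> integrates \<open>flux k\<close>.\<close>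

lemma continuous_coef_flux: "continuous_on {R1..R2} (coef k) \<and> continuous_on {R1..R2} (flux k)"
proof (induction k)
  case 0
  have "continuous_on {R1..R2} (\<lambda>t. integral {R1..t} (\<lambda>s. s ^ m * coef 0 s))"
    by (intro indefinite_integral_continuous_1 integrable_continuous_real continuous_intros) auto
  then show ?case unfolding flux_def by (auto intro!: continuous_intros)
next
  case (Suc k)
  have "continuous_on {R1..R2} (\<lambda>t. integral {R1..t} (\<lambda>t. flux k t / t ^ m))"
    using R1 by (intro indefinite_integral_continuous_1 integrable_continuous_real continuous_intros) (auto simp: Suc)
  then have 1: "continuous_on {R1..R2} (coef (Suc k))" by (simp add: coef_Suc[abs_def])
  then have "continuous_on {R1..R2} (\<lambda>t. integral {R1..t} (\<lambda>s. s ^ m * coef (Suc k) s))"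
    by (intro indefinite_integral_continuous_1 integrable_continuous_real continuous_intros)
  with 1 show ?case unfolding flux_def by (auto intro!: continuous_intros)
qed

lemmas continuous_coef = continuous_coef_flux[THEN conjunct1]
  and continuous_flux = continuous_coef_flux[THEN conjunct2]

lemma continuous_flux_div: "continuous_on {R1..R2} (\<lambda>t. flux k t / t ^ m)"
  using R1 by (intro continuous_intros continuous_flux) auto

lemma deriv_coef_Suc:
  assumes "r \<in> {R1..R2}"
  shows "(coef (Suc k) has_real_derivative flux k r / r ^ m) (at r within {R1..R2})"
  using integral_has_real_derivative[OF continuous_flux_div assms] by (simp add: coef_Suc[abs_def])

lemma deriv_flux:
  assumes "r \<in> {R1..R2}"
  shows "(flux k has_real_derivative r ^ m * coef k r) (at r within {R1..R2})"
proof -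
  have "continuous_on {R1..R2} (\<lambda>s. s ^ m * coef k s)" by (intro continuous_intros continuous_coef)
  from integral_has_real_derivative[OF this assms] show ?thesis
    unfolding flux_def by (auto intro!: derivative_eq_intros)
qed

section \<open>Majorants, convergence and termwise differentiation of the series\<close>

text \<open>The growth factor per step of the recursion: \<open>\<kappa>\<close> accounts for the
  initial slope and \<open>R2 - R1\<close> for the integration of the preceding coefficient.\<close>

definition M :: real where "M = \<kappa> + (R2 - R1)"

lemma M_pos: "M > 0" using R12 \<kappa> by (simp add: M_def)

text \<open>Both \<open>s ^ m\<close> and the assumed bound on \<open>coef k\<close> increase with
  \<open>s\<close>, so the integral up to \<open>r\<close> is at most its length times the value at
  \<open>r\<close>, and \<open>r ^ m\<close> cancels.\<close>

lemma flux_bound: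
  assumes coef: "\<And>s. R1 \<le> s \<Longrightarrow> s \<le> R2 \<Longrightarrow> 0 \<le> coef k s \<and> coef k s \<le> M ^ k * (s - R1) ^ k / fact k"
    and r: "R1 \<le> r" "r \<le> R2"
  shows "0 \<le> flux k r / r ^ m \<and> flux k r / r ^ m \<le> M * (M ^ k * (r - R1) ^ k / fact k)"
  proof -
    let ?B = "M ^ k * (r - R1) ^ k / fact k"
    have rp: "r > 0" using r R1 by simp
    have B: "0 \<le> ?B" using M_pos r by (intro divide_nonneg_nonneg mult_nonneg_nonneg zero_le_power) auto
    have int: "(\<lambda>s. s ^ m * coef k s) integrable_on {R1..r}"
      using r by (intro integrable_continuous_real continuous_intros continuous_on_subset[OF continuous_coef]) auto
    have nn: "0 \<le> integral {R1..r} (\<lambda>s. s ^ m * coef k s)"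
      using coef r R1 by (intro integral_nonneg[OF int]) auto
    have "integral {R1..r} (\<lambda>s. s ^ m * coef k s) \<le> integral {R1..r} (\<lambda>s. r ^ m * ?B)"
    proof (rule integral_le[OF int])
      fix s assume s: "s \<in> {R1..r}"
      have "coef k s \<le> M ^ k * (s - R1) ^ k / fact k" using coef[of s] s r by auto
      also have "\<dots> \<le> ?B" using s M_pos by (intro divide_right_mono mult_left_mono power_mono) auto
      finally show "s ^ m * coef k s \<le> r ^ m * ?B"
        using s R1 r coef[of s] by (intro mult_mono power_mono) auto
    qed auto
    also have "\<dots> = (r - R1) * (r ^ m * ?B)" using r by simp
    also have "\<dots> \<le> (R2 - R1) * (r ^ m * ?B)" using r rp B by (intro mult_right_mono mult_nonneg_nonneg[OF _ B]) auto
    finally have 1: "integral {R1..r} (\<lambda>s. s ^ m * coef k s) \<le> r ^ m * ((R2 - R1) * ?B)" by (simp add: ac_simps)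
    have 2: "(if k = 0 then \<kappa> * R1 ^ m else 0) \<le> r ^ m * (\<kappa> * ?B)"
    proof (cases "k = 0")
      case True
      have "\<kappa> * R1 ^ m \<le> \<kappa> * r ^ m" using r R1 \<kappa> by (intro mult_left_mono power_mono) auto
      with True show ?thesis by (simp add: mult.commute)
    next
      case False
      have "0 \<le> r ^ m * (\<kappa> * ?B)" using \<kappa> rp by (intro mult_nonneg_nonneg[OF _ mult_nonneg_nonneg[OF _ B]]) auto
      with False show ?thesis by simp
    qed
    have 3: "flux k r \<le> r ^ m * (M * ?B)"
    proof -
      have "r ^ m * (M * ?B) = r ^ m * (\<kappa> * ?B) + r ^ m * ((R2 - R1) * ?B)"
        unfolding M_def by (simp only: distrib_left distrib_right)
      then show ?thesis using 1 2 unfolding flux_def by linarith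
    qed
    have "0 \<le> flux k r" using nn R1 \<kappa> unfolding flux_def by auto
    then show ?thesis using 3 rp by (simp add: pos_divide_le_eq mult.commute)
  qed

text \<open>Each step integrates \<open>(t - R1) ^ k / fact k\<close> once more. The resulting
  factorial makes the series in \<open>l\<close> converge for every \<open>l\<close>.\<close>

lemma coef_bound:
  assumes "R1 \<le> r" "r \<le> R2"
  shows "0 \<le> coef k r \<and> coef k r \<le> M ^ k * (r - R1) ^ k / fact k"
  using assms
proof (induction k arbitrary: r)
  case (Suc k)
  note s = Suc.prems and fb = flux_bound[OF Suc.IH]
      have int: "(\<lambda>t. flux k t / t ^ m) integrable_on {R1..r}"
        using s by (intro integrable_continuous_real continuous_on_subset[OF continuous_flux_div]) auto
      have hi: "((\<lambda>t. M * (M ^ k * (t - R1) ^ k / fact k)) has_integral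
          (M ^ Suc k * (r - R1) ^ Suc k / fact (Suc k) - M ^ Suc k * (R1 - R1) ^ Suc k / fact (Suc k))) {R1..r}"
      proof (rule fundamental_theorem_of_calculus)
        fix t assume "t \<in> {R1..r}"
        have "((\<lambda>t. M ^ Suc k * (t - R1) ^ Suc k / fact (Suc k)) has_real_derivative
            M ^ Suc k * ((1 + real k) * (1 * (t - R1) ^ k)) / fact (Suc k)) (at t within {R1..r})"
          by (intro DERIV_cdivide DERIV_cmult DERIV_power_Suc) (auto intro!: derivative_eq_intros)
        also have "M ^ Suc k * ((1 + real k) * (1 * (t - R1) ^ k)) / fact (Suc k) = M * (M ^ k * (t - R1) ^ k / fact k)"
        proof -
          have alg: "(a * b) * (x * (1 * p)) / (x * f) = a * (b * p / f)" if "x \<noteq> 0" for a b x p f :: real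
            using that by simp
          have "fact (Suc k) = (1 + real k) * fact k" by simp
          moreover have "1 + real k \<noteq> 0" by linarith
          ultimately show ?thesis using alg by (simp only: power_Suc)
        qed
        finally show "((\<lambda>t. M ^ Suc k * (t - R1) ^ Suc k / fact (Suc k)) has_vector_derivative
            M * (M ^ k * (t - R1) ^ k / fact k)) (at t within {R1..r})"
          by (simp add: has_real_derivative_iff_has_vector_derivative)
      qed (use s in auto)
      have "coef (Suc k) r \<le> integral {R1..r} (\<lambda>t. M * (M ^ k * (t - R1) ^ k / fact k))"
        unfolding coef_Suc by (rule integral_le[OF int has_integral_integrable[OF hi]]) (use fb s in \<open>auto simp del: fact_Suc\<close>)
      also have "\<dots> = M ^ Suc k * (r - R1) ^ Suc k / fact (Suc k)"
        using integral_unique[OF hi] by simp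
      finally have "coef (Suc k) r \<le> M ^ Suc k * (r - R1) ^ Suc k / fact (Suc k)" .
      moreover have "0 \<le> coef (Suc k) r"
        unfolding coef_Suc by (rule integral_nonneg[OF int]) (use fb s in auto)
      ultimately show ?case by simp
qed simp

text \<open>Terms of an exponential series, written with \<open>/\<^sub>R\<close> to match
  \<open>summable_exp_generic\<close>.\<close>

definition bnd :: "real \<Rightarrow> nat \<Rightarrow> real" where
  "bnd L k = (L * (M * (R2 - R1))) ^ k /\<^sub>R fact k"

lemma summable_bnd: "summable (\<lambda>k. c * bnd L k)"
  unfolding bnd_def by (intro summable_mult summable_exp_generic)

lemma coef_term_bound:
  assumes "\<bar>l\<bar> \<le> L" "R1 \<le> r" "r \<le> R2"
  shows "norm ((-l) ^ k * coef k r) \<le> 1 * bnd L k"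
    and "norm ((-l) ^ Suc k * (flux k r / r ^ m)) \<le> (L * M) * bnd L k"
proof -
  let ?B = "M ^ k * (R2 - R1) ^ k / fact k"
  have le: "M ^ k * (r - R1) ^ k / fact k \<le> ?B"
    using assms M_pos by (intro divide_right_mono mult_left_mono power_mono) auto
  have L: "0 \<le> L" using assms by linarith
  have B0: "0 \<le> ?B" using R12 M_pos by simp
  have fb: "0 \<le> flux k r / r ^ m \<and> flux k r / r ^ m \<le> M * (M ^ k * (r - R1) ^ k / fact k)"
    by (rule flux_bound) (use assms coef_bound in auto)
  note b = coef_bound[OF assms(2,3), of k] fb
  have "norm ((-l) ^ k * coef k r) = \<bar>l\<bar> ^ k * coef k r" using b by (simp add: abs_mult power_abs)
  also have "\<dots> \<le> L ^ k * ?B" using assms b le L by (intro mult_mono power_mono) auto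
  also have "\<dots> = 1 * bnd L k" by (simp add: bnd_def power_mult_distrib divide_inverse)
  finally show "norm ((-l) ^ k * coef k r) \<le> 1 * bnd L k" .
  have "norm ((-l) ^ Suc k * (flux k r / r ^ m)) = \<bar>l\<bar> ^ Suc k * (flux k r / r ^ m)"
    using b by (simp only: norm_mult norm_power norm_minus_cancel) (simp only: real_norm_def abs_of_nonneg)
  also have "\<dots> \<le> L ^ Suc k * (M * ?B)"
  proof (intro mult_mono power_mono)
    show "flux k r / r ^ m \<le> M * ?B" using b mult_left_mono[OF le, of M] M_pos by linarith
  qed (use assms b L in auto)
  also have "\<dots> = (L * M) * bnd L k" by (simp add: bnd_def power_mult_distrib divide_inverse)
  finally show "norm ((-l) ^ Suc k * (flux k r / r ^ m)) \<le> (L * M) * bnd L k" .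
qed

definition phi :: "real \<Rightarrow> real \<Rightarrow> real" where
  "phi l r = (\<Sum>k. (-l) ^ k * coef k r)"

definition dphi :: "real \<Rightarrow> real \<Rightarrow> real" where
  "dphi l r = (\<Sum>k. (-l) ^ Suc k * (flux k r / r ^ m))"

lemma summable_phi: "r \<in> {R1..R2} \<Longrightarrow> summable (\<lambda>k. (-l) ^ k * coef k r)"
  by (rule summable_comparison_test'[OF summable_bnd[of 1 "\<bar>l\<bar>"], of 0])
     (rule coef_term_bound(1), auto)

lemma summable_dphi: "r \<in> {R1..R2} \<Longrightarrow> summable (\<lambda>k. (-l) ^ Suc k * (flux k r / r ^ m))"
  by (rule summable_comparison_test'[OF summable_bnd[of "\<bar>l\<bar> * M" "\<bar>l\<bar>"], of 0])
     (rule coef_term_bound(2), auto)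

text \<open>The M-test with the majorant \<open>bnd L\<close> is uniform in both variables. Joint
  continuity is what makes the set of zeros closed in \<open>exists_ground_value\<close>.\<close>

lemma continuous_phi: "continuous_on ({-L..L} \<times> {R1..R2}) (\<lambda>p. phi (fst p) (snd p))"
proof -
  let ?S = "{-L..L} \<times> {R1..R2}"
  define f where "f i p = (- fst p) ^ i * coef i (snd p)" for i and p :: "real \<times> real"
  have "norm (f i p) \<le> 1 * bnd L i" if "p \<in> ?S" for i p
    unfolding f_def using that by (intro coef_term_bound) auto
  then have ul: "uniform_limit ?S (\<lambda>n p. \<Sum>i<n. f i p) (\<lambda>p. \<Sum>i. f i p) sequentially"
    by (rule Weierstrass_m_test[OF _ summable_bnd])
  have "continuous_on ?S (f i)" for i
    unfolding f_def by (intro continuous_intros continuous_on_compose2[OF continuous_coef]) auto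
  then have ev: "\<forall>\<^sub>F n in sequentially. continuous_on ?S (\<lambda>p. \<Sum>i<n. f i p)"
    by (intro always_eventually allI continuous_on_sum)
  have "continuous_on ?S (\<lambda>p. \<Sum>i. f i p)"
    by (rule uniform_limit_theorem[OF ev ul]) simp
  then show ?thesis by (simp add: phi_def f_def)
qed

lemma continuous_dphi: "continuous_on ({-L..L} \<times> {R1..R2}) (\<lambda>p. dphi (fst p) (snd p))"
proof -
  let ?S = "{-L..L} \<times> {R1..R2}"
  define f where "f i p = (- fst p) ^ Suc i * (flux i (snd p) / snd p ^ m)" for i and p :: "real \<times> real"
  have "norm (f i p) \<le> (L * M) * bnd L i" if "p \<in> ?S" for i p
    unfolding f_def using that by (intro coef_term_bound) auto
  then have ul: "uniform_limit ?S (\<lambda>n p. \<Sum>i<n. f i p) (\<lambda>p. \<Sum>i. f i p) sequentially"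
    by (rule Weierstrass_m_test[OF _ summable_bnd])
  have "continuous_on ?S (f i)" for i
  proof -
    have "continuous_on ?S (\<lambda>p. flux i (snd p) / snd p ^ m)"
      by (rule continuous_on_compose2[OF continuous_flux_div, where f=snd]) (auto intro: continuous_intros)
    then show ?thesis unfolding f_def by (rule continuous_on_mult[rotated]) (intro continuous_intros)
  qed
  then have ev: "\<forall>\<^sub>F n in sequentially. continuous_on ?S (\<lambda>p. \<Sum>i<n. f i p)"
    by (intro always_eventually allI continuous_on_sum)
  have "continuous_on ?S (\<lambda>p. \<Sum>i. f i p)"
    by (rule uniform_limit_theorem[OF ev ul]) simp
  then show ?thesis by (simp add: dphi_def f_def)
qed

lemma deriv_phi:
  assumes "r \<in> {R1..R2}"
  shows "(phi l has_real_derivative dphi l r) (at r within {R1..R2})"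
proof -
  let ?f = "\<lambda>k r. (-l) ^ k * coef k r"
  \<comment> \<open>The k-th term differentiates into \<open>flux (k - 1)\<close>: the constant term
    drops out and the index shifts by one against \<open>dphi\<close>.\<close>
  let ?f' = "\<lambda>k r. if k = 0 then 0 else (-l) ^ k * (flux (k - 1) r / r ^ m)"
  have f: "(?f k has_real_derivative ?f' k r) (at r within {R1..R2})" if "r \<in> {R1..R2}" for k r
  proof (cases k)
    case (Suc j)
    then show ?thesis using deriv_coef_Suc[OF that, of j] by (auto intro!: derivative_eq_intros)
  qed auto
  have eq: "suminf (\<lambda>k. ?f' k r) = dphi l r" if "r \<in> {R1..R2}" for r
  proof -
    have "(\<lambda>k. ?f' (Suc k) r) sums dphi l r"
      using summable_sums[OF summable_dphi[OF that, of l]] unfolding dphi_def by simp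
    then have "(\<lambda>k. ?f' k r) sums (dphi l r + ?f' 0 r)" by (subst (asm) sums_Suc_iff) simp
    then show ?thesis using sums_unique by fastforce
  qed
  define B where "B k = (case k of 0 \<Rightarrow> 0 | Suc j \<Rightarrow> (\<bar>l\<bar> * M) * bnd \<bar>l\<bar> j)" for k
  have "summable (\<lambda>k. B (Suc k))" using summable_bnd[of "\<bar>l\<bar> * M" "\<bar>l\<bar>"] by (simp add: B_def)
  then have "summable B" by (subst (asm) summable_Suc_iff)
  moreover have "norm (?f' k r) \<le> B k" if "r \<in> {R1..R2}" for k r
    using coef_term_bound(2)[of l "\<bar>l\<bar>" r "k - 1"] that by (cases k) (auto simp: B_def)
  ultimately have ul: "uniform_limit {R1..R2} (\<lambda>n r. \<Sum>i<n. ?f' i r) (\<lambda>r. suminf (\<lambda>k. ?f' k r)) sequentially"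
    by (intro Weierstrass_m_test)
  have "\<exists>g. \<forall>r\<in>{R1..R2}. (\<lambda>n. ?f n r) sums g r \<and>
      (g has_real_derivative suminf (\<lambda>k. ?f' k r)) (at r within {R1..R2})"
    by (rule has_field_derivative_series[OF _ f ul, of R1]) (use summable_phi[of R1 l] R12 in auto)
  then obtain g where g: "\<And>r. r \<in> {R1..R2} \<Longrightarrow> (\<lambda>n. ?f n r) sums g r"
      "\<And>r. r \<in> {R1..R2} \<Longrightarrow> (g has_real_derivative suminf (\<lambda>k. ?f' k r)) (at r within {R1..R2})"
    by blast
  have gphi: "g r = phi l r" if "r \<in> {R1..R2}" for r
    using g(1)[OF that] by (simp add: phi_def sums_iff)
  show ?thesis
    using g(2)[OF assms] unfolding eq[OF assms]
    by (rule has_field_derivative_transform_within[OF _ zero_less_one assms]) (use gphi in auto)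
qed

text \<open>The radial equation in divergence form. Multiplying by \<open>r ^ m\<close> leaves the
  fluxes themselves, whose derivatives are again coefficients, so the series can be differentiated
  termwise a second time.\<close>

lemma deriv_power_dphi:
  assumes "r \<in> {R1..R2}"
  shows "((\<lambda>r. r ^ m * dphi l r) has_real_derivative - l * (r ^ m * phi l r)) (at r within {R1..R2})"
proof -
  let ?f = "\<lambda>k r. (-l) ^ Suc k * flux k r"
  let ?f' = "\<lambda>k r. (-l) ^ Suc k * (r ^ m * coef k r)"
  have f: "(?f k has_real_derivative ?f' k r) (at r within {R1..R2})" if "r \<in> {R1..R2}" for k r
    by (rule DERIV_cmult[OF deriv_flux[OF that]])
  have eq: "suminf (\<lambda>k. ?f' k r) = - l * (r ^ m * phi l r)" if "r \<in> {R1..R2}" for r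
  proof -
    have "(\<lambda>k. (- l * r ^ m) * ((-l) ^ k * coef k r)) sums ((- l * r ^ m) * phi l r)"
      unfolding phi_def by (intro sums_mult summable_sums summable_phi that)
    then show ?thesis by (simp add: sums_iff ac_simps)
  qed
  have "norm (?f' k r) \<le> (\<bar>l\<bar> * R2 ^ m) * bnd \<bar>l\<bar> k" if "r \<in> {R1..R2}" for k r
  proof -
    have "norm (?f' k r) = (\<bar>l\<bar> * r ^ m) * norm ((-l) ^ k * coef k r)"
      using that R1 by (simp add: abs_mult power_abs)
    also have "\<dots> \<le> (\<bar>l\<bar> * R2 ^ m) * (1 * bnd \<bar>l\<bar> k)"
      using that R1 coef_term_bound(1)[of l "\<bar>l\<bar>" r k] by (intro mult_mono power_mono) auto
    finally show ?thesis by simp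
  qed
  then have ul: "uniform_limit {R1..R2} (\<lambda>n r. \<Sum>i<n. ?f' i r) (\<lambda>r. suminf (\<lambda>k. ?f' k r)) sequentially"
    by (rule Weierstrass_m_test[OF _ summable_bnd])
  have s: "(\<lambda>k. ?f k r) sums (r ^ m * dphi l r)" if "r \<in> {R1..R2}" for r
  proof -
    have "r > 0" using that R1 by auto
    moreover have "(\<lambda>k. r ^ m * ((-l) ^ Suc k * (flux k r / r ^ m))) sums (r ^ m * dphi l r)"
      unfolding dphi_def by (intro sums_mult summable_sums summable_dphi that)
    ultimately show ?thesis by (simp add: ac_simps)
  qed
  have "\<exists>g. \<forall>r\<in>{R1..R2}. (\<lambda>n. ?f n r) sums g r \<and>
      (g has_real_derivative suminf (\<lambda>k. ?f' k r)) (at r within {R1..R2})"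
    by (rule has_field_derivative_series[OF _ f ul, of R1]) (use sums_summable[OF s[of R1]] R12 in auto)
  then obtain g where g: "\<And>r. r \<in> {R1..R2} \<Longrightarrow> (\<lambda>n. ?f n r) sums g r"
      "\<And>r. r \<in> {R1..R2} \<Longrightarrow> (g has_real_derivative suminf (\<lambda>k. ?f' k r)) (at r within {R1..R2})"
    by blast
  have gs: "g r = r ^ m * dphi l r" if "r \<in> {R1..R2}" for r
    using g(1)[OF that] s[OF that] sums_unique2 by blast
  show ?thesis
    using g(2)[OF assms] unfolding eq[OF assms]
    by (rule has_field_derivative_transform_within[OF _ zero_less_one assms]) (use gs in auto)
qed

lemma deriv_dphi:
  assumes "r \<in> {R1..R2}"
  shows "(dphi l has_real_derivative - l * phi l r - real m / r * dphi l r) (at r within {R1..R2})"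
proof -
  have r: "r > 0" using assms R1 by auto
  have "((\<lambda>r. (r ^ m * dphi l r) / r ^ m) has_real_derivative
      ((- l * (r ^ m * phi l r)) * r ^ m - (r ^ m * dphi l r) * (real m * r ^ (m - 1))) / (r ^ m * r ^ m)) (at r within {R1..R2})"
    using r by (intro DERIV_divide deriv_power_dphi assms) (auto intro!: derivative_eq_intros)
  also have "((- l * (r ^ m * phi l r)) * r ^ m - (r ^ m * dphi l r) * (real m * r ^ (m - 1))) / (r ^ m * r ^ m)
      = - l * phi l r - real m / r * dphi l r"
    using r by (cases m) (simp_all add: field_simps)
  finally show ?thesis
    by (rule has_field_derivative_transform_within[OF _ zero_less_one assms]) (use R1 in auto)
qed

lemma phi_R1: "phi l R1 = 1"
proof -
  have "coef k R1 = 0" if "k \<noteq> 0" for k using that by (cases k) (simp_all add: coef_Suc)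
  then have "phi l R1 = (\<Sum>k\<in>{0}. (-l) ^ k * coef k R1)"
    unfolding phi_def by (intro suminf_finite) auto
  then show ?thesis by simp
qed

lemma dphi_R1: "dphi l R1 = - l * \<kappa>"
proof -
  have "flux k R1 = 0" if "k \<noteq> 0" for k using that by (simp add: flux_def)
  then have "dphi l R1 = (\<Sum>k\<in>{0}. (-l) ^ Suc k * (flux k R1 / R1 ^ m))"
    unfolding dphi_def by (intro suminf_finite) auto
  then show ?thesis using R1 by (simp add: flux_def)
qed

lemma phi_0: "r \<in> {R1..R2} \<Longrightarrow> phi 0 r = 1"
proof -
  have "phi 0 r = (\<Sum>k\<in>{0}. (-0) ^ k * coef k r)"
    unfolding phi_def by (intro suminf_finite) auto
  then show ?thesis by simp
qed

section \<open>The first parameter with a zero\<close>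

text \<open>While \<open>phi l\<close> is nonnegative, \<open>r ^ m * dphi l r\<close> is
  nonincreasing by the radial equation, so it stays below its value
  \<open>- R1 ^ m * l * \<kappa>\<close> at \<open>R1\<close>. Replacing \<open>r ^ m\<close> by
  \<open>R2 ^ m\<close> gives a bound uniform in \<open>r\<close>.\<close>

lemma dphi_upper_bound:
  assumes l: "0 \<le> l" and nn: "\<And>r. r \<in> {R1..R2} \<Longrightarrow> 0 \<le> phi l r" and r: "r \<in> {R1..R2}"
  shows "dphi l r \<le> - (l * \<kappa> * (R1 / R2) ^ m)"
proof -
  have "r ^ m * dphi l r \<le> R1 ^ m * dphi l R1"
  proof (cases "r = R1")
    case False
    then have "R1 < r" using r by auto
    then obtain x where x: "R1 < x" "x < r" "r ^ m * dphi l r - R1 ^ m * dphi l R1 = (r - R1) * (- l * (x ^ m * phi l x))"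
      using mvt_within_Icc[of R1 R2 "\<lambda>r. r ^ m * dphi l r", OF deriv_power_dphi, of R1 r] r by auto
    moreover have "(r - R1) * (l * (x ^ m * phi l x)) \<ge> 0"
      using x r R1 l nn[of x] by (intro mult_nonneg_nonneg) auto
    ultimately show ?thesis by simp
  qed simp
  then have "r ^ m * dphi l r \<le> - (R1 ^ m * l * \<kappa>)" by (simp add: dphi_R1 ac_simps)
  then have "dphi l r \<le> - (R1 ^ m * l * \<kappa>) / r ^ m"
    using r R1 by (subst pos_le_divide_eq) (auto simp: mult.commute)
  also have "\<dots> \<le> - (R1 ^ m * l * \<kappa>) / R2 ^ m"
    using r R1 R12 l \<kappa> by (simp add: frac_le power_mono)
  finally show ?thesis by (simp add: power_divide ac_simps)
qed

lemma exists_phi_nonpos: "\<exists>l\<ge>0. \<exists>r\<in>{R1..R2}. phi l r \<le> 0"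
proof (rule ccontr)
  assume "\<not> ?thesis"
  then have pos: "phi l r > 0" if "l \<ge> 0" "r \<in> {R1..R2}" for l r using that by (meson not_le)
  define c where "c = \<kappa> * (R1 / R2) ^ m"
  have c: "c > 0" using \<kappa> R1 R12 by (simp add: c_def)
  \<comment> \<open>For positive solutions the slope is at most \<open>- l * c\<close>. With this
    \<open>l\<close> the total drop over the interval is at least 1, the value at \<open>R1\<close>,
    so the solution cannot still be positive at \<open>R2\<close>.\<close>
  define l where "l = 1 / (c * (R2 - R1))"
  have l: "l > 0" using c R12 by (simp add: l_def)
  obtain x where x: "R1 < x" "x < R2" "phi l R2 - phi l R1 = (R2 - R1) * dphi l x"
    using mvt_within_Icc[of R1 R2 "phi l", OF deriv_phi, of R1 R2] R12 by auto
  have "dphi l x \<le> - (l * c)"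
    using dphi_upper_bound[of l x] l x pos by (force simp: c_def ac_simps less_imp_le)
  then have "(R2 - R1) * dphi l x \<le> (R2 - R1) * (- (l * c))" using R12 by (intro mult_left_mono) auto
  also have "\<dots> = -1" using c R12 by (simp add: l_def)
  finally show False using x(3) pos[of l R2] l R12 by (simp add: phi_R1)
qed

text \<open>The pairs \<open>(l, r)\<close> with \<open>phi l r \<le> 0\<close> and \<open>l\<close>
  in \<open>{0..L}\<close> form a nonempty compact set, on which the first coordinate attains its
  minimum. The minimum is positive because \<open>phi 0\<close> is constantly 1.\<close>

lemma exists_ground_value:
  "\<exists>l0>0. (\<exists>r\<in>{R1..R2}. phi l0 r \<le> 0) \<and> (\<forall>l. 0 \<le> l \<and> l < l0 \<longrightarrow> (\<forall>r\<in>{R1..R2}. 0 < phi l r))"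
proof -
  obtain L r where L: "L \<ge> 0" "r \<in> {R1..R2}" "phi L r \<le> 0" using exists_phi_nonpos by blast
  define S where "S = {0..L} \<times> {R1..R2}"
  define T where "T = S \<inter> (\<lambda>p. phi (fst p) (snd p)) -` {..0}"
  have S: "compact S" unfolding S_def by (intro compact_Times) auto
  have cont: "continuous_on S (\<lambda>p. phi (fst p) (snd p))"
    using L unfolding S_def by (intro continuous_on_subset[OF continuous_phi[of L]]) auto
  have "closed T" unfolding T_def
    by (rule continuous_closed_preimage[OF cont compact_imp_closed[OF S]]) simp
  then have "compact T" using S by (metis Int_absorb1 T_def closed_Int_compact inf.cobounded1 inf_commute)
  moreover have "(L, r) \<in> T" using L by (auto simp: T_def S_def)
  ultimately obtain p where p: "p \<in> T" "\<And>q. q \<in> T \<Longrightarrow> fst p \<le> fst q"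
    using continuous_attains_inf[of T fst] continuous_on_fst[OF continuous_on_id] by (metis empty_iff)
  have pos: "0 < phi l r'" if "0 \<le> l" "l < fst p" "r' \<in> {R1..R2}" for l r'
  proof (rule ccontr)
    assume "\<not> 0 < phi l r'"
    then have "(l, r') \<in> T" using that p(1) by (auto simp: T_def S_def)
    then show False using p(2) that by force
  qed
  have "fst p \<noteq> 0" using p(1) phi_0[of "snd p"] by (auto simp: T_def S_def)
  then have "fst p > 0" using p(1) by (auto simp: T_def S_def)
  moreover have "\<exists>r\<in>{R1..R2}. phi (fst p) r \<le> 0" using p(1) by (auto simp: T_def S_def)
  ultimately show ?thesis using pos by blast
qed

definition ground :: real where
  "ground = (SOME l0. 0 < l0 \<and> (\<exists>r\<in>{R1..R2}. phi l0 r \<le> 0) \<and> (\<forall>l. 0 \<le> l \<and> l < l0 \<longrightarrow> (\<forall>r\<in>{R1..R2}. 0 < phi l r)))"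

lemma shows ground_pos: "0 < ground" and ground_zero: "\<exists>r\<in>{R1..R2}. phi ground r \<le> 0"
  and phi_pos_below: "\<And>l r. 0 \<le> l \<Longrightarrow> l < ground \<Longrightarrow> r \<in> {R1..R2} \<Longrightarrow> 0 < phi l r"
  using someI_ex[OF exists_ground_value] unfolding ground_def[symmetric] by auto

lemma tendsto_section:
  fixes f :: "real \<Rightarrow> real \<Rightarrow> real"
  assumes "\<And>L. continuous_on ({-L..L} \<times> {R1..R2}) (\<lambda>p. f (fst p) (snd p))" and r: "r \<in> {R1..R2}"
  shows "((\<lambda>l. f l r) \<longlongrightarrow> f l0 r) (at l0)"
proof -
  define L where "L = \<bar>l0\<bar> + 1"
  have "continuous_on {-L..L} (\<lambda>l. (\<lambda>p. f (fst p) (snd p)) (l, r))"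
    using r by (intro continuous_on_compose2[OF assms(1)[of L]] continuous_intros) auto
  then have "continuous_on {-L<..<L} (\<lambda>l. f l r)" by (auto intro: continuous_on_subset)
  moreover have "l0 \<in> {-L<..<L}" by (auto simp: L_def)
  ultimately have "isCont (\<lambda>l. f l r) l0" by (meson continuous_on_eq_continuous_at open_greaterThanLessThan)
  then show ?thesis by (simp add: isCont_def)
qed

lemmas tendsto_phi = tendsto_section[of phi, OF continuous_phi]
  and tendsto_dphi = tendsto_section[of dphi, OF continuous_dphi]

text \<open>A limit from the left in \<open>l\<close>, where the solutions are positive.\<close>

lemma phi_ground_nonneg:
  assumes "r \<in> {R1..R2}"
  shows "0 \<le> phi ground r"
proof (rule tendsto_lowerbound)
  show "((\<lambda>l. phi l r) \<longlongrightarrow> phi ground r) (at_left ground)"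
    using tendsto_phi[OF assms] by (rule tendsto_mono[OF at_le, rotated]) auto
  show "\<forall>\<^sub>F l in at_left ground. 0 \<le> phi l r"
    using eventually_at_left_real[OF ground_pos] phi_pos_below assms
    by (auto elim!: eventually_mono intro: less_imp_le)
qed simp

lemma dphi_ground_neg:
  assumes "r \<in> {R1..R2}"
  shows "dphi ground r < 0"
proof -
  have "dphi ground r \<le> - (ground * \<kappa> * (R1 / R2) ^ m)"
    using ground_pos phi_ground_nonneg assms by (intro dphi_upper_bound) auto
  also have "\<dots> < 0" using ground_pos \<kappa> R1 R12 by simp
  finally show ?thesis .
qed

lemma phi_ground_decreasing:
  assumes "R1 \<le> r" "r < s" "s \<le> R2"
  shows "phi ground s < phi ground r"
proof -
  obtain x where x: "r < x" "x < s" "phi ground s - phi ground r = (s - r) * dphi ground x"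
    using mvt_within_Icc[of R1 R2 "phi ground", OF deriv_phi, of r s] assms by auto
  have "(s - r) * dphi ground x < 0"
    using x assms dphi_ground_neg[of x] by (intro mult_pos_neg) auto
  then show ?thesis using x(3) by simp
qed

lemma phi_ground_R2: "phi ground R2 = 0"
proof -
  obtain r where r: "r \<in> {R1..R2}" "phi ground r \<le> 0" using ground_zero by blast
  have "phi ground R2 \<le> 0"
    using phi_ground_decreasing[of r R2] r by (cases "r = R2") auto
  moreover have "0 \<le> phi ground R2" using phi_ground_nonneg R12 by simp
  ultimately show ?thesis by simp
qed

lemma phi_ground_pos: "R1 \<le> r \<Longrightarrow> r < R2 \<Longrightarrow> 0 < phi ground r"
  using phi_ground_decreasing[of r R2] phi_ground_R2 by simp

end


section \<open>Smooth functions\<close>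

lemma pderivative_eq:
  assumes "(f has_derivative f') (at x)"
  shows "pderivative i f x = f' (axis i 1)"
  using frechet_derivative_at[OF assms] by (simp add: pderivative_def)

lemma C_k_continuous: "C_k k f \<Longrightarrow> continuous_on UNIV f"
  by (cases k) (auto intro: differentiable_imp_continuous_on)

lemma C_k_pred: "C_k (Suc k) f \<Longrightarrow> C_k k f"
proof (induction k arbitrary: f)
  case 0
  then show ?case using C_k_continuous[OF 0] by simp
next
  case (Suc k)
  then show ?case by (metis C_k.simps(2))
qed

lemma has_derivative_frechet:
  "C_k (Suc k) f \<Longrightarrow> (f has_derivative frechet_derivative f (at x)) (at x)"
  by (auto simp: differentiable_on_def frechet_derivative_works[symmetric])

text \<open>\<open>pderivative\<close> is defined through the choice operator in
  \<open>frechet_derivative\<close>; this rule replaces it by any explicit derivative and carries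
  the closure properties of \<open>C_k\<close>.\<close>

lemma C_k_SucI:
  assumes "\<And>x. (f has_derivative f' x) (at x)" "\<And>i. C_k k (\<lambda>x. f' x (axis i 1))"
  shows "C_k (Suc k) f"
proof -
  have "pderivative i f = (\<lambda>x. f' x (axis i 1))" for i
    using pderivative_eq[OF assms(1)] by (auto simp: fun_eq_iff)
  then show ?thesis using assms by (auto simp: differentiable_on_def differentiable_def intro: has_derivative_at_withinI)
qed

lemma C_k_const: "C_k k (\<lambda>_. c)"
proof (induction k arbitrary: c)
  case (Suc k)
  show ?case by (rule C_k_SucI[of _ "\<lambda>_ _. 0"]) (auto intro: Suc)
qed simp

lemma C_k_add: "C_k k f \<Longrightarrow> C_k k g \<Longrightarrow> C_k k (\<lambda>x. f x + g x)"
proof (induction k arbitrary: f g)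
  case 0
  then show ?case by (auto intro: continuous_intros)
next
  case (Suc k)
  note fg = has_derivative_frechet[OF Suc.prems(1)] has_derivative_frechet[OF Suc.prems(2)]
  show ?case
  proof (rule C_k_SucI[OF has_derivative_add[OF fg]])
    fix i
    have "C_k k (pderivative i f)" "C_k k (pderivative i g)" using Suc.prems by auto
    from Suc.IH[OF this] show "C_k k (\<lambda>x. frechet_derivative f (at x) (axis i 1) + frechet_derivative g (at x) (axis i 1))"
      by (simp add: pderivative_def[abs_def])
  qed
qed

lemma C_k_mult: "C_k k f \<Longrightarrow> C_k k g \<Longrightarrow> C_k k (\<lambda>x. f x * g x)"
proof (induction k arbitrary: f g)
  case 0
  then show ?case by (auto intro: continuous_intros)
next
  case (Suc k)
  note fg = has_derivative_frechet[OF Suc.prems(1)] has_derivative_frechet[OF Suc.prems(2)]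
  show ?case
  proof (rule C_k_SucI[OF has_derivative_mult[OF fg]])
    fix i
    have "C_k k (pderivative i f)" "C_k k (pderivative i g)" using Suc.prems by auto
    then have "C_k k (\<lambda>x. f x * pderivative i g x + pderivative i f x * g x)"
      by (intro C_k_add Suc.IH C_k_pred[OF Suc.prems(1)] C_k_pred[OF Suc.prems(2)])
    then show "C_k k (\<lambda>x. f x * frechet_derivative g (at x) (axis i 1) + frechet_derivative f (at x) (axis i 1) * g x)"
      by (simp add: pderivative_def[abs_def])
  qed
qed

lemma C_k_cnj: "C_k k f \<Longrightarrow> C_k k (\<lambda>x. cnj (f x))"
proof (induction k arbitrary: f)
  case 0
  then show ?case by (auto intro: continuous_intros)
next
  case (Suc k)
  show ?case
  proof (rule C_k_SucI[OF has_derivative_cnj[OF has_derivative_frechet[OF Suc.prems]]])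
    fix i
    have "C_k k (pderivative i f)" using Suc.prems by auto
    from Suc.IH[OF this] show "C_k k (\<lambda>x. cnj (frechet_derivative f (at x) (axis i 1)))"
      by (simp add: pderivative_def[abs_def])
  qed
qed

lemma C_k_coord: "C_k k (\<lambda>x::real^'n. complex_of_real (x $ j))"
proof (cases k)
  case 0
  then show ?thesis by (auto intro!: continuous_intros)
next
  case (Suc l)
  have "((\<lambda>x::real^'n. complex_of_real (x $ j)) has_derivative (\<lambda>h. complex_of_real (h $ j))) (at x)" for x
    by (intro has_derivative_of_real bounded_linear.has_derivative[OF bounded_linear_vec_nth] has_derivative_ident)
  from C_k_SucI[OF this C_k_const] show ?thesis by (simp add: Suc)
qed

lemma smooth_const: "smooth (\<lambda>_. c)" by (simp add: smooth_def C_k_const)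
lemma smooth_add: "smooth f \<Longrightarrow> smooth g \<Longrightarrow> smooth (\<lambda>x. f x + g x)" by (simp add: smooth_def C_k_add)
lemma smooth_mult: "smooth f \<Longrightarrow> smooth g \<Longrightarrow> smooth (\<lambda>x. f x * g x)" by (simp add: smooth_def C_k_mult)
lemma smooth_cnj: "smooth f \<Longrightarrow> smooth (\<lambda>x. cnj (f x))" by (simp add: smooth_def C_k_cnj)
lemma smooth_coord: "smooth (\<lambda>x::real^'n. complex_of_real (x $ j))" by (simp add: smooth_def C_k_coord)

lemma smooth_sum: "(\<And>i. i \<in> A \<Longrightarrow> smooth (f i)) \<Longrightarrow> smooth (\<lambda>x. \<Sum>i\<in>A. f i x)"
  by (induction A rule: infinite_finite_induct) (auto intro: smooth_const smooth_add)

lemma smooth_power: "smooth f \<Longrightarrow> smooth (\<lambda>x. f x ^ n)"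
  by (induction n) (auto intro: smooth_const smooth_mult)

lemma smooth_inner_self: "smooth (\<lambda>x::real^'n. complex_of_real (x \<bullet> x))"
  unfolding inner_vec_def by (simp, intro smooth_sum smooth_mult smooth_coord)

lemma smooth_continuous: "smooth f \<Longrightarrow> continuous_on S f"
  unfolding smooth_def using C_k_continuous[of 0 f] continuous_on_subset[OF _ subset_UNIV] by blast

lemma smooth_pderivative: "smooth f \<Longrightarrow> smooth (pderivative i f)"
  unfolding smooth_def using C_k.simps(2) by blast

lemma smooth_continuous_grad: "smooth f \<Longrightarrow> continuous_on S (grad f)"
  unfolding grad_def[abs_def]
  by (intro continuous_intros smooth_continuous smooth_pderivative)

lemma smooth_has_derivative:
  assumes "smooth f"
  shows "(f has_derivative (\<lambda>h. \<Sum>i\<in>UNIV. h $ i *\<^sub>R grad f x $ i)) (at x)"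
proof -
  let ?D = "frechet_derivative f (at x)"
  have D: "(f has_derivative ?D) (at x)"
    using assms has_derivative_frechet[of 0] unfolding smooth_def by blast
  then have lin: "linear ?D" by (rule has_derivative_linear)
  have "?D h = (\<Sum>i\<in>UNIV. h $ i *\<^sub>R grad f x $ i)" for h
  proof -
    have "h = (\<Sum>i\<in>UNIV. h $ i *\<^sub>R axis i 1)"
      using basis_expansion[of h] by (simp add: scalar_mult_eq_scaleR)
    then have "?D h = ?D (\<Sum>i\<in>UNIV. h $ i *\<^sub>R axis i 1)" by simp
    also have "\<dots> = (\<Sum>i\<in>UNIV. h $ i *\<^sub>R ?D (axis i 1))"
      using lin by (simp add: linear_sum linear_cmul)
    finally show ?thesis by (simp add: grad_def pderivative_def)
  qed
  with D show ?thesis by (metis (no_types, lifting) ext)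
qed

section \<open>Radial functions and their approximation by polynomials\<close>

definition cvec :: "real^'n \<Rightarrow> complex^'n" where
  "cvec x = (\<chi> i. of_real (x $ i))"

lemma norm_cvec [simp]: "norm (cvec x) = norm x"
  by (simp add: norm_vec_def cvec_def)

lemma cvec_nth [simp]: "cvec x $ i = of_real (x $ i)" by (simp add: cvec_def)

lemma cvec_diff: "cvec x - cvec y = cvec (x - y)" by (simp add: vec_eq_iff)

lemma continuous_on_cvec [continuous_intros]: "continuous_on S f \<Longrightarrow> continuous_on S (\<lambda>x. cvec (f x))"
  unfolding cvec_def by (intro continuous_intros)

text \<open>Polynomials in \<open>x \<bullet> x\<close> rather than in \<open>norm x\<close>:
  \<open>smooth\<close> refers to the whole space, and \<open>norm\<close> is not differentiable at
  the origin.\<close>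

lemma radial_polynomial:
  fixes a :: "nat \<Rightarrow> real" and n :: nat
  defines "F \<equiv> \<lambda>x::real^'n. complex_of_real (\<Sum>i\<le>n. a i * (x \<bullet> x) ^ i)"
  shows smooth_radial_polynomial: "smooth F"
    and grad_radial_polynomial: "grad F x = cvec ((2 * (\<Sum>i\<le>n. a i * (real i * (x \<bullet> x) ^ (i - 1)))) *\<^sub>R x)"
proof -
  have "F = (\<lambda>x. \<Sum>i\<le>n. complex_of_real (a i) * complex_of_real (x \<bullet> x) ^ i)"
    unfolding F_def by auto
  then show "smooth F" by (simp add: smooth_sum smooth_mult smooth_const smooth_power smooth_inner_self)
  have "(F has_derivative (\<lambda>h. complex_of_real (\<Sum>i\<le>n. a i * (real i * (2 * (x \<bullet> h)) * (x \<bullet> x) ^ (i - 1))))) (at x)"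
    unfolding F_def by (auto intro!: derivative_eq_intros simp: inner_commute ac_simps)
  note pd = pderivative_eq[OF this]
  show "grad F x = cvec ((2 * (\<Sum>i\<le>n. a i * (real i * (x \<bullet> x) ^ (i - 1)))) *\<^sub>R x)"
    unfolding vec_eq_iff grad_def
    by (auto simp: pd inner_axis sum_distrib_left sum_distrib_right ac_simps)
qed

text \<open>A radial gradient is parallel to the normal, so its tangential projection vanishes. The
  two orientations of \<open>annulus_normal\<close> are treated together by a sign \<open>s\<close>
  with \<open>s * s = 1\<close>.\<close>

lemma tangential_grad_radial:
  assumes "x \<noteq> 0" "grad F x = cvec (c *\<^sub>R x)"
  shows "tangential_grad (annulus_normal r) F x = 0"
proof -
  obtain s :: real where s: "s * s = 1" "annulus_normal r x = (s / norm x) *\<^sub>R x"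
    by (cases "norm x = r")
       (auto simp: annulus_normal_def divide_inverse intro: that[of 1] that[of "-1"])
  have "(\<Sum>j\<in>UNIV. grad F x $ j * of_real (annulus_normal r x $ j)) = complex_of_real (\<Sum>j\<in>UNIV. (c * x $ j) * (s / norm x * x $ j))"
    by (simp add: assms(2) s(2))
  also have "(\<Sum>j\<in>UNIV. (c * x $ j) * (s / norm x * x $ j)) = c * (s / norm x) * (x \<bullet> x)"
    by (simp add: inner_vec_def sum_distrib_left ac_simps)
  also have "\<dots> = c * s * norm x"
    using assms(1) by (simp add: power2_norm_eq_inner[symmetric] power2_eq_square)
  finally have sum: "(\<Sum>j\<in>UNIV. grad F x $ j * of_real (annulus_normal r x $ j)) = complex_of_real (c * s * norm x)" .
  have "c * s * norm x * (s / norm x * x $ i) = c * x $ i" for i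
    using assms(1) s(1) by (simp add: field_simps)
  then have "complex_of_real (c * s * norm x) * complex_of_real (s / norm x * x $ i) = complex_of_real (c * x $ i)" for i
    by (simp only: of_real_mult[symmetric])
  then show ?thesis
    unfolding tangential_grad_def sum vec_eq_iff by (simp add: assms(2) s(2) del: of_real_mult of_real_divide)
qed

text \<open>Uniform approximation of \<open>\<phi>\<close> alone would not control gradients. So the
  derivative with respect to the squared radius is approximated by a polynomial, which is then
  integrated.\<close>

lemma radial_approximation:
  fixes \<phi> \<phi>' :: "real \<Rightarrow> real"
  assumes R: "0 < R1" "R1 < R2" and \<epsilon>: "\<epsilon> > 0"
    and \<phi>: "\<And>r. r \<in> {R1..R2} \<Longrightarrow> (\<phi> has_real_derivative \<phi>' r) (at r within {R1..R2})"
    and \<phi>': "continuous_on {R1..R2} \<phi>'"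
  shows "\<exists>F::real^'n \<Rightarrow> complex. smooth F \<and> (\<forall>x. x \<noteq> 0 \<longrightarrow> tangential_grad (annulus_normal R1) F x = 0) \<and>
     (\<forall>x. norm x \<in> {R1..R2} \<longrightarrow> norm (F x - of_real (\<phi> (norm x))) \<le> \<epsilon> \<and>
        norm (grad F x - cvec ((\<phi>' (norm x) / norm x) *\<^sub>R x)) \<le> \<epsilon>)"
proof -
  \<comment> \<open>The derivative of \<open>\<phi> (sqrt s)\<close> with respect to
    \<open>s\<close>.\<close>
  define q where "q s = \<phi>' (sqrt s) / (2 * sqrt s)" for s
  have sq: "sqrt ` {R1\<^sup>2..R2\<^sup>2} \<subseteq> {R1..R2}"
    using R real_le_rsqrt real_sqrt_le_iff by (auto simp: real_le_lsqrt)
  have "continuous_on {R1\<^sup>2..R2\<^sup>2} q"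
    unfolding q_def using R
    by (intro continuous_intros continuous_on_compose2[OF \<phi>' _ sq]) (auto dest: order.strict_trans2[OF zero_less_power[of R1 2]])
  \<comment> \<open>Returning from \<open>s\<close> to the radius costs a factor
    \<open>2 * r\<close>, at most \<open>2 * R2\<close>; integrating over the interval costs at most
    \<open>R2 - R1\<close>. The summand 1 covers the gradient estimate, which is not
    integrated.\<close>
  define \<delta> where "\<delta> = \<epsilon> / (2 * R2 * (1 + (R2 - R1)))"
  have \<delta>: "\<delta> > 0" using R \<epsilon> by (simp add: \<delta>_def)
  have \<delta>1: "2 * R2 * \<delta> \<le> \<epsilon>" "(R2 - R1) * (2 * R2 * \<delta>) \<le> \<epsilon>"
  proof -
    let ?D = "1 + (R2 - R1)"
    have e: "2 * R2 * \<delta> = \<epsilon> / ?D" using R by (simp add: \<delta>_def)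
    have D: "?D \<ge> 1" "R2 - R1 \<le> ?D" using R by auto
    show "2 * R2 * \<delta> \<le> \<epsilon>" unfolding e using D \<epsilon> mult_left_mono[of 1 ?D \<epsilon>] by (subst pos_divide_le_eq) auto
    show "(R2 - R1) * (2 * R2 * \<delta>) \<le> \<epsilon>"
      unfolding e times_divide_eq_right using D \<epsilon> mult_right_mono[OF D(2), of \<epsilon>]
      by (subst pos_divide_le_eq) (auto simp: mult.commute)
  qed
  obtain p where p: "real_polynomial_function p" "\<And>s. s \<in> {R1\<^sup>2..R2\<^sup>2} \<Longrightarrow> \<bar>q s - p s\<bar> < \<delta>"
    using Stone_Weierstrass_real_polynomial_function[OF compact_Icc \<open>continuous_on {R1\<^sup>2..R2\<^sup>2} q\<close> \<delta>] by blast
  obtain b n where b: "p = (\<lambda>s. \<Sum>i\<le>n. b i * s ^ i)"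
    using p(1) real_polynomial_function_iff_sum by blast
  define P0 where "P0 s = (\<Sum>i\<le>n. b i / real (Suc i) * s ^ Suc i)" for s
  \<comment> \<open>The constant coefficient makes \<open>P\<close> agree with \<open>\<phi>\<close>
    at the inner radius, so the error in value is the integral of the error in slope.\<close>
  define a where "a i = (case i of 0 \<Rightarrow> \<phi> R1 - P0 (R1\<^sup>2) | Suc j \<Rightarrow> b j / real (Suc j))" for i
  define P where "P s = (\<Sum>i\<le>Suc n. a i * s ^ i)" for s
  have P: "P s = \<phi> R1 - P0 (R1\<^sup>2) + P0 s" for s
    unfolding P_def by (subst sum.atMost_Suc_shift) (simp add: a_def P0_def)
  have dsum: "(\<Sum>i\<le>Suc n. a i * (real i * s ^ (i - 1))) = p s" for s
    unfolding b by (subst sum.atMost_Suc_shift) (auto simp: a_def intro!: sum.cong)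
  define F where "F x = complex_of_real (\<Sum>i\<le>Suc n. a i * (x \<bullet> x) ^ i)" for x :: "real^'n"
  have F: "smooth F" unfolding F_def by (rule smooth_radial_polynomial)
  have gF: "grad F x = cvec ((2 * p (x \<bullet> x)) *\<^sub>R x)" for x
    unfolding F_def grad_radial_polynomial dsum ..
  have FP: "F x = of_real (P ((norm x)\<^sup>2))" for x
    by (simp add: F_def P_def power2_norm_eq_inner)
  have dP: "(P has_real_derivative p s) (at s within S)" for s S
  proof -
    have "(P has_real_derivative (\<Sum>i\<le>Suc n. a i * (real i * s ^ (i - 1)))) (at s within S)"
      unfolding P_def by (intro DERIV_sum DERIV_cmult) (auto intro!: derivative_eq_intros)
    then show ?thesis by (simp only: dsum)
  qed
  have near: "\<bar>\<phi>' r - 2 * r * p (r\<^sup>2)\<bar> \<le> 2 * R2 * \<delta>" if r: "r \<in> {R1..R2}" for r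
  proof -
    have "r\<^sup>2 \<in> {R1\<^sup>2..R2\<^sup>2}" using r R by (auto intro: power_mono)
    from p(2)[OF this] have "\<bar>\<phi>' r / (2 * r) - p (r\<^sup>2)\<bar> < \<delta>" using r R by (simp add: q_def)
    moreover have "\<phi>' r - 2 * r * p (r\<^sup>2) = 2 * r * (\<phi>' r / (2 * r) - p (r\<^sup>2))" using r R by (simp add: field_simps)
    ultimately show ?thesis using r R by (auto simp: abs_mult intro!: mult_mono)
  qed
  have "\<bar>P (r\<^sup>2) - \<phi> r\<bar> \<le> \<epsilon>" if r: "r \<in> {R1..R2}" for r
  proof (cases "r = R1")
    case True
    then show ?thesis using \<epsilon> by (simp add: P)
  next
    case False
    define k where "k r = P (r\<^sup>2) - \<phi> r" for r
    have dk: "(k has_real_derivative (p (r\<^sup>2) * (2 * r) - \<phi>' r)) (at r within {R1..R2})" if "R1 \<le> r" "r \<le> R2" for r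
    proof -
      have "((\<lambda>r. P (r\<^sup>2)) has_real_derivative (p (r\<^sup>2) * (2 * r))) (at r within {R1..R2})"
        by (rule DERIV_chain2[OF dP]) (auto intro!: derivative_eq_intros)
      then show ?thesis unfolding k_def using \<phi>[of r] that by (intro DERIV_diff) auto
    qed
    obtain x where x: "R1 < x" "x < r" "k r - k R1 = (r - R1) * (p (x\<^sup>2) * (2 * x) - \<phi>' x)"
      using mvt_within_Icc[of R1 R2 k, OF dk, of R1 r] False r by auto
    have "\<bar>k r\<bar> = (r - R1) * \<bar>\<phi>' x - 2 * x * p (x\<^sup>2)\<bar>"
      using x r by (simp add: k_def P abs_mult abs_minus_commute ac_simps)
    also have "\<dots> \<le> (R2 - R1) * (2 * R2 * \<delta>)"
      using near[of x] x r by (intro mult_mono) auto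
    finally show ?thesis using \<delta>1 by (simp add: k_def)
  qed
  then have 1: "norm (F x - of_real (\<phi> (norm x))) \<le> \<epsilon>" if "norm x \<in> {R1..R2}" for x
    unfolding FP of_real_diff[symmetric] norm_of_real using that by blast
  have 2: "norm (grad F x - cvec ((\<phi>' (norm x) / norm x) *\<^sub>R x)) \<le> \<epsilon>" if x: "norm x \<in> {R1..R2}" for x
  proof -
    have "norm (grad F x - cvec ((\<phi>' (norm x) / norm x) *\<^sub>R x))
        = \<bar>2 * p (x \<bullet> x) - \<phi>' (norm x) / norm x\<bar> * norm x"
      by (simp add: gF cvec_diff scaleR_diff_left[symmetric])
    also have "\<dots> = \<bar>\<phi>' (norm x) - 2 * norm x * p ((norm x)\<^sup>2)\<bar>"
    proof -
      have "norm x > 0" using x R by auto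
      then have "\<bar>2 * p (x \<bullet> x) - \<phi>' (norm x) / norm x\<bar> * norm x
        = \<bar>(2 * p (x \<bullet> x) - \<phi>' (norm x) / norm x) * norm x\<bar>" by (simp only: abs_mult abs_norm_cancel)
      also have "(2 * p (x \<bullet> x) - \<phi>' (norm x) / norm x) * norm x = - (\<phi>' (norm x) - 2 * norm x * p ((norm x)\<^sup>2))"
        using \<open>norm x > 0\<close> by (simp add: field_simps power2_norm_eq_inner)
      finally show ?thesis by simp
    qed
    also have "\<dots> \<le> \<epsilon>" using near[OF x] \<delta>1 by linarith
    finally show ?thesis .
  qed
  show ?thesis using F 1 2 tangential_grad_radial[OF _ gF] by blast
qed

section \<open>Integration by parts against test functions\<close>

lemma pderivative_eq_0_outside:
  fixes h :: "real^'n \<Rightarrow> complex"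
  assumes "closed S" "\<And>x. x \<notin> S \<Longrightarrow> h x = 0" "x \<notin> S"
  shows "pderivative i h x = 0"
proof -
  have "(h has_derivative (\<lambda>_. 0)) (at x)"
    by (rule has_derivative_transform_within_open[of "\<lambda>_. 0" _ _ _ "- S"]) (use assms in auto)
  from pderivative_eq[OF this] show ?thesis by simp
qed

lemma smooth_vector_derivative_line:
  assumes "smooth h"
  shows "((\<lambda>t. h (x + t *\<^sub>R y)) has_vector_derivative (\<Sum>i\<in>UNIV. y $ i *\<^sub>R grad h (x + t *\<^sub>R y) $ i)) (at t within S)"
proof -
  have "((\<lambda>t. x + t *\<^sub>R y) has_derivative (\<lambda>s. s *\<^sub>R y)) (at t within S)"
    by (auto intro!: derivative_eq_intros)
  from has_derivative_compose[OF this smooth_has_derivative[OF assms]]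
  show ?thesis by (simp add: has_vector_derivative_def scaleR_sum_right)
qed

lemma integral_lborel_translation:
  fixes f :: "'a::euclidean_space \<Rightarrow> 'b::{banach, second_countable_topology}"
  assumes "f \<in> borel_measurable borel"
  shows "(LINT x|lborel. f (x + c)) = (LINT x|lborel. f x)"
proof -
  have "(LINT x|lborel. f x) = (LINT x|distr lborel borel ((+) c). f x)" by (simp only: lborel_distr_plus)
  also have "\<dots> = (LINT x|lborel. f (c + x))" using assms by (subst integral_distr) auto
  finally show ?thesis by (simp only: add.commute[of c])
qed

text \<open>Translation invariance replaces iterated integration. The increment
  \<open>h (x + e) - h x\<close> is the integral of the derivative along the unit segment in
  direction \<open>e\<close>. Integrated over \<open>x\<close>, the left side is 0, and by Fubini
  the right side is the integral of the derivative.\<close>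

lemma integral_pderivative_eq_0:
  fixes h :: "real^'n \<Rightarrow> complex"
  assumes h: "smooth h" and supp: "\<And>x. norm x > \<rho> \<Longrightarrow> h x = 0"
  shows "integrable lborel (pderivative i h)" "(LINT x|lborel. pderivative i h x) = 0"
proof -
  define e :: "real^'n" where "e = axis i 1"
  define D where "D = pderivative i h"
  have ne: "norm e = 1" by (simp add: e_def)
  have cD: "continuous_on S D" for S unfolding D_def by (intro smooth_continuous smooth_pderivative h)
  have mD [measurable]: "D \<in> borel_measurable borel" by (rule borel_measurable_continuous_onI[OF cD])
  have mh [measurable]: "h \<in> borel_measurable borel" by (rule borel_measurable_continuous_onI[OF smooth_continuous[OF h]])
  have D0: "D x = 0" if "x \<notin> cball 0 \<rho>" for x
    unfolding D_def by (rule pderivative_eq_0_outside[OF closed_cball _ that]) (auto intro!: supp)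
  have eq: "(\<lambda>x. indicator (cball 0 \<rho>) x *\<^sub>R D x) = D" using D0 by (auto simp: fun_eq_iff split: split_indicator)
  have eqh: "(\<lambda>x. indicator (cball 0 \<rho>) x *\<^sub>R h x) = h" using supp by (auto simp: fun_eq_iff split: split_indicator)
  have iD: "integrable lborel D"
    using borel_integrable_compact[OF compact_cball[of 0 \<rho>] cD] by (simp add: set_integrable_def eq)
  have ih: "integrable lborel h"
    using borel_integrable_compact[OF compact_cball[of 0 \<rho>] smooth_continuous[OF h]] by (simp add: set_integrable_def eqh)
  show "integrable lborel (pderivative i h)" using iD by (simp add: D_def)
  have "bounded (D ` cball 0 \<rho>)" by (intro compact_imp_bounded compact_continuous_image cD compact_cball)
  then obtain B0 where "\<forall>x\<in>cball 0 \<rho>. norm (D x) \<le> B0" unfolding bounded_iff by auto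
  then have B: "norm (D x) \<le> max B0 0" for x
    using D0[of x] by (cases "x \<in> cball 0 \<rho>") (auto simp: le_max_iff_disj)
  define k where "k x t = indicator {0..1::real} t *\<^sub>R D (x + t *\<^sub>R e)" for x t
  have mk [measurable]: "case_prod k \<in> borel_measurable (borel \<Otimes>\<^sub>M borel)" unfolding k_def by measurable
  have ik: "integrable (lborel \<Otimes>\<^sub>M lborel) (case_prod k)"
  proof (rule integrableI_bounded_set[where A="cball 0 (\<rho> + 1) \<times> {0..1}" and B="max B0 0"])
    show "emeasure (lborel \<Otimes>\<^sub>M lborel) (cball (0::real^'n) (\<rho> + 1) \<times> {0..1::real}) < \<infinity>"
    proof -
      have "emeasure lborel (cball (0::real^'n) (\<rho> + 1)) < \<infinity>"
        by (rule emeasure_bounded_finite[OF bounded_cball])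
      then show ?thesis by (simp add: lborel.emeasure_pair_measure_Times)
    qed
    show "AE p in lborel \<Otimes>\<^sub>M lborel. p \<notin> cball 0 (\<rho> + 1) \<times> {0..1} \<longrightarrow> case_prod k p = 0"
    proof (intro AE_I2 impI)
      fix p :: "(real^'n) \<times> real" assume p: "p \<notin> cball 0 (\<rho> + 1) \<times> {0..1}"
      obtain x t where xt: "p = (x, t)" by (cases p)
      then have n: "(x, t) \<notin> cball 0 (\<rho> + 1) \<times> {0..1}" using p by simp
      have "k x t = 0"
      proof (cases "t \<in> {0..1}")
        case True
        then have "norm x > \<rho> + 1" using n by auto
        moreover have "norm x \<le> norm (x + t *\<^sub>R e) + norm (t *\<^sub>R e)" using norm_triangle_ineq4[of "x + t *\<^sub>R e" "t *\<^sub>R e"] by simp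
        moreover have "norm (t *\<^sub>R e) \<le> 1" using True ne by simp
        ultimately have "x + t *\<^sub>R e \<notin> cball 0 \<rho>" by auto
        then show ?thesis by (simp add: k_def D0)
      qed (simp add: k_def)
      then show "case_prod k p = 0" by (simp add: xt)
    qed
  qed (use B in \<open>auto simp: k_def split: split_indicator\<close>)
  have fub: "(LINT t|lborel. LINT x|lborel. k x t) = (LINT x|lborel. LINT t|lborel. k x t)"
    by (rule lborel_pair.Fubini_integral[OF ik])
  have inner: "(LINT t|lborel. k x t) = h (x + e) - h x" for x
  proof -
    have "has_bochner_integral lborel (\<lambda>t. indicator {0..1} t *\<^sub>R D (x + t *\<^sub>R e)) (h (x + 1 *\<^sub>R e) - h (x + 0 *\<^sub>R e))"
    proof (rule has_bochner_integral_FTC_Icc)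
      show "continuous_on {0..1} (\<lambda>t. D (x + t *\<^sub>R e))"
        by (intro continuous_on_compose2[OF cD[of UNIV]] continuous_intros) auto
      fix t :: real
      have "(\<Sum>j\<in>UNIV. e $ j *\<^sub>R grad h (x + t *\<^sub>R e) $ j) = D (x + t *\<^sub>R e)"
        by (simp add: e_def axis_def D_def grad_def if_distrib[of "\<lambda>c. c *\<^sub>R _"] cong: if_cong)
      then show "((\<lambda>t. h (x + t *\<^sub>R e)) has_vector_derivative D (x + t *\<^sub>R e)) (at t within {0..1})"
        using smooth_vector_derivative_line[OF h, of x e t "{0..1}"] by simp
    qed simp
    then show ?thesis by (simp add: k_def has_bochner_integral_integral_eq)
  qed
  have shift: "(LINT x|lborel. h (x + e) - h x) = 0"
  proof -
    have "integrable lborel (\<lambda>x. h (e + x))"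
      using integrable_distr_eq[of "(+) e" lborel borel h] ih by (simp add: lborel_distr_plus)
    then show ?thesis using ih integral_lborel_translation[OF mh, of e] by (simp add: add.commute)
  qed
  have "(LINT t|lborel. LINT x|lborel. k x t) = (LINT t|lborel. indicator {0..1::real} t *\<^sub>R (LINT x|lborel. D x))"
    using integral_lborel_translation[OF mD] by (simp add: k_def)
  also have "\<dots> = (LINT x|lborel. D x)" by simp
  finally show "(LINT x|lborel. pderivative i h x) = 0" using fub shift by (simp add: D_def inner)
qed

lemma pderivative_mult:
  assumes "smooth f" "smooth g"
  shows "pderivative i (\<lambda>x. f x * g x) x = f x * pderivative i g x + pderivative i f x * g x"
proof -
  have "(f has_derivative frechet_derivative f (at x)) (at x)" "(g has_derivative frechet_derivative g (at x)) (at x)"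
    using assms has_derivative_frechet[of 0] unfolding smooth_def by blast+
  from pderivative_eq[OF has_derivative_mult[OF this]] show ?thesis by (simp add: pderivative_def)
qed

text \<open>The product with a test function has compact support in \<open>\<Omega>\<close>, so its
  partial derivative integrates to 0 over the whole space as well as over
  \<open>\<Omega>\<close>.\<close>

lemma integration_by_parts_test_function:
  fixes F :: "real^'n \<Rightarrow> complex"
  assumes F: "smooth F" and f: "test_function \<Omega> f" and \<Omega>: "open \<Omega>"
  shows "(LINT x|lebesgue_on \<Omega>. F x * pderivative i f x) = - (LINT x|lebesgue_on \<Omega>. pderivative i F x * f x)"
proof -
  let ?S = "closure {x. f x \<noteq> 0}"
  have fs: "smooth f" and S: "compact ?S" "?S \<subseteq> \<Omega>" using f by (auto simp: test_function_def)
  have f0: "f x = 0" if "x \<notin> ?S" for x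
    using that closure_subset[of "{x. f x \<noteq> 0}"] by auto
  have df0: "pderivative j f x = 0" if "x \<notin> ?S" for x j
    by (rule pderivative_eq_0_outside[OF closed_closure f0 that])
  obtain \<rho> where \<rho>: "\<And>x. x \<in> ?S \<Longrightarrow> norm x \<le> \<rho>" using compact_imp_bounded[OF S(1)] by (auto simp: bounded_iff)
  define h where "h = (\<lambda>x. F x * f x)"
  have h: "smooth h" unfolding h_def by (intro smooth_mult F fs)
  have ph: "pderivative i h x = F x * pderivative i f x + pderivative i F x * f x" for x
    unfolding h_def by (rule pderivative_mult[OF F fs])
  have h0: "h x = 0" if "norm x > \<rho>" for x using that \<rho>[of x] f0[of x] by (auto simp: h_def)
  note ip = integral_pderivative_eq_0[OF h h0, where i=i]
  have conv: "integrable (lebesgue_on \<Omega>) w \<and> (LINT x|lebesgue_on \<Omega>. w x) = (LINT x|lborel. w x)"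
    if w: "continuous_on UNIV w" "\<And>x. x \<notin> ?S \<Longrightarrow> w x = 0" for w :: "real^'n \<Rightarrow> complex"
  proof -
    have eq: "(\<lambda>x. indicator ?S x *\<^sub>R w x) = w" using w(2) by (auto simp: fun_eq_iff split: split_indicator)
    have eq2: "(\<lambda>x. indicator \<Omega> x *\<^sub>R w x) = w" using w(2) S by (auto simp: fun_eq_iff split: split_indicator)
    have mw: "w \<in> borel_measurable borel" by (rule borel_measurable_continuous_onI[OF w(1)])
    have "integrable lborel w"
      using borel_integrable_compact[OF S(1) continuous_on_subset[OF w(1)]] by (simp add: set_integrable_def eq)
    then have "integrable lebesgue w" using mw by (subst integrable_completion) simp_all
    moreover have "\<Omega> \<inter> space lebesgue \<in> sets lebesgue" using \<Omega> by simp
    ultimately show ?thesis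
      using mw by (simp add: integrable_restrict_space integral_restrict_space set_integrable_def eq2 integral_completion)
  qed
  have 1: "integrable (lebesgue_on \<Omega>) (\<lambda>x. F x * pderivative i f x)"
    by (rule conjunct1[OF conv]) (auto simp: df0 intro!: continuous_intros smooth_continuous smooth_mult smooth_pderivative F fs)
  have 2: "integrable (lebesgue_on \<Omega>) (\<lambda>x. pderivative i F x * f x)"
  proof (rule conjunct1[OF conv])
    show "continuous_on UNIV (\<lambda>x. pderivative i F x * f x)"
      by (intro smooth_continuous smooth_mult smooth_pderivative F fs)
    show "pderivative i F x * f x = 0" if "x \<notin> closure {x. f x \<noteq> 0}" for x
      using f0[OF that] by simp
  qed
  have "(LINT x|lebesgue_on \<Omega>. pderivative i h x) = (LINT x|lborel. pderivative i h x)"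
  proof (rule conjunct2[OF conv])
    show "continuous_on UNIV (pderivative i h)" by (intro smooth_continuous smooth_pderivative h)
    show "pderivative i h x = 0" if "x \<notin> closure {x. f x \<noteq> 0}" for x
      using f0[OF that] df0[OF that] by (simp add: ph)
  qed
  with ip(2) have "(LINT x|lebesgue_on \<Omega>. pderivative i h x) = 0" by simp
  then have "(LINT x|lebesgue_on \<Omega>. F x * pderivative i f x) + (LINT x|lebesgue_on \<Omega>. pderivative i F x * f x) = 0"
    using 1 2 by (simp add: ph)
  then show ?thesis by (simp only: eq_neg_iff_add_eq_0)
qed


section \<open>Convergence in the mean\<close>

lemma norm_diff_sq_le: "(norm (a - b :: 'a::real_normed_vector))\<^sup>2 \<le> 2 * (norm a)\<^sup>2 + 2 * (norm b)\<^sup>2"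
proof -
  have "(norm (a - b))\<^sup>2 \<le> (norm a + norm b)\<^sup>2" by (intro power_mono norm_triangle_ineq4) simp
  also have "\<dots> \<le> 2 * (norm a)\<^sup>2 + 2 * (norm b)\<^sup>2"
    using zero_le_power2[of "norm a - norm b"] by (simp add: power2_eq_square algebra_simps)
  finally show ?thesis .
qed

lemma L2_diff:
  fixes f g :: "'a \<Rightarrow> 'b::{real_normed_vector, second_countable_topology}"
  assumes "L2 M f" "L2 M g"
  shows "L2 M (\<lambda>x. f x - g x)"
proof -
  have [measurable]: "f \<in> borel_measurable M" "g \<in> borel_measurable M" using assms by (auto simp: L2_def)
  have "integrable M (\<lambda>x. 2 * (norm (f x))\<^sup>2 + 2 * (norm (g x))\<^sup>2)" using assms by (auto simp: L2_def)
  then have "integrable M (\<lambda>x. (norm (f x - g x))\<^sup>2)"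
    by (rule Bochner_Integration.integrable_bound) (auto simp: norm_diff_sq_le)
  then show ?thesis by (simp add: L2_def)
qed

lemma L2_mult_integrable:
  fixes f g :: "'a \<Rightarrow> 'b::{real_normed_algebra, banach, second_countable_topology}"
  assumes "L2 M f" "L2 M g"
  shows "integrable M (\<lambda>x. f x * g x)"
proof -
  have [measurable]: "f \<in> borel_measurable M" "g \<in> borel_measurable M" using assms by (auto simp: L2_def)
  have le: "norm (a * b) \<le> (norm a)\<^sup>2 + (norm b)\<^sup>2" for a b :: 'b
  proof -
    have "norm (a * b) \<le> norm a * norm b" by (rule norm_mult_ineq)
    also have "\<dots> \<le> (norm a)\<^sup>2 + (norm b)\<^sup>2"
      using sum_squares_bound[of "norm a" "norm b"] mult_nonneg_nonneg[OF norm_ge_zero[of a] norm_ge_zero[of b]] by linarith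
    finally show ?thesis .
  qed
  have "integrable M (\<lambda>x. (norm (f x))\<^sup>2 + (norm (g x))\<^sup>2)" using assms by (auto simp: L2_def)
  then show ?thesis
    by (rule Bochner_Integration.integrable_bound) (auto simp: le)
qed

lemma L2_tendsto_iff:
  fixes f :: "'a \<Rightarrow> 'b::{real_normed_vector, second_countable_topology}"
  assumes "\<And>n. L2 M (F n)" "L2 M f"
  shows "L2_tendsto M F f \<longleftrightarrow> (\<lambda>n. \<integral>x. (norm (F n x - f x))\<^sup>2 \<partial>M) \<longlonglongrightarrow> 0"
proof -
  have "integrable M (\<lambda>x. (norm (F n x - f x))\<^sup>2)" for n
    using L2_diff[OF assms(1,2)] by (simp add: L2_def)
  then have "(\<integral>\<^sup>+x. ennreal ((norm (F n x - f x))\<^sup>2) \<partial>M) = ennreal (\<integral>x. (norm (F n x - f x))\<^sup>2 \<partial>M)" for n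
    by (rule nn_integral_eq_integral) simp
  then show ?thesis
    unfolding L2_tendsto_def by (simp flip: ennreal_0 add: tendsto_ennreal_iff)
qed

text \<open>The form in which Young's inequality delivers its estimates: \<open>C \<eta>\<close> may
  blow up for small \<open>\<eta>\<close>, but \<open>\<eta>\<close> is fixed before
  \<open>n\<close> grows.\<close>

lemma tendsto_from_slack:
  fixes X :: "nat \<Rightarrow> 'a::real_normed_vector"
  assumes le: "\<And>\<eta> n. \<eta> > 0 \<Longrightarrow> norm (X n - L) \<le> C \<eta> * d n + \<eta> * A" and d: "d \<longlonglongrightarrow> (0::real)" and A: "A \<ge> 0"
  shows "X \<longlonglongrightarrow> L"
proof (rule metric_LIMSEQ_I)
  fix e :: real assume e: "e > 0"
  \<comment> \<open>The summand 1 keeps the denominator positive when \<open>A = 0\<close>.\<close>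
  define \<eta> where "\<eta> = e / (2 * (A + 1))"
  have \<eta>: "\<eta> > 0" "\<eta> * A < e / 2"
  proof -
    show "\<eta> > 0" using e A by (simp add: \<eta>_def)
    then have "\<eta> * A < \<eta> * (A + 1)" by simp
    also have "\<dots> = e / 2" using A by (simp add: \<eta>_def field_simps)
    finally show "\<eta> * A < e / 2" .
  qed
  have "(\<lambda>n. C \<eta> * d n) \<longlonglongrightarrow> C \<eta> * 0" by (intro tendsto_intros d)
  then have "\<forall>\<^sub>F n in sequentially. C \<eta> * d n < e / 2" using e by (intro order_tendstoD) auto
  then obtain n0 where n0: "\<And>n. n \<ge> n0 \<Longrightarrow> C \<eta> * d n < e / 2" by (auto simp: eventually_sequentially)
  have "dist (X n) L < e" if "n \<ge> n0" for n
    using le[OF \<eta>(1), of n] n0[OF that] \<eta>(2) by (simp add: dist_norm)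
  then show "\<exists>n0. \<forall>n\<ge>n0. dist (X n) L < e" by blast
qed

text \<open>The hypotheses say that \<open>p\<close> and \<open>q\<close> differ by at most
  \<open>r\<close>; the squares then differ by at most \<open>2 * q * r + r\<^sup>2\<close>, and
  Young's inequality with weight \<open>\<eta>\<close> splits the mixed term.\<close>

lemma square_diff_bound:
  fixes p q r \<eta> :: real
  assumes "0 \<le> p" "0 \<le> q" "0 \<le> r" "p \<le> q + r" "q \<le> p + r" "\<eta> > 0"
  shows "\<bar>p\<^sup>2 - q\<^sup>2\<bar> \<le> (1 + 1 / \<eta>) * r\<^sup>2 + \<eta> * q\<^sup>2"
proof -
  have "0 \<le> (sqrt \<eta> * q - r / sqrt \<eta>)\<^sup>2" by simp
  also have "\<dots> = \<eta> * q\<^sup>2 - 2 * q * r + r\<^sup>2 / \<eta>"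
    using assms(6) by (simp add: power2_diff power_mult_distrib power_divide)
  finally have yo: "2 * q * r \<le> \<eta> * q\<^sup>2 + r\<^sup>2 / \<eta>" by simp
  have "\<bar>p\<^sup>2 - q\<^sup>2\<bar> \<le> 2 * q * r + r\<^sup>2"
  proof (rule abs_leI)
    have "p\<^sup>2 \<le> (q + r)\<^sup>2" using assms by (intro power_mono) auto
    then show "p\<^sup>2 - q\<^sup>2 \<le> 2 * q * r + r\<^sup>2" by (simp add: power2_sum)
    show "- (p\<^sup>2 - q\<^sup>2) \<le> 2 * q * r + r\<^sup>2"
    proof (cases "q \<le> r")
      case True
      then have "q\<^sup>2 \<le> r\<^sup>2" using assms by (intro power_mono) auto
      moreover have "0 \<le> q * r" using assms by simp
      ultimately show ?thesis using zero_le_power2[of p] by linarith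
    next
      case False
      then have "(q - r)\<^sup>2 \<le> p\<^sup>2" using assms by (intro power_mono) auto
      then have "q\<^sup>2 - 2 * q * r + r\<^sup>2 \<le> p\<^sup>2" by (simp add: power2_diff)
      then show ?thesis using zero_le_power2[of r] by linarith
    qed
  qed
  then show ?thesis using yo by (simp add: algebra_simps)
qed

lemma L2_tendsto_norm_square:
  fixes f :: "'a \<Rightarrow> 'b::{real_normed_vector, second_countable_topology}"
  assumes F: "\<And>n. L2 M (F n)" and f: "L2 M f" and lim: "L2_tendsto M F f"
  shows "(\<lambda>n. \<integral>x. (norm (F n x))\<^sup>2 \<partial>M) \<longlonglongrightarrow> (\<integral>x. (norm (f x))\<^sup>2 \<partial>M)"
proof (rule tendsto_from_slack[where C="\<lambda>\<eta>. 1 + 1 / \<eta>" and d="\<lambda>n. \<integral>x. (norm (F n x - f x))\<^sup>2 \<partial>M"])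
  show "(\<lambda>n. \<integral>x. (norm (F n x - f x))\<^sup>2 \<partial>M) \<longlonglongrightarrow> 0" using lim L2_tendsto_iff[of M F f] F f by simp
  fix \<eta> :: real and n assume \<eta>: "\<eta> > 0"
  have i: "integrable M (\<lambda>x. (norm (F n x))\<^sup>2)" "integrable M (\<lambda>x. (norm (f x))\<^sup>2)"
      "integrable M (\<lambda>x. (norm (F n x - f x))\<^sup>2)"
    using F f L2_diff[OF F f] by (auto simp: L2_def)
  have "norm ((\<integral>x. (norm (F n x))\<^sup>2 \<partial>M) - (\<integral>x. (norm (f x))\<^sup>2 \<partial>M))
      = norm (\<integral>x. (norm (F n x))\<^sup>2 - (norm (f x))\<^sup>2 \<partial>M)" using i by simp
  also have "\<dots> \<le> (\<integral>x. (1 + 1 / \<eta>) * (norm (F n x - f x))\<^sup>2 + \<eta> * (norm (f x))\<^sup>2 \<partial>M)"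
  proof (rule integral_norm_bound_AE)
    show "AE x in M. norm ((norm (F n x))\<^sup>2 - (norm (f x))\<^sup>2) \<le> (1 + 1 / \<eta>) * (norm (F n x - f x))\<^sup>2 + \<eta> * (norm (f x))\<^sup>2"
      unfolding real_norm_def using \<eta>
      by (intro AE_I2 square_diff_bound norm_ge_zero norm_triangle_sub)
         (auto intro: norm_triangle_sub simp: norm_minus_commute[of "F n _"])
  qed (use i in auto)
  also have "\<dots> = (1 + 1 / \<eta>) * (\<integral>x. (norm (F n x - f x))\<^sup>2 \<partial>M) + \<eta> * (\<integral>x. (norm (f x))\<^sup>2 \<partial>M)"
    using i by simp
  finally show "norm ((\<integral>x. (norm (F n x))\<^sup>2 \<partial>M) - (\<integral>x. (norm (f x))\<^sup>2 \<partial>M))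
     \<le> (1 + 1 / \<eta>) * (\<integral>x. (norm (F n x - f x))\<^sup>2 \<partial>M) + \<eta> * (\<integral>x. (norm (f x))\<^sup>2 \<partial>M)" .
qed simp

lemma L2_tendsto_mult:
  fixes f w :: "'a \<Rightarrow> complex"
  assumes F: "\<And>n. L2 M (F n)" and f: "L2 M f" and lim: "L2_tendsto M F f" and w: "L2 M w"
  shows "(\<lambda>n. \<integral>x. w x * F n x \<partial>M) \<longlonglongrightarrow> (\<integral>x. w x * f x \<partial>M)"
proof (rule tendsto_from_slack[where C="\<lambda>\<eta>. 1 / \<eta>" and d="\<lambda>n. \<integral>x. (norm (F n x - f x))\<^sup>2 \<partial>M"])
  show "(\<lambda>n. \<integral>x. (norm (F n x - f x))\<^sup>2 \<partial>M) \<longlonglongrightarrow> 0" using lim L2_tendsto_iff[of M F f] F f by simp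
  fix \<eta> :: real and n assume \<eta>: "\<eta> > 0"
  have i: "integrable M (\<lambda>x. w x * F n x)" "integrable M (\<lambda>x. w x * f x)"
    by (intro L2_mult_integrable w F f)+
  have j: "integrable M (\<lambda>x. (norm (w x))\<^sup>2)" "integrable M (\<lambda>x. (norm (F n x - f x))\<^sup>2)"
    using w L2_diff[OF F f] by (auto simp: L2_def)
  have "norm ((\<integral>x. w x * F n x \<partial>M) - (\<integral>x. w x * f x \<partial>M)) = norm (\<integral>x. w x * F n x - w x * f x \<partial>M)" using i by simp
  also have "\<dots> \<le> (\<integral>x. 1 / \<eta> * (norm (F n x - f x))\<^sup>2 + \<eta> * (norm (w x))\<^sup>2 \<partial>M)"
  proof (rule integral_norm_bound_AE[OF AE_I2])
    fix x
    let ?q = "norm (w x)" and ?r = "norm (F n x - f x)"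
    have "0 \<le> (sqrt \<eta> * ?q - ?r / sqrt \<eta>)\<^sup>2" by simp
    also have "\<dots> = \<eta> * ?q\<^sup>2 - 2 * (?q * ?r) + ?r\<^sup>2 / \<eta>"
      using \<eta> by (simp add: power2_diff power_mult_distrib power_divide)
    finally have "2 * (?q * ?r) \<le> \<eta> * ?q\<^sup>2 + ?r\<^sup>2 / \<eta>" by simp
    moreover have "0 \<le> ?q * ?r" by (intro mult_nonneg_nonneg norm_ge_zero)
    moreover have "1 / \<eta> * ?r\<^sup>2 = ?r\<^sup>2 / \<eta>" by simp
    ultimately have "?q * ?r \<le> 1 / \<eta> * ?r\<^sup>2 + \<eta> * ?q\<^sup>2" by linarith
    then show "norm (w x * F n x - w x * f x) \<le> 1 / \<eta> * ?r\<^sup>2 + \<eta> * ?q\<^sup>2"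
      by (simp add: norm_mult flip: right_diff_distrib)
  qed (use i j in auto)
  also have "\<dots> = 1 / \<eta> * (\<integral>x. (norm (F n x - f x))\<^sup>2 \<partial>M) + \<eta> * (\<integral>x. (norm (w x))\<^sup>2 \<partial>M)"
    using j by simp
  finally show "norm ((\<integral>x. w x * F n x \<partial>M) - (\<integral>x. w x * f x \<partial>M))
     \<le> 1 / \<eta> * (\<integral>x. (norm (F n x - f x))\<^sup>2 \<partial>M) + \<eta> * (\<integral>x. (norm (w x))\<^sup>2 \<partial>M)" .
qed simp

text \<open>Transfers convergence of a function and its gradient to quantities depending on both, in
  particular to \<open>defect\<close>.\<close>

lemma L2_tendsto_dominated:
  fixes f :: "'a \<Rightarrow> 'b::{real_normed_vector, second_countable_topology}"
    and g :: "'a \<Rightarrow> 'c::{real_normed_vector, second_countable_topology}"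
    and h :: "'a \<Rightarrow> 'd::{real_normed_vector, second_countable_topology}"
  assumes F: "\<And>n. L2 M (F n)" "L2 M f" "L2_tendsto M F f"
    and G: "\<And>n. L2 M (G n)" "L2 M g" "L2_tendsto M G g"
    and H: "\<And>n. L2 M (H n)" "L2 M h"
    and le: "\<And>n x. x \<in> space M \<Longrightarrow> (norm (H n x - h x))\<^sup>2 \<le> B * (norm (F n x - f x))\<^sup>2 + B * (norm (G n x - g x))\<^sup>2"
  shows "L2_tendsto M H h"
  unfolding L2_tendsto_iff[OF H]
proof (rule tendsto_sandwich[OF _ _ tendsto_const[of 0]])
  show "\<forall>\<^sub>F n in sequentially. 0 \<le> (\<integral>x. (norm (H n x - h x))\<^sup>2 \<partial>M)" by simp
  have i: "integrable M (\<lambda>x. (norm (F n x - f x))\<^sup>2)" "integrable M (\<lambda>x. (norm (G n x - g x))\<^sup>2)"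
     "integrable M (\<lambda>x. (norm (H n x - h x))\<^sup>2)" for n
    using L2_diff[OF F(1,2)] L2_diff[OF G(1,2)] L2_diff[OF H] by (auto simp: L2_def)
  show "\<forall>\<^sub>F n in sequentially. (\<integral>x. (norm (H n x - h x))\<^sup>2 \<partial>M)
      \<le> B * (\<integral>x. (norm (F n x - f x))\<^sup>2 \<partial>M) + B * (\<integral>x. (norm (G n x - g x))\<^sup>2 \<partial>M)"
  proof (rule always_eventually, rule allI)
    fix n
    have "(\<integral>x. (norm (H n x - h x))\<^sup>2 \<partial>M) \<le> (\<integral>x. B * (norm (F n x - f x))\<^sup>2 + B * (norm (G n x - g x))\<^sup>2 \<partial>M)"
      using i by (intro integral_mono le) auto
    then show "(\<integral>x. (norm (H n x - h x))\<^sup>2 \<partial>M)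
      \<le> B * (\<integral>x. (norm (F n x - f x))\<^sup>2 \<partial>M) + B * (\<integral>x. (norm (G n x - g x))\<^sup>2 \<partial>M)" using i by simp
  qed
  have "(\<lambda>n. B * (\<integral>x. (norm (F n x - f x))\<^sup>2 \<partial>M) + B * (\<integral>x. (norm (G n x - g x))\<^sup>2 \<partial>M)) \<longlonglongrightarrow> B * 0 + B * 0"
    using F G by (intro tendsto_intros) (auto simp: L2_tendsto_iff)
  then show "(\<lambda>n. B * (\<integral>x. (norm (F n x - f x))\<^sup>2 \<partial>M) + B * (\<integral>x. (norm (G n x - g x))\<^sup>2 \<partial>M)) \<longlonglongrightarrow> 0" by simp
qed

lemma norm_sq_vec: "(norm (v :: 'a::real_normed_vector ^ 'n))\<^sup>2 = (\<Sum>i\<in>UNIV. (norm (v $ i))\<^sup>2)"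
  by (simp add: norm_vec_def L2_set_def sum_nonneg)

lemma norm_diff_scaled_sq:
  fixes a :: "complex^'n" and z :: complex and c :: "real^'n"
  shows "(norm (\<chi> i. a $ i - z * of_real (c $ i)))\<^sup>2
    = (norm a)\<^sup>2 - 2 * Re (cnj z * (\<Sum>i\<in>UNIV. of_real (c $ i) * a $ i)) + (norm z)\<^sup>2 * (norm c)\<^sup>2"
proof -
  have "(norm (x - z * of_real t))\<^sup>2 = (norm x)\<^sup>2 - 2 * Re (cnj z * (of_real t * x)) + (norm z)\<^sup>2 * (norm t)\<^sup>2" for x and t :: real
    unfolding cmod_power2 by (simp add: power2_eq_square algebra_simps)
  then have "(norm (\<chi> i. a $ i - z * of_real (c $ i)))\<^sup>2
    = (\<Sum>i\<in>UNIV. (norm (a $ i))\<^sup>2 - 2 * Re (cnj z * (of_real (c $ i) * a $ i)) + (norm z)\<^sup>2 * (norm (c $ i))\<^sup>2)"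
    by (simp add: norm_sq_vec)
  also have "\<dots> = (norm a)\<^sup>2 - 2 * (\<Sum>i\<in>UNIV. Re (cnj z * (of_real (c $ i) * a $ i))) + (norm z)\<^sup>2 * (norm c)\<^sup>2"
    by (simp only: norm_sq_vec sum.distrib sum_subtractf sum_distrib_left)
  also have "(\<Sum>i\<in>UNIV. Re (cnj z * (of_real (c $ i) * a $ i))) = Re (cnj z * (\<Sum>i\<in>UNIV. of_real (c $ i) * a $ i))"
    by (simp only: sum_distrib_left Re_sum)
  finally show ?thesis .
qed

lemma L2_component: "L2 M g \<Longrightarrow> L2 M (\<lambda>x. (g x :: complex^'n) $ i)"
proof -
  assume g: "L2 M g"
  then have [measurable]: "g \<in> borel_measurable M" and i: "integrable M (\<lambda>x. (norm (g x))\<^sup>2)" by (auto simp: L2_def)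
  have [measurable]: "(\<lambda>x. g x $ i) \<in> borel_measurable M"
    by (rule measurable_compose[OF _ borel_measurable_continuous_onI]) (auto intro: continuous_intros)
  have "integrable M (\<lambda>x. (norm (g x $ i))\<^sup>2)"
    by (rule Bochner_Integration.integrable_bound[OF i])
       (auto intro!: power_mono Finite_Cartesian_Product.norm_nth_le)
  then show ?thesis by (simp add: L2_def)
qed

lemma L2_tendsto_component:
  assumes "L2_tendsto M F (f :: _ \<Rightarrow> complex^'n)"
  shows "L2_tendsto M (\<lambda>n x. F n x $ i) (\<lambda>x. f x $ i)"
  unfolding L2_tendsto_def
proof (rule tendsto_sandwich[OF _ _ tendsto_const assms[unfolded L2_tendsto_def]])
  show "\<forall>\<^sub>F n in sequentially. (\<integral>\<^sup>+x. ennreal ((norm (F n x $ i - f x $ i))\<^sup>2) \<partial>M)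
      \<le> (\<integral>\<^sup>+x. ennreal ((norm (F n x - f x))\<^sup>2) \<partial>M)"
    by (intro always_eventually allI nn_integral_mono ennreal_leI power_mono)
       (auto simp flip: vector_minus_component intro: Finite_Cartesian_Product.norm_nth_le)
qed simp

lemma L2_tendsto_uniform:
  assumes fin: "emeasure M (space M) < \<infinity>"
    and le: "\<And>n x. x \<in> space M \<Longrightarrow> norm (F n x - f x) \<le> 1 / real (Suc n)"
  shows "L2_tendsto M F f"
  unfolding L2_tendsto_def
proof (rule tendsto_sandwich[OF _ _ tendsto_const])
  show "\<forall>\<^sub>F n in sequentially. (\<integral>\<^sup>+x. ennreal ((norm (F n x - f x))\<^sup>2) \<partial>M) \<le> ennreal ((1 / real (Suc n))\<^sup>2 * measure M (space M))"
  proof (intro always_eventually allI)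
    fix n
    have "(\<integral>\<^sup>+x. ennreal ((norm (F n x - f x))\<^sup>2) \<partial>M) \<le> (\<integral>\<^sup>+x. ennreal ((1 / real (Suc n))\<^sup>2) \<partial>M)"
      by (intro nn_integral_mono ennreal_leI power_mono le) auto
    also have "\<dots> = ennreal ((1 / real (Suc n))\<^sup>2) * emeasure M (space M)" by simp
    also have "\<dots> = ennreal ((1 / real (Suc n))\<^sup>2 * measure M (space M))"
      using fin by (simp add: emeasure_eq_ennreal_measure ennreal_mult')
    finally show "(\<integral>\<^sup>+x. ennreal ((norm (F n x - f x))\<^sup>2) \<partial>M) \<le> ennreal ((1 / real (Suc n))\<^sup>2 * measure M (space M))" .
  qed
  have "(\<lambda>n. (1 / real (Suc n))\<^sup>2 * measure M (space M)) \<longlonglongrightarrow> 0\<^sup>2 * measure M (space M)"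
    by (intro tendsto_intros LIMSEQ_Suc[OF lim_1_over_n])
  then show "(\<lambda>n. ennreal ((1 / real (Suc n))\<^sup>2 * measure M (space M))) \<longlonglongrightarrow> 0"
    by (simp flip: ennreal_0 add: tendsto_ennreal_iff del: of_nat_Suc)
qed simp

section \<open>Restriction of surface integrals to one boundary sphere\<close>

text \<open>Traces converge on the whole boundary, whereas the boundary terms live on single
  spheres; this identity links the two measures.\<close>

lemma surface_measure_mono:
  assumes "S \<subseteq> T" "S \<in> sets borel" "T \<in> sets borel"
  shows "surface_measure S = restrict_space (surface_measure T) S"
proof -
  have "T \<inter> S = S" using assms(1) by blast
  then show ?thesis
    unfolding surface_measure_def using assms(2,3)
    by (subst restrict_restrict_space) (simp_all add: sets_hausdorff_measure)
qed

lemma sets_surface_measure_sub: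
  assumes "S \<subseteq> T" "S \<in> sets borel"
  shows "S \<inter> space (surface_measure T) \<in> sets (surface_measure T)"
  using assms by (auto simp: sets_surface_measure sets_restrict_space Int_absorb2)

lemma L2_surface_mono:
  fixes f :: "real^'n \<Rightarrow> 'b::{real_normed_vector, second_countable_topology}"
  assumes ST: "S \<subseteq> T" "S \<in> sets borel" "T \<in> sets borel" and f: "L2 (surface_measure T) f"
  shows "L2 (surface_measure S) f"
proof -
  have "integrable (surface_measure T) (\<lambda>x. indicator S x *\<^sub>R (norm (f x))\<^sup>2)"
    using f sets_surface_measure_sub[OF ST(1,2)] ST
    by (intro integrable_mult_indicator) (auto simp: L2_def Int_absorb2)
  then have "integrable (surface_measure S) (\<lambda>x. (norm (f x))\<^sup>2)"
    unfolding surface_measure_mono[OF ST]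
    by (subst integrable_restrict_space[OF sets_surface_measure_sub[OF ST(1,2)]]) (simp add: set_integrable_def)
  moreover have "f \<in> borel_measurable (surface_measure S)"
    unfolding surface_measure_mono[OF ST] using f by (intro measurable_restrict_space1) (simp add: L2_def)
  ultimately show ?thesis by (simp add: L2_def)
qed

lemma L2_tendsto_surface_mono:
  fixes f :: "real^'n \<Rightarrow> 'b::{real_normed_vector, second_countable_topology}"
  assumes ST: "S \<subseteq> T" "S \<in> sets borel" "T \<in> sets borel" and f: "L2_tendsto (surface_measure T) F f"
  shows "L2_tendsto (surface_measure S) F f"
  unfolding L2_tendsto_def
proof (rule tendsto_sandwich[OF _ _ tendsto_const f[unfolded L2_tendsto_def]])
  show "\<forall>\<^sub>F n in sequentially. (\<integral>\<^sup>+x. ennreal ((norm (F n x - f x))\<^sup>2) \<partial>surface_measure S)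
      \<le> (\<integral>\<^sup>+x. ennreal ((norm (F n x - f x))\<^sup>2) \<partial>surface_measure T)"
    unfolding surface_measure_mono[OF ST]
    by (intro always_eventually allI, subst nn_integral_restrict_space[OF sets_surface_measure_sub[OF ST(1,2)]])
       (auto intro!: nn_integral_mono split: split_indicator)
qed simp


section \<open>Picone's identity\<close>

definition radial_deriv :: "(real^'n \<Rightarrow> complex) \<Rightarrow> real^'n \<Rightarrow> complex" where
  "radial_deriv F x = (\<Sum>i\<in>UNIV. of_real (x $ i / norm x) * grad F x $ i)"

lemma continuous_radial_deriv:
  "smooth F \<Longrightarrow> 0 \<notin> S \<Longrightarrow> continuous_on S (radial_deriv F)"
  unfolding radial_deriv_def
  by (intro continuous_intros smooth_continuous_grad) auto

lemma smooth_radial_derivative: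
  assumes F: "smooth F" and w: "norm \<omega> = 1" and r: "r > 0"
  shows "((\<lambda>r. F (r *\<^sub>R \<omega>)) has_vector_derivative radial_deriv F (r *\<^sub>R \<omega>)) (at r)"
proof -
  have "radial_deriv F (r *\<^sub>R \<omega>) = (\<Sum>i\<in>UNIV. \<omega> $ i *\<^sub>R grad F (r *\<^sub>R \<omega>) $ i)"
    using w r by (simp add: radial_deriv_def scaleR_conv_of_real[where 'a=complex])
  then show ?thesis using smooth_vector_derivative_line[OF F, of 0 \<omega> r UNIV] by simp
qed

text \<open>\<open>c1\<close> and \<open>c2\<close> are the factors with which surface integrals
  appear as boundary terms of the divergence theorem when the latter is derived from polar
  coordinates; classically both are 1.\<close>

locale annulus_problem =
  fixes R1 R2 :: real and dim :: "'n::finite itself" and m :: nat and c1 c2 :: real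
  assumes R1: "0 < R1" and R12: "R1 < R2" and dim: "CARD('n) \<ge> 2" and m: "m = CARD('n) - 1"
    and c1: "c1 = real CARD('n) * R1 ^ m * sphere_ratio (sphere (0::real^'n) R1)"
    and c2: "c2 = real CARD('n) * R2 ^ m * sphere_ratio (sphere (0::real^'n) R2)"
begin

abbreviation Om :: "(real^'n) set" where "Om \<equiv> ball 0 R2 - cball 0 R1"
abbreviation K :: "(real^'n) set" where "K \<equiv> cball 0 R2 - ball 0 R1"
abbreviation S1 :: "(real^'n) set" where "S1 \<equiv> sphere 0 R1"
abbreviation S2 :: "(real^'n) set" where "S2 \<equiv> sphere 0 R2"

lemma c1_pos: "c1 > 0"
  using sphere_ratio_pos[OF dim R1] R1 by (simp add: c1)

text \<open>With \<open>\<kappa> = 1 / c1\<close> the radial solution satisfies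
  \<open>c1 * dphi l R1 = - l * phi l R1\<close>, which is the boundary condition on the inner
  sphere as the divergence theorem sees it.\<close>

sublocale radial_ode R1 R2 "1 / c1" m
  using R1 R12 c1_pos by (intro radial_ode.intro) auto

lemma divergence:
  fixes f df :: "real^'n \<Rightarrow> 'b::euclidean_space" and \<beta> \<beta>' :: "real \<Rightarrow> real"
  assumes f: "continuous_on UNIV f" and df: "continuous_on K df"
    and deriv: "\<And>\<omega> r. norm \<omega> = 1 \<Longrightarrow> R1 \<le> r \<Longrightarrow> r \<le> R2 \<Longrightarrow>
      ((\<lambda>r. f (r *\<^sub>R \<omega>)) has_vector_derivative df (r *\<^sub>R \<omega>)) (at r)"
    and \<beta>: "\<And>r. r \<in> {R1..R2} \<Longrightarrow> (\<beta> has_real_derivative \<beta>' r) (at r within {R1..R2})"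
    and \<beta>': "continuous_on {R1..R2} \<beta>'"
  shows "(LINT x|lebesgue_on Om. \<beta> (norm x) *\<^sub>R df x + (\<beta>' (norm x) + real m / norm x * \<beta> (norm x)) *\<^sub>R f x)
    = (c2 * \<beta> R2) *\<^sub>R (LINT x|surface_measure S2. f x) - (c1 * \<beta> R1) *\<^sub>R (LINT x|surface_measure S1. f x)"
proof -
  have R2: "0 < R2" using R1 R12 by simp
  have "(LINT x|lebesgue_on Om. \<beta> (norm x) *\<^sub>R df x + (\<beta>' (norm x) + real m / norm x * \<beta> (norm x)) *\<^sub>R f x)
    = real CARD('n) *\<^sub>R ((R2 ^ m * \<beta> R2) *\<^sub>R (LINT \<omega>|cone_measure. f (R2 *\<^sub>R \<omega>))
        - (R1 ^ m * \<beta> R1) *\<^sub>R (LINT \<omega>|cone_measure. f (R1 *\<^sub>R \<omega>)))"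
    using radial_divergence[OF R1 R12 f df deriv \<beta> \<beta>'] by (simp add: m)
  then show ?thesis
    unfolding integral_cone_eq_surface[OF dim R1 f] integral_cone_eq_surface[OF dim R2 f]
    by (simp add: c1 c2 scaleR_diff_right ac_simps)
qed

lemma finite_surface: "finite_measure (surface_measure (S2 \<union> S1))"
proof
  have k: "m \<ge> 1" using dim by (simp add: m)
  have R2: "0 < R2" using R1 R12 by simp
  have fin: "hausdorff_outer m (sphere (0::real^'n) R) < \<infinity>" if "R > 0" for R
    using hausdorff_outer_sphere_finite[OF that, where 'a="real^'n"] dim by (simp add: m)
  have "emeasure (surface_measure (S2 \<union> S1)) (S2 \<union> S1) = hausdorff_outer m (S2 \<union> S1)"
    unfolding m using dim by (intro emeasure_surface_measure) auto
  also have "\<dots> \<le> hausdorff_outer m S2 + hausdorff_outer m S1" by (rule hausdorff_outer_Un[OF k])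
  also have "\<dots> < \<infinity>" using fin[OF R1] fin[OF R2] by simp
  finally show "emeasure (surface_measure (S2 \<union> S1)) (space (surface_measure (S2 \<union> S1))) \<noteq> \<infinity>" by simp
qed

lemma L2_surface:
  fixes f :: "real^'n \<Rightarrow> 'b::{banach, second_countable_topology}"
  assumes f: "continuous_on (S2 \<union> S1) f"
  shows "L2 (surface_measure (S2 \<union> S1)) f"
proof -
  interpret finite_measure "surface_measure (S2 \<union> S1)" by (rule finite_surface)
  have meas: "f \<in> borel_measurable (surface_measure (S2 \<union> S1))"
    using borel_measurable_continuous_on_restrict[OF f] by (simp add: measurable_cong_sets[OF sets_surface_measure refl])
  have "compact (f ` (S2 \<union> S1))" by (intro compact_continuous_image f compact_Un) auto
  from compact_imp_bounded[OF this] obtain B where B: "\<And>x. x \<in> S2 \<union> S1 \<Longrightarrow> norm (f x) \<le> B"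
    unfolding bounded_iff by blast
  have "integrable (surface_measure (S2 \<union> S1)) (\<lambda>x. (norm (f x))\<^sup>2)"
    using meas by (intro integrable_const_bound[where B="B\<^sup>2"]) (auto intro!: AE_I2 power_mono B)
  then show ?thesis using meas by (simp add: L2_def)
qed

lemma L2_annulus:
  fixes f :: "real^'n \<Rightarrow> 'b::{banach, second_countable_topology}"
  assumes f: "continuous_on K f"
  shows "L2 (lebesgue_on Om) f"
proof -
  have "continuous_on K (\<lambda>x. (norm (f x))\<^sup>2)" by (intro continuous_intros f)
  from integrable_annulus[OF this] borel_measurable_integrable[OF integrable_annulus[OF f]]
  show ?thesis by (simp add: L2_def)
qed

lemma K_nonzero: "x \<in> K \<Longrightarrow> x \<noteq> 0" using R1 by auto

lemma Om_sub_K: "Om \<subseteq> K" by auto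

definition bfield :: "(real \<Rightarrow> real) \<Rightarrow> real^'n \<Rightarrow> real^'n" where
  "bfield \<beta> x = (\<beta> (norm x) / norm x) *\<^sub>R x"

definition defect :: "(real \<Rightarrow> real) \<Rightarrow> (real^'n \<Rightarrow> complex) \<Rightarrow> (real^'n \<Rightarrow> complex^'n) \<Rightarrow> real^'n \<Rightarrow> complex^'n" where
  "defect \<beta> u g x = (\<chi> i. g x $ i - u x * of_real (bfield \<beta> x $ i))"

lemma norm_image_K: "norm ` K \<subseteq> {R1..R2}" by (auto simp: dist_norm)

lemma continuous_on_K_norm: "continuous_on {R1..R2} \<beta> \<Longrightarrow> continuous_on K (\<lambda>x. \<beta> (norm x))"
  by (rule continuous_on_compose2[OF _ _ norm_image_K]) (auto intro: continuous_intros)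

lemma continuous_bfield:
  assumes "continuous_on {R1..R2} \<beta>"
  shows "continuous_on K (bfield \<beta>)"
  unfolding bfield_def
  by (intro continuous_on_scaleR continuous_on_divide continuous_on_K_norm assms continuous_intros)
     (use R1 in auto)

lemma beta_continuous:
  assumes "\<And>r. r \<in> {R1..R2} \<Longrightarrow> (\<beta> has_real_derivative \<beta>' r) (at r within {R1..R2})"
  shows "continuous_on {R1..R2} \<beta>"
  by (rule DERIV_continuous_on[where D=\<beta>']) (use assms in auto)

text \<open>Expanding the square gives a cross term \<open>2 Re (cnj F (b \<bullet> grad F)) = b \<bullet> grad |F|\<^sup>2\<close> for the field
  \<open>b = \<beta>(|x|) x / |x|\<close>; integrating it by parts, the Riccati equation says \<open>div b + |b|\<^sup>2 = -l\<close>.\<close>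

lemma picone_smooth:
  fixes \<beta> :: "real \<Rightarrow> real"
  assumes F: "smooth F"
    and \<beta>: "\<And>r. r \<in> {R1..R2} \<Longrightarrow> (\<beta> has_real_derivative - l - real m / r * \<beta> r - (\<beta> r)\<^sup>2) (at r within {R1..R2})"
    and \<beta>R1: "\<beta> R1 = - l * (1 / c1)"
  shows "(LINT x|lebesgue_on Om. (norm (defect \<beta> F (grad F) x))\<^sup>2)
    = (LINT x|lebesgue_on Om. (norm (grad F x))\<^sup>2) - l * (LINT x|lebesgue_on Om. (norm (F x))\<^sup>2)
      - l * (LINT x|surface_measure S1. (norm (F x))\<^sup>2) - c2 * \<beta> R2 * (LINT x|surface_measure S2. (norm (F x))\<^sup>2)"
proof -
  let ?\<beta>' = "\<lambda>r. - l - real m / r * \<beta> r - (\<beta> r)\<^sup>2"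
  let ?df = "\<lambda>x. 2 * Re (cnj (F x) * radial_deriv F x)"
  let ?f = "\<lambda>x. (norm (F x))\<^sup>2"
  have \<beta>c: "continuous_on {R1..R2} \<beta>" by (rule beta_continuous[OF \<beta>])
  have \<beta>'c: "continuous_on {R1..R2} ?\<beta>'" using R1 by (intro continuous_intros \<beta>c) auto
  have K0: "0 \<notin> K" using R1 by auto
  have Fc: "continuous_on S F" for S by (rule smooth_continuous[OF F])
  have dfc: "continuous_on K ?df"
    by (intro continuous_intros Fc continuous_radial_deriv[OF F K0])
  have deriv: "((\<lambda>r. ?f (r *\<^sub>R \<omega>)) has_vector_derivative ?df (r *\<^sub>R \<omega>)) (at r)"
    if w: "norm \<omega> = 1" and r: "R1 \<le> r" for \<omega> r
  proof -
    have eq: "?f x = Re (cnj (F x) * F x)" for x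
      unfolding cmod_power2 by (simp add: power2_eq_square)
    have d: "((\<lambda>r. F (r *\<^sub>R \<omega>)) has_vector_derivative radial_deriv F (r *\<^sub>R \<omega>)) (at r)"
      using r R1 by (intro smooth_radial_derivative[OF F w]) simp
    have "((\<lambda>r. Re (cnj (F (r *\<^sub>R \<omega>)) * F (r *\<^sub>R \<omega>))) has_vector_derivative
        Re (cnj (F (r *\<^sub>R \<omega>)) * radial_deriv F (r *\<^sub>R \<omega>) + cnj (radial_deriv F (r *\<^sub>R \<omega>)) * F (r *\<^sub>R \<omega>))) (at r)"
      by (intro bounded_linear.has_vector_derivative[OF bounded_linear_Re] has_vector_derivative_mult has_vector_derivative_cnj d)
    also have "Re (cnj (F (r *\<^sub>R \<omega>)) * radial_deriv F (r *\<^sub>R \<omega>) + cnj (radial_deriv F (r *\<^sub>R \<omega>)) * F (r *\<^sub>R \<omega>)) = ?df (r *\<^sub>R \<omega>)"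
      by simp
    finally show ?thesis unfolding eq .
  qed
  have div: "(LINT x|lebesgue_on Om. \<beta> (norm x) *\<^sub>R ?df x + (?\<beta>' (norm x) + real m / norm x * \<beta> (norm x)) *\<^sub>R ?f x)
    = (c2 * \<beta> R2) *\<^sub>R (LINT x|surface_measure S2. ?f x) - (c1 * \<beta> R1) *\<^sub>R (LINT x|surface_measure S1. ?f x)"
    by (rule divergence[OF _ dfc deriv \<beta> \<beta>'c]) (auto intro!: continuous_intros Fc)
  \<comment> \<open>By the Riccati equation \<open>\<beta>' + m / r * \<beta>\<close> equals
    \<open>- l - \<beta>\<^sup>2\<close>: on the right the multiples of \<open>l\<close> cancel and
    \<open>\<beta>\<^sup>2\<close> times \<open>|F|\<^sup>2\<close> remains, the last term of the
    expanded square.\<close>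
  have Q: "(norm (defect \<beta> F (grad F) x))\<^sup>2 = (norm (grad F x))\<^sup>2 - l * ?f x
      - (\<beta> (norm x) *\<^sub>R ?df x + (?\<beta>' (norm x) + real m / norm x * \<beta> (norm x)) *\<^sub>R ?f x)" if x: "x \<noteq> 0" for x
  proof -
    have 1: "(norm (bfield \<beta> x))\<^sup>2 = (\<beta> (norm x))\<^sup>2" using x by (simp add: bfield_def)
    have 2: "(\<Sum>i\<in>UNIV. of_real (bfield \<beta> x $ i) * grad F x $ i) = of_real (\<beta> (norm x)) * radial_deriv F x"
      by (simp add: bfield_def radial_deriv_def sum_distrib_left ac_simps)
    have 3: "Re (cnj (F x) * (of_real (\<beta> (norm x)) * radial_deriv F x)) = \<beta> (norm x) * Re (cnj (F x) * radial_deriv F x)"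
      by (simp add: algebra_simps)
    show ?thesis unfolding defect_def norm_diff_scaled_sq 1 2 3 by (simp add: algebra_simps)
  qed
  note \<beta>K = continuous_on_K_norm[OF \<beta>c] continuous_on_K_norm[OF \<beta>'c]
  have i1: "integrable (lebesgue_on Om) (\<lambda>x. (norm (grad F x))\<^sup>2)"
    by (intro integrable_annulus continuous_intros smooth_continuous_grad F)
  have i2: "integrable (lebesgue_on Om) ?f"
    by (intro integrable_annulus continuous_intros Fc)
  have i3: "integrable (lebesgue_on Om) (\<lambda>x. \<beta> (norm x) *\<^sub>R ?df x + (?\<beta>' (norm x) + real m / norm x * \<beta> (norm x)) *\<^sub>R ?f x)"
    using K0 by (intro integrable_annulus continuous_on_add continuous_on_scaleR \<beta>K dfc continuous_on_mult continuous_on_divide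
        continuous_intros Fc) auto
  have split: "integrable M a \<Longrightarrow> integrable M b \<Longrightarrow> integrable M c \<Longrightarrow>
      (LINT x|M. a x - l * b x - c x) = (LINT x|M. a x) - l * (LINT x|M. b x) - (LINT x|M. c x)"
    for M :: "(real^'n) measure" and a b c :: "real^'n \<Rightarrow> real" by simp
  have "(LINT x|lebesgue_on Om. (norm (defect \<beta> F (grad F) x))\<^sup>2)
    = (LINT x|lebesgue_on Om. (norm (grad F x))\<^sup>2 - l * ?f x
      - (\<beta> (norm x) *\<^sub>R ?df x + (?\<beta>' (norm x) + real m / norm x * \<beta> (norm x)) *\<^sub>R ?f x))"
    using R1 by (intro Bochner_Integration.integral_cong refl Q) auto
  also have "\<dots> = (LINT x|lebesgue_on Om. (norm (grad F x))\<^sup>2) - l * (LINT x|lebesgue_on Om. ?f x)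
      - (LINT x|lebesgue_on Om. \<beta> (norm x) *\<^sub>R ?df x + (?\<beta>' (norm x) + real m / norm x * \<beta> (norm x)) *\<^sub>R ?f x)"
    by (rule split[OF i1 i2 i3])
  \<comment> \<open>The prescribed value of \<open>\<beta> R1\<close> gives
    \<open>c1 * \<beta> R1 = - l\<close>, which turns the inner boundary term into the eigenvalue
    term on \<open>S1\<close>.\<close>
  also have "\<dots> = (LINT x|lebesgue_on Om. (norm (grad F x))\<^sup>2) - l * (LINT x|lebesgue_on Om. ?f x)
      - l * (LINT x|surface_measure S1. ?f x) - c2 * \<beta> R2 * (LINT x|surface_measure S2. ?f x)"
    unfolding div \<beta>R1 using c1_pos by simp
  finally show ?thesis .
qed

end

section \<open>Complex conjugation and the energy identity\<close>

lemma compact_bound: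
  fixes f :: "'a::topological_space \<Rightarrow> 'b::real_normed_vector"
  assumes "compact S" "continuous_on S f"
  obtains B where "\<And>x. x \<in> S \<Longrightarrow> norm (f x) \<le> B"
proof -
  from compact_imp_bounded[OF compact_continuous_image[OF assms(2,1)]]
  obtain B where "\<forall>y\<in>f ` S. norm y \<le> B" by (auto simp only: bounded_iff)
  then show thesis by (intro that[of B]) simp
qed

lemma borel_measurable_scaled_vec:
  fixes u :: "'a \<Rightarrow> complex" and b :: "'a \<Rightarrow> real^'n"
  assumes "u \<in> borel_measurable M" "b \<in> borel_measurable M"
  shows "(\<lambda>x. \<chi> i. u x * of_real (b x $ i)) \<in> borel_measurable M"
  by (rule borel_measurable_continuous_Pair[OF assms]) (intro continuous_intros)

lemma norm_scaled_vec: "norm (\<chi> i. z * complex_of_real (c $ i)) = norm z * norm (c :: real^'n)"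
proof -
  have "(norm (\<chi> i. z * complex_of_real (c $ i)))\<^sup>2 = (norm z * norm c)\<^sup>2"
    by (simp add: norm_sq_vec norm_mult power_mult_distrib sum_distrib_left)
  then show ?thesis by (simp add: power2_eq_iff_nonneg)
qed

lemma vec_cnj_norm [simp]: "norm (vec_cnj a) = norm a"
  by (simp add: norm_vec_def vec_cnj_def)

lemma vec_cnj_diff: "vec_cnj a - vec_cnj b = vec_cnj (a - b)"
  by (simp add: vec_cnj_def vec_eq_iff)

lemma vec_cnj_cnj [simp]: "vec_cnj (vec_cnj a) = a"
  by (simp add: vec_cnj_def vec_eq_iff)

lemma herm_self: "herm a a = of_real ((norm a)\<^sup>2)"
  by (simp add: herm_def norm_sq_vec complex_norm_square[symmetric])

lemma continuous_on_vec_cnj: "continuous_on S vec_cnj"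
  unfolding vec_cnj_def by (intro continuous_intros)

lemma pderivative_cnj:
  assumes "smooth f"
  shows "pderivative i (\<lambda>x. cnj (f x)) x = cnj (pderivative i f x)"
proof -
  have "(f has_derivative frechet_derivative f (at x)) (at x)"
    using assms has_derivative_frechet[of 0] unfolding smooth_def by blast
  from pderivative_eq[OF has_derivative_cnj[OF this]] show ?thesis by (simp add: pderivative_def)
qed

lemma grad_cnj: "smooth f \<Longrightarrow> grad (\<lambda>x. cnj (f x)) x = vec_cnj (grad f x)"
  by (simp add: grad_def vec_cnj_def pderivative_cnj)

lemma tangential_grad_cnj: "smooth f \<Longrightarrow> tangential_grad \<nu> (\<lambda>x. cnj (f x)) x = vec_cnj (tangential_grad \<nu> f x)"
  by (simp add: tangential_grad_def grad_cnj) (simp add: vec_cnj_def)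

lemma test_function_cnj: "test_function \<Omega> f \<Longrightarrow> test_function \<Omega> (\<lambda>x. cnj (f x))"
  by (simp add: test_function_def smooth_cnj)

lemma L2_cnj: "L2 M f \<Longrightarrow> L2 M (\<lambda>x. cnj (f x))"
  using measurable_compose[OF _ borel_measurable_continuous_onI[OF continuous_on_cnj[OF continuous_on_id]]]
  by (auto simp: L2_def)

lemma L2_vec_cnj: "L2 M g \<Longrightarrow> L2 M (\<lambda>x. vec_cnj (g x))"
  using measurable_compose[OF _ borel_measurable_continuous_onI[OF continuous_on_vec_cnj]]
  by (auto simp: L2_def)

lemma L2_tendsto_cnj: "L2_tendsto M F f \<Longrightarrow> L2_tendsto M (\<lambda>n x. cnj (F n x)) (\<lambda>x. cnj (f x))"
  by (simp add: L2_tendsto_def flip: complex_cnj_diff)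

lemma L2_tendsto_vec_cnj: "L2_tendsto M F f \<Longrightarrow> L2_tendsto M (\<lambda>n x. vec_cnj (F n x)) (\<lambda>x. vec_cnj (f x))"
  by (simp add: L2_tendsto_def vec_cnj_diff)

text \<open>Makes the conjugate of a weak solution an admissible test function. Approximating
  sequences are conjugated termwise; the weak gradient is treated by conjugating the test
  function.\<close>

lemma in_H1_cnj:
  assumes "in_H1 \<Omega> A B \<nu> u g v G"
  shows "in_H1 \<Omega> A B \<nu> (\<lambda>x. cnj (u x)) (\<lambda>x. vec_cnj (g x)) (\<lambda>x. cnj (v x)) (\<lambda>x. vec_cnj (G x))"
proof -
  have wg: "weak_grad \<Omega> (\<lambda>x. cnj (u x)) (\<lambda>x. vec_cnj (g x))" if w: "weak_grad \<Omega> u g"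
    unfolding weak_grad_def
  proof (intro allI impI)
    fix f i assume f: "test_function \<Omega> f"
    then have sf: "smooth f" by (simp add: test_function_def)
    have "(LINT x|lebesgue_on \<Omega>. u x * pderivative i (\<lambda>x. cnj (f x)) x) = - (LINT x|lebesgue_on \<Omega>. g x $ i * cnj (f x))"
      using w test_function_cnj[OF f] by (simp add: weak_grad_def)
    then have eq: "cnj (LINT x|lebesgue_on \<Omega>. u x * cnj (pderivative i f x)) = - cnj (LINT x|lebesgue_on \<Omega>. g x $ i * cnj (f x))"
      by (simp add: pderivative_cnj[OF sf])
    have "(LINT x|lebesgue_on \<Omega>. cnj (u x) * pderivative i f x) = (LINT x|lebesgue_on \<Omega>. cnj (u x * cnj (pderivative i f x)))"
      by simp
    also have "\<dots> = - cnj (LINT x|lebesgue_on \<Omega>. g x $ i * cnj (f x))" by (simp only: Bochner_Integration.integral_cnj eq)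
    also have "\<dots> = - (LINT x|lebesgue_on \<Omega>. cnj (g x $ i * cnj (f x)))" by (simp only: Bochner_Integration.integral_cnj)
    finally show "(LINT x|lebesgue_on \<Omega>. cnj (u x) * pderivative i f x) = - (LINT x|lebesgue_on \<Omega>. vec_cnj (g x) $ i * f x)"
      by (simp add: vec_cnj_def)
  qed
  have tr: "has_trace \<Omega> \<Gamma> (\<lambda>x. cnj (u x)) (\<lambda>x. vec_cnj (g x)) (\<lambda>x. cnj (v x))" if h: "has_trace \<Omega> \<Gamma> u g v" for \<Gamma>
  proof -
    obtain F where F: "\<And>n. smooth (F n)" "L2_tendsto (lebesgue_on \<Omega>) F u"
        "L2_tendsto (lebesgue_on \<Omega>) (\<lambda>n. grad (F n)) g" "L2_tendsto (surface_measure \<Gamma>) F v"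
      using h unfolding has_trace_def by blast
    have eq: "(\<lambda>n. grad (\<lambda>x. cnj (F n x))) = (\<lambda>n x. vec_cnj (grad (F n) x))"
      using grad_cnj[OF F(1)] by (auto simp: fun_eq_iff)
    have "\<forall>n. smooth (\<lambda>x. cnj (F n x))" using F(1) smooth_cnj by blast
    moreover note L2_tendsto_cnj[OF F(2)] L2_tendsto_vec_cnj[OF F(3), folded eq] L2_tendsto_cnj[OF F(4)]
    moreover have "L2 (surface_measure \<Gamma>) (\<lambda>x. cnj (v x))" using h L2_cnj unfolding has_trace_def by blast
    ultimately show ?thesis unfolding has_trace_def by (intro conjI exI[of _ "\<lambda>n x. cnj (F n x)"]) simp_all
  qed
  have su: "H1_surf \<Gamma> \<nu> (\<lambda>x. cnj (v x)) (\<lambda>x. vec_cnj (G x))" if h: "H1_surf \<Gamma> \<nu> v G" for \<Gamma>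
  proof -
    obtain F where F: "\<And>n. smooth (F n)" "L2_tendsto (surface_measure \<Gamma>) F v"
        "L2_tendsto (surface_measure \<Gamma>) (\<lambda>n. tangential_grad \<nu> (F n)) G"
      using h unfolding H1_surf_def by blast
    have eq: "(\<lambda>n. tangential_grad \<nu> (\<lambda>x. cnj (F n x))) = (\<lambda>n x. vec_cnj (tangential_grad \<nu> (F n) x))"
      using tangential_grad_cnj[OF F(1)] by (auto simp: fun_eq_iff)
    have "\<forall>n. smooth (\<lambda>x. cnj (F n x))" using F(1) smooth_cnj by blast
    moreover note L2_tendsto_cnj[OF F(2)] L2_tendsto_vec_cnj[OF F(3), folded eq]
    moreover have "L2 (surface_measure \<Gamma>) (\<lambda>x. cnj (v x))" "L2 (surface_measure \<Gamma>) (\<lambda>x. vec_cnj (G x))"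
      using h L2_cnj L2_vec_cnj unfolding H1_surf_def by blast+
    ultimately show ?thesis unfolding H1_surf_def by (intro conjI exI[of _ "\<lambda>n x. cnj (F n x)"]) simp_all
  qed
  show ?thesis using assms wg tr su L2_cnj L2_vec_cnj unfolding in_H1_def H1_dom_def by auto
qed

text \<open>Testing a weak solution with its own conjugate.\<close>

lemma weak_solution_energy:
  assumes "weak_solution \<Omega> A B \<nu> (of_real \<mu>) u v"
  obtains g G where "in_H1 \<Omega> A B \<nu> u g v G"
    "(LINT x|lebesgue_on \<Omega>. (norm (g x))\<^sup>2) + (LINT x|surface_measure B. (norm (G x))\<^sup>2)
      = \<mu> * ((LINT x|lebesgue_on \<Omega>. (norm (u x))\<^sup>2) + (LINT x|surface_measure B. (norm (v x))\<^sup>2))"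
proof -
  obtain g G where H: "in_H1 \<Omega> A B \<nu> u g v G"
    and w: "\<And>\<phi> h \<psi> H. in_H1 \<Omega> A B \<nu> \<phi> h \<psi> H \<Longrightarrow>
          (LINT x|lebesgue_on \<Omega>. (\<Sum>i\<in>UNIV. g x $ i * h x $ i))
            + (LINT x|surface_measure B. herm (G x) (vec_cnj (H x)))
          = of_real \<mu> * ((LINT x|lebesgue_on \<Omega>. u x * \<phi> x) + (LINT x|surface_measure B. v x * \<psi> x))"
    using assms unfolding weak_solution_def by blast
  have z: "z * cnj z = of_real ((norm z)\<^sup>2)" for z by (rule complex_norm_square[symmetric])
  have s: "(\<Sum>i\<in>UNIV. g x $ i * vec_cnj (g x) $ i) = of_real ((norm (g x))\<^sup>2)" for x
    by (simp add: vec_cnj_def norm_sq_vec z)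
  \<comment> \<open>In the surface term the conjugation in the weak formulation cancels against that
    of the test function, leaving \<open>herm (G x) (G x)\<close>.\<close>
  have "complex_of_real ((LINT x|lebesgue_on \<Omega>. (norm (g x))\<^sup>2) + (LINT x|surface_measure B. (norm (G x))\<^sup>2))
      = of_real (\<mu> * ((LINT x|lebesgue_on \<Omega>. (norm (u x))\<^sup>2) + (LINT x|surface_measure B. (norm (v x))\<^sup>2)))"
    using w[OF in_H1_cnj[OF H]]
    unfolding s z vec_cnj_cnj herm_self integral_complex_of_real by simp
  then have "(LINT x|lebesgue_on \<Omega>. (norm (g x))\<^sup>2) + (LINT x|surface_measure B. (norm (G x))\<^sup>2)
      = \<mu> * ((LINT x|lebesgue_on \<Omega>. (norm (u x))\<^sup>2) + (LINT x|surface_measure B. (norm (v x))\<^sup>2))"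
    by (simp only: of_real_eq_iff)
  with H show thesis by (rule that)
qed

section \<open>Picone's identity in H1 and the vanishing of the defect\<close>

context annulus_problem
begin

lemma defect_diff:
  "defect \<beta> u g x - defect \<beta> u' g' x = (g x - g' x) - (\<chi> i. (u x - u' x) * of_real (bfield \<beta> x $ i))"
  by (simp add: defect_def vec_eq_iff algebra_simps)

text \<open>The defect is linear in the pair of function and gradient, so convergence of both in the
  mean carries over wherever the field is bounded.\<close>

lemma defect_diff_bound:
  assumes "norm (bfield \<beta> x) \<le> B"
  shows "(norm (defect \<beta> u g x - defect \<beta> u' g' x))\<^sup>2
    \<le> (2 + 2 * B\<^sup>2) * (norm (g x - g' x))\<^sup>2 + (2 + 2 * B\<^sup>2) * (norm (u x - u' x))\<^sup>2"
proof -
  have "(norm (defect \<beta> u g x - defect \<beta> u' g' x))\<^sup>2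
      \<le> 2 * (norm (g x - g' x))\<^sup>2 + 2 * (norm (u x - u' x) * norm (bfield \<beta> x))\<^sup>2"
    unfolding defect_diff using norm_diff_sq_le[of "g x - g' x"] by (simp only: norm_scaled_vec[symmetric])
  also have "\<dots> \<le> 2 * (norm (g x - g' x))\<^sup>2 + 2 * (norm (u x - u' x) * B)\<^sup>2"
    using assms by (intro add_left_mono mult_left_mono power_mono mult_left_mono[OF assms]) auto
  also have "\<dots> \<le> (2 + 2 * B\<^sup>2) * (norm (g x - g' x))\<^sup>2 + (2 + 2 * B\<^sup>2) * (norm (u x - u' x))\<^sup>2"
    by (simp add: power_mult_distrib algebra_simps)
  finally show ?thesis .
qed

lemma bfield_bounded:
  assumes "continuous_on {R1..R2} \<beta>"
  obtains B where "\<And>x. x \<in> K \<Longrightarrow> norm (bfield \<beta> x) \<le> B"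
proof (rule compact_bound[OF _ continuous_bfield[OF assms]])
  show "compact K" by (intro compact_diff) auto
qed (rule that)

lemma L2_defect:
  assumes \<beta>: "continuous_on {R1..R2} \<beta>" and u: "L2 (lebesgue_on Om) u" and g: "L2 (lebesgue_on Om) g"
  shows "L2 (lebesgue_on Om) (defect \<beta> u g)"
proof -
  obtain B where B: "\<And>x. x \<in> K \<Longrightarrow> norm (bfield \<beta> x) \<le> B" using bfield_bounded[OF \<beta>] by blast
  have bm: "bfield \<beta> \<in> borel_measurable (lebesgue_on Om)"
    using L2_annulus[OF continuous_bfield[OF \<beta>]] by (simp add: L2_def)
  have [measurable]: "(\<lambda>x. \<chi> i. u x * of_real (bfield \<beta> x $ i)) \<in> borel_measurable (lebesgue_on Om)"
    by (rule borel_measurable_scaled_vec[OF _ bm]) (use u in \<open>simp add: L2_def\<close>)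
  have "integrable (lebesgue_on Om) (\<lambda>x. B\<^sup>2 * (norm (u x))\<^sup>2)" using u by (simp add: L2_def)
  then have "integrable (lebesgue_on Om) (\<lambda>x. (norm (\<chi> i. u x * of_real (bfield \<beta> x $ i)))\<^sup>2)"
  proof (rule Bochner_Integration.integrable_bound)
    show "AE x in lebesgue_on Om. norm ((norm (\<chi> i. u x * of_real (bfield \<beta> x $ i)))\<^sup>2) \<le> norm (B\<^sup>2 * (norm (u x))\<^sup>2)"
    proof (rule AE_I2)
      fix x assume "x \<in> space (lebesgue_on Om)"
      then have "norm (bfield \<beta> x) \<le> B" using B Om_sub_K by auto
      then have "(norm (bfield \<beta> x))\<^sup>2 \<le> B\<^sup>2" by (intro power_mono) auto
      then show "norm ((norm (\<chi> i. u x * of_real (bfield \<beta> x $ i)))\<^sup>2) \<le> norm (B\<^sup>2 * (norm (u x))\<^sup>2)"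
        using mult_left_mono[of _ _ "(norm (u x))\<^sup>2"] by (simp add: norm_scaled_vec power_mult_distrib mult.commute[of "B\<^sup>2"])
    qed
  qed measurable
  then have "L2 (lebesgue_on Om) (\<lambda>x. \<chi> i. u x * of_real (bfield \<beta> x $ i))" by (simp add: L2_def)
  from L2_diff[OF g this] show ?thesis
    by (simp add: defect_def[abs_def] minus_vec_def)
qed

text \<open>All terms of the smooth identity are squared norms, continuous along the sequence from
  \<open>has_trace\<close>. The term on \<open>S2\<close> disappears in the limit because the trace
  vanishes there; for smooth approximants it need not be zero.\<close>

lemma picone_H1:
  assumes H: "in_H1 Om S2 S1 \<nu> u g v G"
    and \<beta>: "\<And>r. r \<in> {R1..R2} \<Longrightarrow> (\<beta> has_real_derivative - l - real m / r * \<beta> r - (\<beta> r)\<^sup>2) (at r within {R1..R2})"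
    and \<beta>R1: "\<beta> R1 = - l * (1 / c1)"
  shows "(LINT x|lebesgue_on Om. (norm (defect \<beta> u g x))\<^sup>2)
    = (LINT x|lebesgue_on Om. (norm (g x))\<^sup>2) - l * (LINT x|lebesgue_on Om. (norm (u x))\<^sup>2)
      - l * (LINT x|surface_measure S1. (norm (v x))\<^sup>2)"
proof -
  obtain F where F: "\<And>n. smooth (F n)" "L2_tendsto (lebesgue_on Om) F u"
      "L2_tendsto (lebesgue_on Om) (\<lambda>n. grad (F n)) g" "L2_tendsto (surface_measure (S2 \<union> S1)) F v"
    and u: "L2 (lebesgue_on Om) u" and g: "L2 (lebesgue_on Om) g" and v: "L2 (surface_measure (S2 \<union> S1)) v"
    and v0: "AE x in surface_measure S2. v x = 0"
    using H unfolding in_H1_def H1_dom_def has_trace_def by blast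
  have \<beta>c: "continuous_on {R1..R2} \<beta>" by (rule beta_continuous[OF \<beta>])
  obtain B where B: "\<And>x. x \<in> K \<Longrightarrow> norm (bfield \<beta> x) \<le> B" using bfield_bounded[OF \<beta>c] by blast
  have LF: "L2 (lebesgue_on Om) (F n)" "L2 (lebesgue_on Om) (grad (F n))" "L2 (surface_measure (S2 \<union> S1)) (F n)" for n
    by (intro L2_annulus L2_surface smooth_continuous smooth_continuous_grad F(1))+
  have sub: "S1 \<subseteq> S2 \<union> S1" "S2 \<subseteq> S2 \<union> S1" "S1 \<in> sets borel" "S2 \<in> sets borel" "S2 \<union> S1 \<in> sets borel" by auto
  note mono1 = L2_surface_mono[OF sub(1,3,5)] L2_tendsto_surface_mono[OF sub(1,3,5)]
  note mono2 = L2_surface_mono[OF sub(2,4,5)] L2_tendsto_surface_mono[OF sub(2,4,5)]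
  note LD = L2_defect[OF \<beta>c LF(1,2)] and Ld = L2_defect[OF \<beta>c u g]
  have "L2_tendsto (lebesgue_on Om) (\<lambda>n. defect \<beta> (F n) (grad (F n))) (defect \<beta> u g)"
  proof (rule L2_tendsto_dominated[OF LF(2) g F(3) LF(1) u F(2) LD Ld])
    fix n x assume "x \<in> space (lebesgue_on Om)"
    then have "x \<in> K" using Om_sub_K by auto
    then show "(norm (defect \<beta> (F n) (grad (F n)) x - defect \<beta> u g x))\<^sup>2
        \<le> (2 + 2 * B\<^sup>2) * (norm (grad (F n) x - g x))\<^sup>2 + (2 + 2 * B\<^sup>2) * (norm (F n x - u x))\<^sup>2"
      by (intro defect_diff_bound B)
  qed
  from L2_tendsto_norm_square[OF LD Ld this]
  have l1: "(\<lambda>n. LINT x|lebesgue_on Om. (norm (defect \<beta> (F n) (grad (F n)) x))\<^sup>2)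
      \<longlonglongrightarrow> (LINT x|lebesgue_on Om. (norm (defect \<beta> u g x))\<^sup>2)" .
  note l2 = L2_tendsto_norm_square[OF LF(2) g F(3)]
  note l3 = L2_tendsto_norm_square[OF LF(1) u F(2)]
  note l4 = L2_tendsto_norm_square[OF mono1(1)[OF LF(3)] mono1(1)[OF v] mono1(2)[OF F(4)]]
  note l5 = L2_tendsto_norm_square[OF mono2(1)[OF LF(3)] mono2(1)[OF v] mono2(2)[OF F(4)]]
  have "(LINT x|surface_measure S2. (norm (v x))\<^sup>2) = 0"
    by (rule integral_eq_zero_AE) (use v0 in \<open>auto elim: eventually_mono\<close>)
  note l5' = l5[unfolded this]
  have "(\<lambda>n. (LINT x|lebesgue_on Om. (norm (grad (F n) x))\<^sup>2) - l * (LINT x|lebesgue_on Om. (norm (F n x))\<^sup>2)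
      - l * (LINT x|surface_measure S1. (norm (F n x))\<^sup>2) - c2 * \<beta> R2 * (LINT x|surface_measure S2. (norm (F n x))\<^sup>2))
    \<longlonglongrightarrow> (LINT x|lebesgue_on Om. (norm (g x))\<^sup>2) - l * (LINT x|lebesgue_on Om. (norm (u x))\<^sup>2)
      - l * (LINT x|surface_measure S1. (norm (v x))\<^sup>2) - c2 * \<beta> R2 * 0"
    by (intro tendsto_intros l2 l3 l4 l5')
  moreover have "(LINT x|lebesgue_on Om. (norm (defect \<beta> (F n) (grad (F n)) x))\<^sup>2)
    = (LINT x|lebesgue_on Om. (norm (grad (F n) x))\<^sup>2) - l * (LINT x|lebesgue_on Om. (norm (F n x))\<^sup>2)
      - l * (LINT x|surface_measure S1. (norm (F n x))\<^sup>2) - c2 * \<beta> R2 * (LINT x|surface_measure S2. (norm (F n x))\<^sup>2)" for n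
    by (rule picone_smooth[OF F(1) \<beta> \<beta>R1])
  ultimately have "(\<lambda>n. LINT x|lebesgue_on Om. (norm (defect \<beta> (F n) (grad (F n)) x))\<^sup>2)
    \<longlonglongrightarrow> (LINT x|lebesgue_on Om. (norm (g x))\<^sup>2) - l * (LINT x|lebesgue_on Om. (norm (u x))\<^sup>2)
      - l * (LINT x|surface_measure S1. (norm (v x))\<^sup>2)"
    by (simp only: mult_zero_right diff_zero)
  from LIMSEQ_unique[OF l1 this] show ?thesis .
qed

definition beta :: "real \<Rightarrow> real \<Rightarrow> real" where
  "beta l r = dphi l r / phi l r"

lemma beta_riccati:
  assumes "0 \<le> l" "l < ground" "r \<in> {R1..R2}"
  shows "(beta l has_real_derivative - l - real m / r * beta l r - (beta l r)\<^sup>2) (at r within {R1..R2})"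
proof -
  have p: "phi l r > 0" by (rule phi_pos_below[OF assms])
  have "(beta l has_real_derivative ((- l * phi l r - real m / r * dphi l r) * phi l r - dphi l r * dphi l r) / (phi l r * phi l r))
      (at r within {R1..R2})"
    unfolding beta_def using p by (intro DERIV_divide deriv_phi deriv_dphi assms) simp
  also have "((- l * phi l r - real m / r * dphi l r) * phi l r - dphi l r * dphi l r) / (phi l r * phi l r)
      = - l - real m / r * beta l r - (beta l r)\<^sup>2"
    using p by (simp add: beta_def diff_divide_distrib power2_eq_square)
  finally show ?thesis .
qed

text \<open>\<open>beta ground\<close> blows up at \<open>R2\<close>, so Picone's identity is used for \<open>l < ground\<close>, with Fatou's
  lemma as \<open>l\<close> tends to \<open>ground\<close>.\<close>

lemma defect_zero:
  assumes w: "weak_solution Om S2 S1 \<nu> (of_real \<mu>) u v" and \<mu>: "\<mu> \<le> ground"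
  obtains g G where "in_H1 Om S2 S1 \<nu> u g v G"
    "AE x in lebesgue_on Om. defect (beta ground) u g x = 0"
proof -
  obtain g G where H: "in_H1 Om S2 S1 \<nu> u g v G"
    and en: "(LINT x|lebesgue_on Om. (norm (g x))\<^sup>2) + (LINT x|surface_measure S1. (norm (G x))\<^sup>2)
      = \<mu> * ((LINT x|lebesgue_on Om. (norm (u x))\<^sup>2) + (LINT x|surface_measure S1. (norm (v x))\<^sup>2))"
    using weak_solution_energy[OF w] by blast
  define X where "X = (LINT x|lebesgue_on Om. (norm (u x))\<^sup>2) + (LINT x|surface_measure S1. (norm (v x))\<^sup>2)"
  have X: "0 \<le> X" unfolding X_def by (intro add_nonneg_nonneg integral_nonneg_AE) auto
  have u: "L2 (lebesgue_on Om) u" and g: "L2 (lebesgue_on Om) g" using H by (auto simp: in_H1_def H1_dom_def)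
  \<comment> \<open>A sequence starting at 0, below \<open>ground\<close> throughout and tending to
    it; \<open>beta (l n)\<close> is thus finite and continuous up to \<open>R2\<close>.\<close>
  define l where "l n = ground - ground * (1 / real (Suc n))" for n
  have l: "0 \<le> l n" "l n < ground" for n
    using ground_pos by (auto simp: l_def field_simps)
  have lim_l: "l \<longlonglongrightarrow> ground"
  proof -
    have "l \<longlonglongrightarrow> ground - ground * 0"
      unfolding l_def by (intro tendsto_intros LIMSEQ_Suc[OF lim_1_over_n])
    then show ?thesis by simp
  qed
  have "l n \<noteq> ground" for n using l(2)[of n] by simp
  then have fl: "filterlim l (at ground) sequentially"
    using lim_l by (intro filterlim_atI always_eventually) auto
  let ?d = "\<lambda>n x. ennreal ((norm (defect (beta (l n)) u g x))\<^sup>2)"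
  have Ld: "L2 (lebesgue_on Om) (defect (beta (l n)) u g)" for n
    by (rule L2_defect[OF beta_continuous[OF beta_riccati[OF l]] u g])
  have le: "(\<integral>\<^sup>+x. ?d n x \<partial>lebesgue_on Om) \<le> ennreal ((ground - l n) * X)" for n
  proof -
    have bR1: "beta (l n) R1 = - l n * (1 / c1)" by (simp add: beta_def phi_R1 dphi_R1)
    have "(\<integral>\<^sup>+x. ?d n x \<partial>lebesgue_on Om) = ennreal (LINT x|lebesgue_on Om. (norm (defect (beta (l n)) u g x))\<^sup>2)"
      using Ld[of n] by (intro nn_integral_eq_integral) (auto simp: L2_def)
    also have "(LINT x|lebesgue_on Om. (norm (defect (beta (l n)) u g x))\<^sup>2)
       = (LINT x|lebesgue_on Om. (norm (g x))\<^sup>2) - l n * X"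
      using picone_H1[OF H beta_riccati[OF l] bR1] by (simp add: X_def distrib_left)
    \<comment> \<open>The energy identity bounds the integral of \<open>|g|\<^sup>2\<close> by
      \<open>\<mu> * X\<close>, the tangential energy being nonnegative, and \<open>\<mu>\<close> is
      at most \<open>ground\<close>.\<close>
    also have "\<dots> \<le> (ground - l n) * X"
    proof -
      have "0 \<le> (LINT x|surface_measure S1. (norm (G x))\<^sup>2)" by (intro integral_nonneg_AE) auto
      moreover have "\<mu> * X \<le> ground * X" using \<mu> X by (rule mult_right_mono)
      ultimately show ?thesis using en unfolding X_def[symmetric] left_diff_distrib by linarith
    qed
    finally show ?thesis by (simp add: ennreal_leI)
  qed
  have "(\<lambda>n. (ground - l n) * X) \<longlonglongrightarrow> (ground - ground) * X" by (intro tendsto_intros lim_l)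
  then have up: "(\<lambda>n. ennreal ((ground - l n) * X)) \<longlonglongrightarrow> 0"
    using l X by (simp flip: ennreal_0 add: tendsto_ennreal_iff less_imp_le)
  have "(\<lambda>n. \<integral>\<^sup>+x. ?d n x \<partial>lebesgue_on Om) \<longlonglongrightarrow> 0"
    by (rule tendsto_sandwich[OF _ always_eventually[OF allI[OF le]] tendsto_const up]) simp
  then have "liminf (\<lambda>n. \<integral>\<^sup>+x. ?d n x \<partial>lebesgue_on Om) = 0"
    using lim_imp_Liminf[OF sequentially_bot] by blast
  moreover have meas: "?d n \<in> borel_measurable (lebesgue_on Om)" for n
    using Ld[of n] by (auto simp: L2_def)
  ultimately have "(\<integral>\<^sup>+x. liminf (\<lambda>n. ?d n x) \<partial>lebesgue_on Om) = 0"
    using nn_integral_liminf[of ?d "lebesgue_on Om", OF meas] by simp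
  then have ae: "AE x in lebesgue_on Om. liminf (\<lambda>n. ?d n x) = 0"
    using meas by (subst (asm) nn_integral_0_iff_AE) auto
  \<comment> \<open>Inside the annulus \<open>phi ground\<close> is positive, so
    \<open>beta (l n)\<close> converges pointwise although the limit is unbounded near
    \<open>R2\<close>.\<close>
  have lim: "liminf (\<lambda>n. ?d n x) = ennreal ((norm (defect (beta ground) u g x))\<^sup>2)" if x: "x \<in> Om" for x
  proof -
    have r: "norm x \<in> {R1..R2}" "norm x < R2" using x by auto
    have p: "phi ground (norm x) \<noteq> 0" using phi_ground_pos[of "norm x"] r by auto
    have "(\<lambda>n. phi (l n) (norm x)) \<longlonglongrightarrow> phi ground (norm x)" "(\<lambda>n. dphi (l n) (norm x)) \<longlonglongrightarrow> dphi ground (norm x)"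
      by (rule filterlim_compose[OF tendsto_phi[OF r(1)] fl], rule filterlim_compose[OF tendsto_dphi[OF r(1)] fl])
    then have "(\<lambda>n. beta (l n) (norm x)) \<longlonglongrightarrow> beta ground (norm x)"
      unfolding beta_def by (intro tendsto_divide p)
    then have "(\<lambda>n. ?d n x) \<longlonglongrightarrow> ennreal ((norm (defect (beta ground) u g x))\<^sup>2)"
      unfolding defect_def bfield_def using K_nonzero[of x] Om_sub_K x by (intro tendsto_intros) auto
    then show ?thesis by (rule lim_imp_Liminf[OF sequentially_bot])
  qed
  have "AE x in lebesgue_on Om. defect (beta ground) u g x = 0"
    using ae AE_space[of "lebesgue_on Om"]
  proof eventually_elim
    case (elim x)
    then have "x \<in> Om" by simp
    then show ?case using lim[of x] elim(1) by simp
  qed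
  with H show thesis by (rule that)
qed

end


section \<open>The ground state\<close>

lemma emeasure_open_pos:
  fixes U :: "'a::euclidean_space set"
  assumes "open U" "U \<noteq> {}"
  shows "emeasure lborel U > 0"
proof -
  obtain x r where r: "r > 0" "ball x r \<subseteq> U" using assms open_contains_ball by blast
  have "0 < emeasure lborel (ball x r)" using r(1) by (simp add: emeasure_ball)
  also have "\<dots> \<le> emeasure lborel U" using r assms(1) by (intro emeasure_mono) auto
  finally show ?thesis .
qed

lemma L2_tendsto_mult_vec:
  fixes f w :: "'a \<Rightarrow> complex^'n"
  assumes F: "\<And>n. L2 M (F n)" and f: "L2 M f" and lim: "L2_tendsto M F f" and w: "L2 M w"
  shows "(\<lambda>n. \<integral>x. (\<Sum>i\<in>UNIV. w x $ i * F n x $ i) \<partial>M) \<longlonglongrightarrow> (\<integral>x. (\<Sum>i\<in>UNIV. w x $ i * f x $ i) \<partial>M)"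
proof -
  have "(\<lambda>n. \<Sum>i\<in>UNIV. \<integral>x. w x $ i * F n x $ i \<partial>M) \<longlonglongrightarrow> (\<Sum>i\<in>UNIV. \<integral>x. w x $ i * f x $ i \<partial>M)"
    by (intro tendsto_sum L2_tendsto_mult L2_component F f w L2_tendsto_component lim)
  moreover have "(\<integral>x. (\<Sum>i\<in>UNIV. w x $ i * k x $ i) \<partial>M) = (\<Sum>i\<in>UNIV. \<integral>x. w x $ i * k x $ i \<partial>M)"
    if "L2 M k" for k :: "'a \<Rightarrow> complex^'n"
    by (intro Bochner_Integration.integral_sum L2_mult_integrable L2_component w that)
  ultimately show ?thesis using F f by simp
qed

context annulus_problem
begin

definition u0 :: "real^'n \<Rightarrow> complex" where "u0 x = of_real (phi ground (norm x))"
definition g0 :: "real^'n \<Rightarrow> complex^'n" where "g0 x = cvec (bfield (dphi ground) x)"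

lemma continuous_phi_ground: "continuous_on {R1..R2} (phi ground)"
  by (rule beta_continuous[OF deriv_phi])

lemma continuous_dphi_ground: "continuous_on {R1..R2} (dphi ground)"
  by (rule beta_continuous[OF deriv_dphi])

lemma continuous_u0: "continuous_on K u0"
  unfolding u0_def by (intro continuous_on_of_real continuous_on_K_norm continuous_phi_ground)

lemma continuous_g0: "continuous_on K g0"
  unfolding g0_def by (intro continuous_on_cvec continuous_bfield continuous_dphi_ground)

lemma S_sub_K: "S2 \<union> S1 \<subseteq> K" using R12 by auto

lemma open_Om: "open Om" by (intro open_Diff) auto

lemma finite_Om: "emeasure (lebesgue_on Om) (space (lebesgue_on Om)) < \<infinity>"
proof -
  have "emeasure (lebesgue_on Om) (space (lebesgue_on Om)) = emeasure lborel Om"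
    by (simp add: emeasure_restrict_space)
  also have "\<dots> < \<infinity>" by (rule emeasure_bounded_finite) (auto intro: bounded_diff)
  finally show ?thesis .
qed

text \<open>The smooth radial polynomials from \<open>radial_approximation\<close> converge
  uniformly with their gradients on the closed annulus. One sequence therefore serves as witness for
  the trace and for the surface gradient, which is identically 0, and yields the weak gradient by
  passing to the limit.\<close>

lemma in_H1_u0: "in_H1 Om S2 S1 (annulus_normal R1) u0 g0 u0 (\<lambda>_. 0)"
proof -
  have "\<exists>F::real^'n \<Rightarrow> complex. smooth F \<and> (\<forall>x. x \<noteq> 0 \<longrightarrow> tangential_grad (annulus_normal R1) F x = 0) \<and>
     (\<forall>x. norm x \<in> {R1..R2} \<longrightarrow> norm (F x - of_real (phi ground (norm x))) \<le> 1 / real (Suc n) \<and>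
        norm (grad F x - cvec ((dphi ground (norm x) / norm x) *\<^sub>R x)) \<le> 1 / real (Suc n))" for n
    by (rule radial_approximation[OF R1 R12 _ deriv_phi continuous_dphi_ground]) auto
  then obtain F :: "nat \<Rightarrow> real^'n \<Rightarrow> complex" where F: "\<And>n. smooth (F n)"
      "\<And>n x. x \<noteq> 0 \<Longrightarrow> tangential_grad (annulus_normal R1) (F n) x = 0"
      "\<And>n x. norm x \<in> {R1..R2} \<Longrightarrow> norm (F n x - of_real (phi ground (norm x))) \<le> 1 / real (Suc n)"
      "\<And>n x. norm x \<in> {R1..R2} \<Longrightarrow> norm (grad (F n) x - cvec ((dphi ground (norm x) / norm x) *\<^sub>R x)) \<le> 1 / real (Suc n)"
    by metis
  have near: "norm (F n x - u0 x) \<le> 1 / real (Suc n)" "norm (grad (F n) x - g0 x) \<le> 1 / real (Suc n)" if "x \<in> K" for n x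
    using F(3,4)[of x n] norm_image_K that by (auto simp: u0_def g0_def bfield_def)
  interpret S: finite_measure "surface_measure (S2 \<union> S1)" by (rule finite_surface)
  have finS: "emeasure (surface_measure (S2 \<union> S1)) (space (surface_measure (S2 \<union> S1))) < \<infinity>"
    by (simp add: S.emeasure_eq_measure)
  have L: "L2 (lebesgue_on Om) u0" "L2 (lebesgue_on Om) g0"
    by (intro L2_annulus continuous_u0 continuous_g0)+
  have LS: "L2 (surface_measure (S2 \<union> S1)) u0"
    by (intro L2_surface continuous_on_subset[OF continuous_u0 S_sub_K])
  have LF: "L2 (lebesgue_on Om) (F n)" "L2 (lebesgue_on Om) (grad (F n))" for n
    by (intro L2_annulus smooth_continuous smooth_continuous_grad F(1))+
  have t1: "L2_tendsto (lebesgue_on Om) F u0"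
    by (rule L2_tendsto_uniform[OF finite_Om]) (use near Om_sub_K in auto)
  have t2: "L2_tendsto (lebesgue_on Om) (\<lambda>n. grad (F n)) g0"
    by (rule L2_tendsto_uniform[OF finite_Om]) (use near Om_sub_K in auto)
  have t3: "L2_tendsto (surface_measure (S2 \<union> S1)) F u0"
    by (rule L2_tendsto_uniform[OF finS], rule near(1)) (use S_sub_K in auto)
  have t4: "L2_tendsto (surface_measure (S2 \<union> S1)) (\<lambda>n. tangential_grad (annulus_normal R1) (F n)) (\<lambda>_. 0)"
  proof (rule L2_tendsto_uniform[OF finS])
    fix n and x :: "real^'n" assume "x \<in> space (surface_measure (S2 \<union> S1))"
    then have "x \<noteq> 0" using R1 R12 by auto
    then show "norm (tangential_grad (annulus_normal R1) (F n) x - 0) \<le> 1 / real (Suc n)"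
      using F(2)[of x n] by simp
  qed
  have "weak_grad Om u0 g0"
    unfolding weak_grad_def
  proof (intro allI impI)
    fix f i assume f: "test_function Om f"
    then have sf: "smooth f" by (simp add: test_function_def)
    have Lf: "L2 (lebesgue_on Om) f" "L2 (lebesgue_on Om) (pderivative i f)"
      by (intro L2_annulus smooth_continuous smooth_pderivative sf)+
    have "(\<lambda>n. LINT x|lebesgue_on Om. pderivative i f x * F n x) \<longlonglongrightarrow> (LINT x|lebesgue_on Om. pderivative i f x * u0 x)"
      by (rule L2_tendsto_mult[OF LF(1) L(1) t1 Lf(2)])
    moreover have "(\<lambda>n. - (LINT x|lebesgue_on Om. f x * grad (F n) x $ i)) \<longlonglongrightarrow> - (LINT x|lebesgue_on Om. f x * g0 x $ i)"
      by (intro tendsto_minus L2_tendsto_mult L2_component LF L Lf L2_tendsto_component t2)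
    moreover have "(LINT x|lebesgue_on Om. pderivative i f x * F n x) = - (LINT x|lebesgue_on Om. f x * grad (F n) x $ i)" for n
      using integration_by_parts_test_function[OF F(1)[of n] f open_Om, of i] by (simp add: grad_def mult.commute)
    ultimately have "(LINT x|lebesgue_on Om. pderivative i f x * u0 x) = - (LINT x|lebesgue_on Om. f x * g0 x $ i)"
      using LIMSEQ_unique by auto
    then show "(LINT x|lebesgue_on Om. u0 x * pderivative i f x) = - (LINT x|lebesgue_on Om. g0 x $ i * f x)"
      by (simp add: mult.commute)
  qed
  moreover have "AE x in surface_measure S2. u0 x = 0"
    by (rule AE_I2) (simp add: u0_def phi_ground_R2)
  ultimately show ?thesis
    unfolding in_H1_def H1_dom_def has_trace_def H1_surf_def
    using F(1) L LS t1 t2 t3 t4 by (auto simp: L2_def)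
qed

text \<open>The divergence theorem with the radial profile \<open>dphi ground\<close> itself instead
  of its logarithmic version \<open>beta\<close>; the radial equation turns its divergence into
  \<open>- ground * u0\<close>. The term on \<open>S2\<close> is kept because \<open>F\<close> need
  not vanish there.\<close>

lemma ground_identity_smooth:
  assumes F: "smooth F"
  shows "(LINT x|lebesgue_on Om. (\<Sum>i\<in>UNIV. g0 x $ i * grad F x $ i))
    = of_real ground * ((LINT x|lebesgue_on Om. u0 x * F x) + (LINT x|surface_measure S1. F x))
      + of_real (c2 * dphi ground R2) * (LINT x|surface_measure S2. F x)"
proof -
  let ?\<beta>' = "\<lambda>r. - ground * phi ground r - real m / r * dphi ground r"
  have K0: "0 \<notin> K" using R1 by auto
  have c': "continuous_on {R1..R2} ?\<beta>'"
    using R1 by (intro continuous_intros continuous_phi_ground continuous_dphi_ground) auto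
  have div: "(LINT x|lebesgue_on Om. dphi ground (norm x) *\<^sub>R radial_deriv F x
        + (?\<beta>' (norm x) + real m / norm x * dphi ground (norm x)) *\<^sub>R F x)
    = (c2 * dphi ground R2) *\<^sub>R (LINT x|surface_measure S2. F x) - (c1 * dphi ground R1) *\<^sub>R (LINT x|surface_measure S1. F x)"
    by (rule divergence[OF smooth_continuous[OF F] continuous_radial_deriv[OF F K0] smooth_radial_derivative[OF F] deriv_dphi c'])
       (use R1 in auto)
  have eq: "dphi ground (norm x) *\<^sub>R radial_deriv F x + (?\<beta>' (norm x) + real m / norm x * dphi ground (norm x)) *\<^sub>R F x
    = (\<Sum>i\<in>UNIV. g0 x $ i * grad F x $ i) - of_real ground * (u0 x * F x)" for x
    by (simp add: radial_deriv_def g0_def bfield_def u0_def scaleR_conv_of_real[where 'a=complex] sum_distrib_left ac_simps)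
  have i1: "integrable (lebesgue_on Om) (\<lambda>x. \<Sum>i\<in>UNIV. g0 x $ i * grad F x $ i)"
    by (intro integrable_annulus continuous_intros continuous_g0 smooth_continuous_grad F)
  have i2: "integrable (lebesgue_on Om) (\<lambda>x. u0 x * F x)"
    by (intro integrable_annulus continuous_intros continuous_u0 smooth_continuous F)
  have c1d: "c1 * dphi ground R1 = - ground" using c1_pos by (simp add: dphi_R1)
  have "(LINT x|lebesgue_on Om. (\<Sum>i\<in>UNIV. g0 x $ i * grad F x $ i)) - of_real ground * (LINT x|lebesgue_on Om. u0 x * F x)
    = (LINT x|lebesgue_on Om. (\<Sum>i\<in>UNIV. g0 x $ i * grad F x $ i) - of_real ground * (u0 x * F x))"
    using i1 i2 by simp
  also have "\<dots> = (c2 * dphi ground R2) *\<^sub>R (LINT x|surface_measure S2. F x) - (c1 * dphi ground R1) *\<^sub>R (LINT x|surface_measure S1. F x)"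
    using div unfolding eq .
  finally show ?thesis unfolding c1d by (simp add: scaleR_conv_of_real[where 'a=complex] algebra_simps)
qed

lemma ground_weak_solution: "weak_solution Om S2 S1 (annulus_normal R1) (of_real ground) u0 u0"
  unfolding weak_solution_def
proof (intro exI conjI allI impI)
  show "in_H1 Om S2 S1 (annulus_normal R1) u0 g0 u0 (\<lambda>_. 0)" by (rule in_H1_u0)
  fix w h \<psi> H assume T: "in_H1 Om S2 S1 (annulus_normal R1) w h \<psi> H"
  obtain F where F: "\<And>n. smooth (F n)" "L2_tendsto (lebesgue_on Om) F w"
      "L2_tendsto (lebesgue_on Om) (\<lambda>n. grad (F n)) h" "L2_tendsto (surface_measure (S2 \<union> S1)) F \<psi>"
    and w: "L2 (lebesgue_on Om) w" and h: "L2 (lebesgue_on Om) h" and \<psi>: "L2 (surface_measure (S2 \<union> S1)) \<psi>"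
    and \<psi>0: "AE x in surface_measure S2. \<psi> x = 0"
    using T unfolding in_H1_def H1_dom_def has_trace_def by blast
  have LF: "L2 (lebesgue_on Om) (F n)" "L2 (lebesgue_on Om) (grad (F n))" "L2 (surface_measure (S2 \<union> S1)) (F n)" for n
    by (intro L2_annulus L2_surface smooth_continuous smooth_continuous_grad F(1))+
  have L1: "L2 (surface_measure (S2 \<union> S1)) (\<lambda>_. 1 :: complex)" by (intro L2_surface continuous_intros)
  have L: "L2 (lebesgue_on Om) u0" "L2 (lebesgue_on Om) g0"
    by (intro L2_annulus continuous_u0 continuous_g0)+
  have sub: "S1 \<subseteq> S2 \<union> S1" "S2 \<subseteq> S2 \<union> S1" "S1 \<in> sets borel" "S2 \<in> sets borel" "S2 \<union> S1 \<in> sets borel" by auto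
  note mono1 = L2_surface_mono[OF sub(1,3,5)] L2_tendsto_surface_mono[OF sub(1,3,5)]
  note mono2 = L2_surface_mono[OF sub(2,4,5)] L2_tendsto_surface_mono[OF sub(2,4,5)]
  have l1: "(\<lambda>n. LINT x|lebesgue_on Om. (\<Sum>i\<in>UNIV. g0 x $ i * grad (F n) x $ i))
      \<longlonglongrightarrow> (LINT x|lebesgue_on Om. (\<Sum>i\<in>UNIV. g0 x $ i * h x $ i))"
    by (rule L2_tendsto_mult_vec[OF LF(2) h F(3) L(2)])
  have l2: "(\<lambda>n. LINT x|lebesgue_on Om. u0 x * F n x) \<longlonglongrightarrow> (LINT x|lebesgue_on Om. u0 x * w x)"
    by (rule L2_tendsto_mult[OF LF(1) w F(2) L(1)])
  have l3: "(\<lambda>n. LINT x|surface_measure S1. F n x) \<longlonglongrightarrow> (LINT x|surface_measure S1. \<psi> x)"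
    using L2_tendsto_mult[OF mono1(1)[OF LF(3)] mono1(1)[OF \<psi>] mono1(2)[OF F(4)] mono1(1)[OF L1]] by simp
  have l4: "(\<lambda>n. LINT x|surface_measure S2. F n x) \<longlonglongrightarrow> (LINT x|surface_measure S2. \<psi> x)"
    using L2_tendsto_mult[OF mono2(1)[OF LF(3)] mono2(1)[OF \<psi>] mono2(2)[OF F(4)] mono2(1)[OF L1]] by simp
  have z: "(LINT x|surface_measure S2. \<psi> x) = 0"
    by (rule integral_eq_zero_AE[OF \<psi>0])
  have "(\<lambda>n. of_real ground * ((LINT x|lebesgue_on Om. u0 x * F n x) + (LINT x|surface_measure S1. F n x))
      + of_real (c2 * dphi ground R2) * (LINT x|surface_measure S2. F n x))
    \<longlonglongrightarrow> of_real ground * ((LINT x|lebesgue_on Om. u0 x * w x) + (LINT x|surface_measure S1. \<psi> x))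
      + of_real (c2 * dphi ground R2) * (LINT x|surface_measure S2. \<psi> x)"
    by (intro tendsto_intros l2 l3 l4)
  then have "(\<lambda>n. LINT x|lebesgue_on Om. (\<Sum>i\<in>UNIV. g0 x $ i * grad (F n) x $ i))
    \<longlonglongrightarrow> of_real ground * ((LINT x|lebesgue_on Om. u0 x * w x) + (LINT x|surface_measure S1. \<psi> x))"
    by (simp add: ground_identity_smooth[OF F(1)] z)
  from LIMSEQ_unique[OF l1 this]
  have "(LINT x|lebesgue_on Om. (\<Sum>i\<in>UNIV. g0 x $ i * h x $ i))
    = of_real ground * ((LINT x|lebesgue_on Om. u0 x * w x) + (LINT x|surface_measure S1. \<psi> x))" .
  \<comment> \<open>The normalisation \<open>phi ground R1 = 1\<close> makes \<open>u0\<close> equal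
    to 1 on the inner sphere.\<close>
  moreover have "(LINT x|surface_measure S1. u0 x * \<psi> x) = (LINT x|surface_measure S1. \<psi> x)"
    by (intro Bochner_Integration.integral_cong refl) (simp add: u0_def phi_R1)
  ultimately show "(LINT x|lebesgue_on Om. (\<Sum>i\<in>UNIV. g0 x $ i * h x $ i))
      + (LINT x|surface_measure S1. herm 0 (vec_cnj (H x)))
    = of_real ground * ((LINT x|lebesgue_on Om. u0 x * w x) + (LINT x|surface_measure S1. u0 x * \<psi> x))"
    by (simp add: herm_def)
qed

lemma Om_nonempty: "Om \<noteq> {}"
proof -
  obtain x :: "real^'n" where "norm x = (R1 + R2) / 2" using vector_choose_size[of "(R1 + R2) / 2"] R1 R12 by auto
  then have "x \<in> Om" using R12 by auto
  then show ?thesis by blast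
qed

lemma ground_eigenvalue: "eigenvalue Om S2 S1 (annulus_normal R1) (of_real ground)"
proof -
  have "\<not> (AE x in lebesgue_on Om. u0 x = 0)"
  proof
    assume "AE x in lebesgue_on Om. u0 x = 0"
    then have "AE x in lebesgue_on Om. False"
      using AE_space[of "lebesgue_on Om"]
    proof eventually_elim
      case (elim x)
      then have "R1 \<le> norm x" "norm x < R2" by auto
      then show ?case using phi_ground_pos[of "norm x"] elim(1) by (simp add: u0_def)
    qed
    then have "AE x in lebesgue_on Om. x \<notin> space (lebesgue_on Om)" by (rule eventually_mono) simp
    then have "space (lebesgue_on Om) \<in> null_sets (lebesgue_on Om)"
      using AE_iff_null_sets[OF sets.top, of "lebesgue_on Om"] by blast
    then have "emeasure (lebesgue_on Om) (space (lebesgue_on Om)) = 0" by (rule null_setsD1)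
    moreover have "emeasure (lebesgue_on Om) (space (lebesgue_on Om)) = emeasure lborel Om"
      by (simp add: emeasure_restrict_space)
    ultimately show False using emeasure_open_pos[OF _ Om_nonempty] by auto
  qed
  then show ?thesis unfolding eigenvalue_def eigenfunction_def using ground_weak_solution by blast
qed

end


section \<open>Rigidity\<close>

lemma nn_integral_lborel_translation:
  fixes f :: "'a::euclidean_space \<Rightarrow> ennreal"
  assumes "f \<in> borel_measurable borel"
  shows "(\<integral>\<^sup>+x. f (c + x) \<partial>lborel) = (\<integral>\<^sup>+x. f x \<partial>lborel)"
proof -
  have "(\<integral>\<^sup>+x. f x \<partial>lborel) = (\<integral>\<^sup>+x. f x \<partial>distr lborel borel ((+) c))" by (simp only: lborel_distr_plus)
  also have "\<dots> = (\<integral>\<^sup>+x. f (c + x) \<partial>lborel)" using assms by (subst nn_integral_distr) auto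
  finally show ?thesis ..
qed

text \<open>After the substitution \<open>y = x + h\<close> and integration in \<open>x\<close> first, each point of the segment contributes
  the full integral of \<open>k\<close>.\<close>

lemma poincare_ball:
  fixes W :: "'a::euclidean_space \<Rightarrow> 'b::euclidean_space" and k :: "'a \<Rightarrow> ennreal"
  assumes W [measurable]: "W \<in> borel_measurable borel" and k [measurable]: "k \<in> borel_measurable borel"
    and le: "\<And>x y. x \<in> ball a \<delta> \<Longrightarrow> y \<in> ball a \<delta> \<Longrightarrow>
      ennreal (norm (W y - W x)) \<le> ennreal (2 * \<delta>) * (\<integral>\<^sup>+t. indicator {0..1} t * k (x + t *\<^sub>R (y - x)) \<partial>lborel)"
  shows "(\<integral>\<^sup>+x. (\<integral>\<^sup>+y. indicator (ball a \<delta>) x * indicator (ball a \<delta>) y * ennreal (norm (W y - W x)) \<partial>lborel) \<partial>lborel)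
    \<le> ennreal (2 * \<delta>) * emeasure lborel (ball (0::'a) (2 * \<delta>)) * (\<integral>\<^sup>+x. k x \<partial>lborel)"
proof -
  let ?B = "ball a \<delta>" and ?D = "ball (0::'a) (2 * \<delta>)"
  define J where "J x h = (\<integral>\<^sup>+t. indicator {0..1} t * k (x + t *\<^sub>R h) \<partial>lborel)" for x h
  have [measurable]: "ball c r \<in> sets borel" for c :: 'a and r by simp
  have [measurable]: "case_prod J \<in> borel_measurable (borel \<Otimes>\<^sub>M borel)" unfolding J_def by measurable
  have J_int: "(\<integral>\<^sup>+x. J x h \<partial>lborel) = (\<integral>\<^sup>+x. k x \<partial>lborel)" for h
  proof -
    have "(\<integral>\<^sup>+x. J x h \<partial>lborel) = (\<integral>\<^sup>+t. (\<integral>\<^sup>+x. indicator {0..1::real} t * k (x + t *\<^sub>R h) \<partial>lborel) \<partial>lborel)"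
      unfolding J_def by (rule lborel_pair.Fubini'[symmetric]) measurable
    also have "\<dots> = (\<integral>\<^sup>+t. indicator {0..1::real} t * (\<integral>\<^sup>+x. k x \<partial>lborel) \<partial>lborel)"
    proof (intro nn_integral_cong)
      fix t :: real
      have "(\<integral>\<^sup>+x. k (x + t *\<^sub>R h) \<partial>lborel) = (\<integral>\<^sup>+x. k x \<partial>lborel)"
        using nn_integral_lborel_translation[OF k, of "t *\<^sub>R h"] by (simp add: add.commute)
      then show "(\<integral>\<^sup>+x. indicator {0..1} t * k (x + t *\<^sub>R h) \<partial>lborel) = indicator {0..1} t * (\<integral>\<^sup>+x. k x \<partial>lborel)"
        by (subst nn_integral_cmult) auto
    qed
    also have "\<dots> = (\<integral>\<^sup>+x. k x \<partial>lborel)" by (subst nn_integral_multc) auto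
    finally show ?thesis .
  qed
  have "(\<integral>\<^sup>+x. (\<integral>\<^sup>+y. indicator ?B x * indicator ?B y * ennreal (norm (W y - W x)) \<partial>lborel) \<partial>lborel)
    = (\<integral>\<^sup>+x. (\<integral>\<^sup>+h. indicator ?B x * indicator ?B (x + h) * ennreal (norm (W (x + h) - W x)) \<partial>lborel) \<partial>lborel)"
  proof (rule nn_integral_cong)
    fix x :: 'a
    show "(\<integral>\<^sup>+y. indicator ?B x * indicator ?B y * ennreal (norm (W y - W x)) \<partial>lborel)
      = (\<integral>\<^sup>+h. indicator ?B x * indicator ?B (x + h) * ennreal (norm (W (x + h) - W x)) \<partial>lborel)"
      by (rule nn_integral_lborel_translation[symmetric]) measurable
  qed
  \<comment> \<open>Two points of the ball differ by some \<open>h\<close> of norm below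
    \<open>2 * \<delta>\<close>. Then \<open>x\<close> may range over the whole space, which is
    where translation invariance applies.\<close>
  also have "\<dots> \<le> (\<integral>\<^sup>+x. (\<integral>\<^sup>+h. indicator ?D h * (ennreal (2 * \<delta>) * J x h) \<partial>lborel) \<partial>lborel)"
  proof (intro nn_integral_mono)
    fix x h :: 'a
    show "indicator ?B x * indicator ?B (x + h) * ennreal (norm (W (x + h) - W x)) \<le> indicator ?D h * (ennreal (2 * \<delta>) * J x h)"
    proof (cases "x \<in> ?B \<and> x + h \<in> ?B")
      case True
      have "dist x (x + h) \<le> dist a x + dist a (x + h)" by (rule dist_triangle3)
      moreover have "dist x (x + h) = norm h" by (simp add: dist_norm)
      ultimately have "h \<in> ?D" using True by simp
      then show ?thesis using le[of x "x + h"] True by (simp add: J_def)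
    qed (auto split: split_indicator)
  qed
  also have "\<dots> = (\<integral>\<^sup>+h. (\<integral>\<^sup>+x. indicator ?D h * (ennreal (2 * \<delta>) * J x h) \<partial>lborel) \<partial>lborel)"
    by (rule lborel_pair.Fubini'[symmetric]) measurable
  also have "\<dots> = (\<integral>\<^sup>+h. indicator ?D h * (ennreal (2 * \<delta>) * (\<integral>\<^sup>+x. k x \<partial>lborel)) \<partial>lborel)"
    by (intro nn_integral_cong) (simp add: nn_integral_cmult J_int)
  also have "\<dots> = emeasure lborel ?D * (ennreal (2 * \<delta>) * (\<integral>\<^sup>+x. k x \<partial>lborel))"
    by (subst nn_integral_multc) auto
  finally show ?thesis by (simp add: ac_simps)
qed

lemma AE_imp_exists:
  assumes "AE x in M. P x" "B \<in> sets M" "emeasure M B > 0"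
  shows "\<exists>x\<in>B. P x"
proof (rule ccontr)
  assume "\<not> ?thesis"
  then have "AE x in M. x \<notin> B" using assms(1) by (auto elim!: eventually_mono)
  then have "B \<in> null_sets M" using AE_iff_null_sets[OF assms(2)] by blast
  then show False using assms(3) by (simp add: null_setsD1)
qed

text \<open>Cauchy-Schwarz on a set of finite measure turns convergence in the square mean into
  convergence in the mean, the form used by the Poincare estimate.\<close>

lemma nn_integral_tendsto_0_square:
  fixes f :: "nat \<Rightarrow> 'a \<Rightarrow> ennreal"
  assumes f [measurable]: "\<And>n. f n \<in> borel_measurable M" and B [measurable]: "B \<in> sets M" and fin: "emeasure M B < \<infinity>"
    and lim: "(\<lambda>n. \<integral>\<^sup>+x. indicator B x * (f n x)\<^sup>2 \<partial>M) \<longlonglongrightarrow> 0"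
  shows "(\<lambda>n. \<integral>\<^sup>+x. indicator B x * f n x \<partial>M) \<longlonglongrightarrow> 0"
proof (rule order_tendstoI)
  define a where "a n = (\<integral>\<^sup>+x. indicator B x * f n x \<partial>M)" for n
  have le: "(a n)\<^sup>2 \<le> emeasure M B * (\<integral>\<^sup>+x. indicator B x * (f n x)\<^sup>2 \<partial>M)" for n
  proof -
    have "(\<integral>\<^sup>+x. indicator B x * (indicator B x * f n x) \<partial>M)\<^sup>2
        \<le> (\<integral>\<^sup>+x. (indicator B x)\<^sup>2 \<partial>M) * (\<integral>\<^sup>+x. (indicator B x * f n x)\<^sup>2 \<partial>M)"
      by (rule Cauchy_Schwarz_nn_integral) measurable
    also have "(\<lambda>x. indicator B x * (indicator B x * f n x)) = (\<lambda>x. indicator B x * f n x)"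
      by (auto simp: fun_eq_iff split: split_indicator)
    also have "(\<lambda>x. (indicator B x)\<^sup>2 :: ennreal) = indicator B"
      by (auto simp: fun_eq_iff split: split_indicator)
    also have "(\<lambda>x. (indicator B x * f n x)\<^sup>2) = (\<lambda>x. indicator B x * (f n x)\<^sup>2)"
      by (auto simp: fun_eq_iff split: split_indicator)
    finally show ?thesis by (simp add: a_def)
  qed
  have lim0: "(\<lambda>n. emeasure M B * (\<integral>\<^sup>+x. indicator B x * (f n x)\<^sup>2 \<partial>M)) \<longlonglongrightarrow> 0"
    using ennreal_tendsto_cmult[OF _ lim, of "emeasure M B"] fin by simp
  fix e :: ennreal assume e: "0 < e"
  then have "0 < e\<^sup>2" by (simp add: zero_less_iff_neq_zero)
  from order_tendstoD(2)[OF lim0 this]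
  show "\<forall>\<^sub>F n in sequentially. (\<integral>\<^sup>+x. indicator B x * f n x \<partial>M) < e"
  proof eventually_elim
    case (elim n)
    show ?case
    proof (rule ccontr)
      assume "\<not> ?case"
      then have "e \<le> a n" by (simp add: a_def)
      then have "e\<^sup>2 \<le> (a n)\<^sup>2" unfolding power2_eq_square by (intro mult_mono) auto
      then show False using le[of n] elim by simp
    qed
  qed
qed simp

lemma nn_integral_add3:
  "f \<in> borel_measurable M \<Longrightarrow> g \<in> borel_measurable M \<Longrightarrow> h \<in> borel_measurable M \<Longrightarrow>
    (\<integral>\<^sup>+x. f x + (g x + h x) \<partial>M) = (\<integral>\<^sup>+x. f x \<partial>M) + ((\<integral>\<^sup>+x. g x \<partial>M) + (\<integral>\<^sup>+x. h x \<partial>M))"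
  by (simp add: nn_integral_add)

text \<open>The triangle inequality through \<open>W n x\<close> and \<open>W n y\<close> bounds the
  double integral of \<open>norm (w y - w x)\<close> over the ball by two approximation errors and
  the Poincare bound for \<open>W n\<close>, all tending to 0.\<close>

lemma poincare_limit:
  fixes W :: "nat \<Rightarrow> 'a::euclidean_space \<Rightarrow> 'b::euclidean_space" and k :: "nat \<Rightarrow> 'a \<Rightarrow> ennreal"
  assumes \<delta>: "\<delta> > 0" and w [measurable]: "w \<in> borel_measurable borel"
    and W [measurable]: "\<And>n. W n \<in> borel_measurable borel" and k: "\<And>n. k n \<in> borel_measurable borel"
    and le: "\<And>n x y. x \<in> ball a \<delta> \<Longrightarrow> y \<in> ball a \<delta> \<Longrightarrow>
      ennreal (norm (W n y - W n x)) \<le> ennreal (2 * \<delta>) * (\<integral>\<^sup>+t. indicator {0..1} t * k n (x + t *\<^sub>R (y - x)) \<partial>lborel)"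
    and lim_W: "(\<lambda>n. \<integral>\<^sup>+x. indicator (ball a \<delta>) x * ennreal (norm (W n x - w x)) \<partial>lborel) \<longlonglongrightarrow> 0"
    and lim_k: "(\<lambda>n. \<integral>\<^sup>+x. k n x \<partial>lborel) \<longlonglongrightarrow> 0"
  shows "\<exists>c. AE x in lborel. x \<in> ball a \<delta> \<longrightarrow> w x = c"
proof -
  let ?B = "ball a \<delta>"
  define m where "m = emeasure lborel ?B"
  define C where "C = ennreal (2 * \<delta>) * emeasure lborel (ball (0::'a) (2 * \<delta>))"
  define A where "A n = (\<integral>\<^sup>+x. indicator ?B x * ennreal (norm (W n x - w x)) \<partial>lborel)" for n
  define J where "J x = (\<integral>\<^sup>+y. indicator ?B x * indicator ?B y * ennreal (norm (w y - w x)) \<partial>lborel)" for x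
  have fin: "m < \<infinity>" "C < \<infinity>" "m > 0"
    using \<delta> by (auto simp: m_def C_def ennreal_mult_less_top emeasure_ball)
  have [measurable]: "?B \<in> sets borel" by simp
  have [measurable]: "J \<in> borel_measurable borel" unfolding J_def by measurable
  have bound: "(\<integral>\<^sup>+x. J x \<partial>lborel) \<le> m * A n + (C * (\<integral>\<^sup>+x. k n x \<partial>lborel) + m * A n)" for n
  proof -
    let ?r = "\<lambda>x. ennreal (norm (W n x - w x))"
    have pt: "indicator ?B x * indicator ?B y * ennreal (norm (w y - w x))
      \<le> indicator ?B x * (indicator ?B y * ?r y) + (indicator ?B x * indicator ?B y * ennreal (norm (W n y - W n x)) + (indicator ?B x * ?r x) * indicator ?B y)"
      for x y
    proof -
      have "norm (w y - w x) \<le> norm (W n y - w y) + (norm (W n y - W n x) + norm (W n x - w x))"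
        by (smt (verit) norm_triangle_ineq4 norm_triangle_ineq diff_add_cancel norm_minus_commute add_diff_eq diff_diff_eq2)
      then have "ennreal (norm (w y - w x)) \<le> ?r y + (ennreal (norm (W n y - W n x)) + ?r x)"
        by (simp flip: ennreal_plus)
      then show ?thesis by (auto split: split_indicator)
    qed
    have "(\<integral>\<^sup>+x. J x \<partial>lborel) \<le> (\<integral>\<^sup>+x. (\<integral>\<^sup>+y. indicator ?B x * (indicator ?B y * ?r y)
        + (indicator ?B x * indicator ?B y * ennreal (norm (W n y - W n x)) + (indicator ?B x * ?r x) * indicator ?B y) \<partial>lborel) \<partial>lborel)"
      unfolding J_def by (intro nn_integral_mono pt)
    also have "\<dots> = (\<integral>\<^sup>+x. indicator ?B x * A n + ((\<integral>\<^sup>+y. indicator ?B x * indicator ?B y * ennreal (norm (W n y - W n x)) \<partial>lborel)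
        + (indicator ?B x * ?r x) * m) \<partial>lborel)"
    proof (rule nn_integral_cong)
      fix x :: 'a
      have e: "(\<integral>\<^sup>+y. indicator ?B x * (indicator ?B y * ?r y) \<partial>lborel) = indicator ?B x * A n"
        unfolding A_def by (rule nn_integral_cmult) measurable
      have e': "(\<integral>\<^sup>+y. (indicator ?B x * ?r x) * indicator ?B y \<partial>lborel) = (indicator ?B x * ?r x) * m"
        unfolding m_def by (rule nn_integral_cmult_indicator) simp
      show "(\<integral>\<^sup>+y. indicator ?B x * (indicator ?B y * ?r y)
        + (indicator ?B x * indicator ?B y * ennreal (norm (W n y - W n x)) + (indicator ?B x * ?r x) * indicator ?B y) \<partial>lborel)
        = indicator ?B x * A n + ((\<integral>\<^sup>+y. indicator ?B x * indicator ?B y * ennreal (norm (W n y - W n x)) \<partial>lborel)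
        + (indicator ?B x * ?r x) * m)"
        unfolding e[symmetric] e'[symmetric] by (rule nn_integral_add3) measurable
    qed
    also have "\<dots> = (\<integral>\<^sup>+x. indicator ?B x * A n \<partial>lborel)
        + ((\<integral>\<^sup>+x. (\<integral>\<^sup>+y. indicator ?B x * indicator ?B y * ennreal (norm (W n y - W n x)) \<partial>lborel) \<partial>lborel)
        + (\<integral>\<^sup>+x. (indicator ?B x * ?r x) * m \<partial>lborel))"
      by (rule nn_integral_add3) measurable
    also have "(\<integral>\<^sup>+x. indicator ?B x * A n \<partial>lborel) = m * A n" unfolding m_def by (subst nn_integral_multc) auto
    also have "(\<integral>\<^sup>+x. (indicator ?B x * ?r x) * m \<partial>lborel) = m * A n"
      unfolding A_def by (subst nn_integral_multc) (auto simp: mult.commute)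
    also have "(\<integral>\<^sup>+x. (\<integral>\<^sup>+y. indicator ?B x * indicator ?B y * ennreal (norm (W n y - W n x)) \<partial>lborel) \<partial>lborel)
        \<le> C * (\<integral>\<^sup>+x. k n x \<partial>lborel)"
      unfolding C_def by (rule poincare_ball[OF W k le])
    finally show ?thesis by (simp add: add_left_mono add_right_mono)
  qed
  have "(\<lambda>n. m * A n + (C * (\<integral>\<^sup>+x. k n x \<partial>lborel) + m * A n)) \<longlonglongrightarrow> m * 0 + (C * 0 + m * 0)"
    using fin lim_W lim_k unfolding A_def
    by (intro tendsto_add ennreal_tendsto_cmult) (auto simp: less_top)
  then have "(\<integral>\<^sup>+x. J x \<partial>lborel) \<le> m * 0 + (C * 0 + m * 0)"
    by (rule LIMSEQ_le_const) (use bound in blast)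
  then have "(\<integral>\<^sup>+x. J x \<partial>lborel) = 0" by simp
  then have "AE x in lborel. J x = 0" by (subst (asm) nn_integral_0_iff_AE) auto
  \<comment> \<open>A single good point \<open>x\<close> is enough: vanishing of \<open>J x\<close>
    says that \<open>w\<close> equals \<open>w x\<close> almost everywhere on the ball.\<close>
  from AE_imp_exists[OF this, of ?B] obtain x where x: "x \<in> ?B" "J x = 0" using fin(3) by (auto simp: m_def)
  have "(\<integral>\<^sup>+y. indicator ?B y * ennreal (norm (w y - w x)) \<partial>lborel) = 0" using x by (simp add: J_def)
  then have "AE y in lborel. indicator ?B y * ennreal (norm (w y - w x)) = 0" by (subst (asm) nn_integral_0_iff_AE) auto
  then have "AE y in lborel. y \<in> ?B \<longrightarrow> w y = w x" by eventually_elim (auto simp: ennreal_eq_0_iff)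
  then show ?thesis by (rule exI)
qed

lemma completion_ex_borel_measurable_complex:
  fixes g :: "'a \<Rightarrow> complex"
  assumes "g \<in> borel_measurable (completion M)"
  shows "\<exists>g'\<in>borel_measurable M. (AE x in M. g x = g' x)"
proof -
  have "(\<lambda>x. Re (g x)) \<in> borel_measurable (completion M)" "(\<lambda>x. Im (g x)) \<in> borel_measurable (completion M)"
    using assms by measurable
  from completion_ex_borel_measurable_real[OF this(1)] completion_ex_borel_measurable_real[OF this(2)]
  obtain a b where [measurable]: "a \<in> borel_measurable M" "b \<in> borel_measurable M"
      and ab: "AE x in M. Re (g x) = a x" "AE x in M. Im (g x) = b x" by (elim bexE) (rule that)
  have "(\<lambda>x. complex_of_real (a x) + \<i> * complex_of_real (b x)) \<in> borel_measurable M" by measurable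
  moreover have "AE x in M. g x = complex_of_real (a x) + \<i> * complex_of_real (b x)"
    using ab by eventually_elim (simp add: complex_eq_iff)
  ultimately show ?thesis by (intro bexI)
qed

lemma AE_not_in_imp_negligible:
  fixes A :: "'a::euclidean_space set"
  assumes "AE x in lebesgue. x \<notin> A"
  shows "negligible A"
proof -
  obtain N where N: "N \<in> null_sets lebesgue" "{x \<in> space lebesgue. \<not> x \<notin> A} \<subseteq> N"
    using assms unfolding eventually_ae_filter by blast
  then have "A \<subseteq> N" by simp
  with N(1) show ?thesis
    unfolding negligible_iff_null_sets[symmetric] by (rule negligible_subset)
qed

lemma norm_sum_scaleR_le:
  "norm (\<Sum>i\<in>UNIV. (y::real^'n) $ i *\<^sub>R (d::complex^'n) $ i) \<le> norm y * norm d"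
proof -
  have "norm (\<Sum>i\<in>UNIV. y $ i *\<^sub>R d $ i) \<le> (\<Sum>i\<in>UNIV. \<bar>y $ i\<bar> * \<bar>norm (d $ i)\<bar>)"
    by (rule order_trans[OF norm_sum]) simp
  also have "\<dots> \<le> L2_set (\<lambda>i. y $ i) UNIV * L2_set (\<lambda>i. norm (d $ i)) UNIV" by (rule L2_set_mult_ineq)
  also have "\<dots> = norm y * norm d" by (simp add: norm_vec_def L2_set_def)
  finally show ?thesis .
qed

section \<open>Dividing by the ground state\<close>

context annulus_problem
begin

abbreviation p0 :: "real^'n \<Rightarrow> real" where "p0 x \<equiv> phi ground (norm x)"

lemma p0_pos: "x \<in> Om \<Longrightarrow> p0 x > 0"
  by (rule phi_ground_pos) auto

lemma continuous_p0: "S \<subseteq> Om \<Longrightarrow> continuous_on S p0"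
  by (rule continuous_on_subset[OF continuous_on_K_norm[OF continuous_phi_ground]]) auto

lemma continuous_bfield_ground: "S \<subseteq> Om \<Longrightarrow> continuous_on S (bfield (beta ground))"
proof -
  assume S: "S \<subseteq> Om"
  have d: "continuous_on S (\<lambda>x. dphi ground (norm x))"
    by (rule continuous_on_subset[OF continuous_on_K_norm[OF continuous_dphi_ground]]) (use S in auto)
  have "p0 x \<noteq> 0" "x \<noteq> 0" if "x \<in> S" for x using p0_pos[of x] S that K_nonzero[of x] by auto
  then show ?thesis
    unfolding bfield_def beta_def
    by (intro continuous_on_scaleR continuous_on_divide d continuous_p0[OF S] continuous_intros) auto
qed

lemma continuous_defect_ground:
  "smooth F \<Longrightarrow> S \<subseteq> Om \<Longrightarrow> continuous_on S (defect (beta ground) F (grad F))"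
  unfolding defect_def
  by (intro continuous_on_vec_lambda continuous_on_diff continuous_on_mult continuous_on_of_real continuous_on_component
      smooth_continuous smooth_continuous_grad continuous_bfield_ground)

text \<open>The quotient rule: the logarithmic gradient of \<open>p0\<close> is
  \<open>bfield (beta ground)\<close>, so the gradient of \<open>F / p0\<close> is the defect of
  \<open>F\<close> divided by \<open>p0\<close>.\<close>

lemma quotient_derivative:
  assumes F: "smooth F" and z: "x + t *\<^sub>R y \<in> Om"
  shows "((\<lambda>t. (1 / p0 (x + t *\<^sub>R y)) *\<^sub>R F (x + t *\<^sub>R y)) has_vector_derivative
      (1 / p0 (x + t *\<^sub>R y)) *\<^sub>R (\<Sum>i\<in>UNIV. y $ i *\<^sub>R defect (beta ground) F (grad F) (x + t *\<^sub>R y) $ i)) (at t within S)"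
proof -
  let ?z = "x + t *\<^sub>R y"
  have r: "norm ?z \<in> {R1<..<R2}" "?z \<noteq> 0" using z R1 by auto
  have p: "p0 ?z > 0" by (rule p0_pos[OF z])
  have dphi': "(phi ground has_real_derivative dphi ground (norm ?z)) (at (norm ?z))"
    using deriv_phi[of "norm ?z" ground] r at_within_Icc_at[of R1 "norm ?z" R2] by auto
  have dn: "((\<lambda>t. norm (x + t *\<^sub>R y)) has_real_derivative (?z \<bullet> y) / norm ?z) (at t within S)"
  proof -
    have l: "((\<lambda>t. x + t *\<^sub>R y) has_derivative (\<lambda>s. s *\<^sub>R y)) (at t within S)"
      by (auto intro!: derivative_eq_intros)
    have "((\<lambda>t. norm (x + t *\<^sub>R y)) has_derivative (\<lambda>s. (s *\<^sub>R y) \<bullet> sgn ?z)) (at t within S)"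
      using has_derivative_compose[OF l has_derivative_norm[OF r(2)]] by simp
    also have "(\<lambda>s. (s *\<^sub>R y) \<bullet> sgn ?z) = (\<lambda>s. (?z \<bullet> y) / norm ?z * s)"
      by (simp add: fun_eq_iff sgn_div_norm inner_commute divide_inverse)
    finally show ?thesis unfolding has_field_derivative_def .
  qed
  have dp: "((\<lambda>t. p0 (x + t *\<^sub>R y)) has_real_derivative dphi ground (norm ?z) * ((?z \<bullet> y) / norm ?z)) (at t within S)"
    by (rule DERIV_chain2[OF dphi' dn])
  have d1: "((\<lambda>t. 1 / p0 (x + t *\<^sub>R y)) has_real_derivative
      - (dphi ground (norm ?z) * ((?z \<bullet> y) / norm ?z)) / (p0 ?z * p0 ?z)) (at t within S)"
    using DERIV_divide[OF DERIV_const dp, of 1] p by simp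
  have "((\<lambda>t. (1 / p0 (x + t *\<^sub>R y)) *\<^sub>R F (x + t *\<^sub>R y)) has_vector_derivative
     (1 / p0 ?z) *\<^sub>R (\<Sum>i\<in>UNIV. y $ i *\<^sub>R grad F ?z $ i)
       + (- (dphi ground (norm ?z) * ((?z \<bullet> y) / norm ?z)) / (p0 ?z * p0 ?z)) *\<^sub>R F ?z) (at t within S)"
    by (rule has_vector_derivative_scaleR[OF d1 smooth_vector_derivative_line[OF F]])
  also have "(1 / p0 ?z) *\<^sub>R (\<Sum>i\<in>UNIV. y $ i *\<^sub>R grad F ?z $ i)
       + (- (dphi ground (norm ?z) * ((?z \<bullet> y) / norm ?z)) / (p0 ?z * p0 ?z)) *\<^sub>R F ?z
     = (1 / p0 ?z) *\<^sub>R (\<Sum>i\<in>UNIV. y $ i *\<^sub>R defect (beta ground) F (grad F) ?z $ i)"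
  proof -
    have "(\<Sum>i\<in>UNIV. y $ i *\<^sub>R (F ?z * of_real (bfield (beta ground) ?z $ i)))
      = (\<Sum>i\<in>UNIV. (beta ground (norm ?z) / norm ?z * (?z $ i * y $ i)) *\<^sub>R F ?z)"
      by (intro sum.cong refl) (simp add: bfield_def scaleR_conv_of_real[where 'a=complex] ac_simps)
    also have "\<dots> = (beta ground (norm ?z) / norm ?z * (?z \<bullet> y)) *\<^sub>R F ?z"
      by (simp add: inner_vec_def sum_distrib_left flip: scaleR_sum_left)
    finally have s: "(\<Sum>i\<in>UNIV. y $ i *\<^sub>R (F ?z * of_real (bfield (beta ground) ?z $ i)))
      = (beta ground (norm ?z) / norm ?z * (?z \<bullet> y)) *\<^sub>R F ?z" .
    have "(\<Sum>i\<in>UNIV. y $ i *\<^sub>R defect (beta ground) F (grad F) ?z $ i)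
      = (\<Sum>i\<in>UNIV. y $ i *\<^sub>R grad F ?z $ i) - (beta ground (norm ?z) / norm ?z * (?z \<bullet> y)) *\<^sub>R F ?z"
      unfolding s[symmetric] by (simp add: defect_def scaleR_diff_right sum_subtractf)
    then show ?thesis by (simp add: scaleR_diff_right beta_def ac_simps)
  qed
  finally show ?thesis .
qed

lemma nn_integral_ball_le:
  fixes f h :: "real^'n \<Rightarrow> ennreal"
  assumes f: "f \<in> borel_measurable borel" and B: "B \<in> sets borel" "B \<subseteq> Om"
    and ae: "AE x in lebesgue_on Om. x \<in> B \<longrightarrow> f x \<le> h x"
  shows "(\<integral>\<^sup>+x. indicator B x * f x \<partial>lborel) \<le> (\<integral>\<^sup>+x. h x \<partial>lebesgue_on Om)"
proof -
  have "(\<integral>\<^sup>+x. indicator B x * f x \<partial>lborel) = (\<integral>\<^sup>+x. indicator B x * f x \<partial>lebesgue)"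
    by (rule nn_integral_completion[symmetric]) (use f B in measurable)
  also have "\<dots> \<le> (\<integral>\<^sup>+x. h x * indicator Om x \<partial>lebesgue)"
  proof (rule nn_integral_mono_AE)
    have "AE x in lebesgue. x \<in> Om \<longrightarrow> (x \<in> B \<longrightarrow> f x \<le> h x)"
      using ae by (subst (asm) AE_restrict_space_iff) auto
    then show "AE x in lebesgue. indicator B x * f x \<le> h x * indicator Om x"
      by eventually_elim (use B in \<open>auto split: split_indicator\<close>)
  qed
  also have "\<dots> = (\<integral>\<^sup>+x. h x \<partial>lebesgue_on Om)"
    by (rule nn_integral_restrict_space[symmetric]) simp
  finally show ?thesis .
qed

text \<open>The Poincare estimate uses Fubini for Borel functions on \<open>lborel\<close>, whereas
  elements of H1 are only Lebesgue measurable.\<close>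

lemma borel_version:
  fixes u :: "real^'n \<Rightarrow> complex"
  assumes "u \<in> borel_measurable (lebesgue_on Om)"
  obtains u' where "u' \<in> borel_measurable borel" "AE x in lebesgue_on Om. u x = u' x"
proof -
  have "(\<lambda>x. indicator Om x *\<^sub>R u x) \<in> borel_measurable lebesgue"
    using assms by (subst (asm) borel_measurable_restrict_space_iff) auto
  from completion_ex_borel_measurable_complex[OF this]
  obtain u' where u': "u' \<in> borel_measurable lborel" "AE x in lborel. indicator Om x *\<^sub>R u x = u' x" by blast
  have "AE x in lebesgue. indicator Om x *\<^sub>R u x = u' x" by (rule AE_completion[OF u'(2)])
  then have "AE x in lebesgue. x \<in> Om \<longrightarrow> u x = u' x" by eventually_elim auto
  then have "AE x in lebesgue_on Om. u x = u' x" by (subst AE_restrict_space_iff) auto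
  with u'(1) show thesis by (intro that) auto
qed

text \<open>The fundamental theorem along the segment from \<open>x\<close> to \<open>y\<close>,
  which stays in \<open>B\<close> by convexity. This is the hypothesis of the Poincare estimate,
  with the defect as integrand.\<close>

lemma quotient_increment:
  assumes F: "smooth F" and B: "convex B" "B \<subseteq> Om" "x \<in> B" "y \<in> B"
    and Q: "\<And>z. z \<in> B \<Longrightarrow> 1 / p0 z \<le> Q" and d: "norm (y - x) \<le> d"
  shows "ennreal (norm ((1 / p0 y) *\<^sub>R F y - (1 / p0 x) *\<^sub>R F x))
    \<le> ennreal d * (\<integral>\<^sup>+t. indicator {0..1} t *
        (ennreal Q * (indicator B (x + t *\<^sub>R (y - x)) * ennreal (norm (defect (beta ground) F (grad F) (x + t *\<^sub>R (y - x)))))) \<partial>lborel)"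
    (is "_ \<le> _ * (\<integral>\<^sup>+t. ?k t \<partial>lborel)")
proof -
  let ?z = "\<lambda>t::real. x + t *\<^sub>R (y - x)"
  let ?D = "defect (beta ground) F (grad F)"
  let ?f = "\<lambda>t. (1 / p0 (?z t)) *\<^sub>R (\<Sum>i\<in>UNIV. (y - x) $ i *\<^sub>R ?D (?z t) $ i)"
  have zB: "?z t \<in> B" if "t \<in> {0..1}" for t
    using convexD_alt[OF B(1,3,4), of t] that by (simp add: algebra_simps)
  have zc: "continuous_on {0..1} ?z" by (intro continuous_intros)
  have pc: "continuous_on {0..1} (\<lambda>t. p0 (?z t))"
    by (rule continuous_on_compose2[OF continuous_p0[OF B(2)] zc]) (use zB in auto)
  have Dc: "continuous_on {0..1} (\<lambda>t. ?D (?z t))"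
    by (rule continuous_on_compose2[OF continuous_defect_ground[OF F B(2)] zc]) (use zB in auto)
  have pos: "p0 (?z t) > 0" if "t \<in> {0..1}" for t using p0_pos zB[OF that] B(2) by blast
  have fc: "continuous_on {0..1} ?f"
  proof (intro continuous_on_scaleR continuous_on_divide pc continuous_on_sum continuous_on_component Dc continuous_on_const ballI)
    fix t :: real assume "t \<in> {0..1}"
    then show "p0 (?z t) \<noteq> 0" using pos[of t] by simp
  qed
  have "has_bochner_integral lborel (\<lambda>t. indicator {0..1} t *\<^sub>R ?f t)
      ((1 / p0 (?z 1)) *\<^sub>R F (?z 1) - (1 / p0 (?z 0)) *\<^sub>R F (?z 0))"
  proof (rule has_bochner_integral_FTC_Icc[OF _ _ fc])
    fix t :: real assume "0 \<le> t" "t \<le> 1"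
    then have "?z t \<in> Om" using zB[of t] B(2) by auto
    then show "((\<lambda>t. (1 / p0 (?z t)) *\<^sub>R F (?z t)) has_vector_derivative ?f t) (at t within {0..1})"
      by (rule quotient_derivative[OF F])
  qed simp
  then have int: "integrable lborel (\<lambda>t. indicator {0..1} t *\<^sub>R ?f t)"
    and eq: "(LINT t|lborel. indicator {0..1} t *\<^sub>R ?f t) = (1 / p0 y) *\<^sub>R F y - (1 / p0 x) *\<^sub>R F x"
    by (auto simp: has_bochner_integral_iff)
  have d0: "0 \<le> d" using d norm_ge_zero order_trans by blast
  have "ennreal (norm ((1 / p0 y) *\<^sub>R F y - (1 / p0 x) *\<^sub>R F x)) \<le> (\<integral>\<^sup>+t. ennreal (norm (indicator {0..1} t *\<^sub>R ?f t)) \<partial>lborel)"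
    using integral_norm_bound_ennreal[OF int] unfolding eq .
  also have "\<dots> \<le> (\<integral>\<^sup>+t. ennreal d * ?k t \<partial>lborel)"
  proof (intro nn_integral_mono)
    fix t :: real
    show "ennreal (norm (indicator {0..1} t *\<^sub>R ?f t)) \<le> ennreal d * ?k t"
    proof (cases "t \<in> {0..1}")
      case True
      have Q0: "0 \<le> 1 / p0 (?z t)" "1 / p0 (?z t) \<le> Q" using pos[OF True] Q[OF zB[OF True]] by auto
      then have Q1: "0 \<le> Q" by (rule order_trans)
      have "norm (?f t) = 1 / p0 (?z t) * norm (\<Sum>i\<in>UNIV. (y - x) $ i *\<^sub>R ?D (?z t) $ i)"
        using Q0(1) by simp
      also have "\<dots> \<le> Q * (d * norm (?D (?z t)))"
      proof (rule mult_mono[OF Q0(2)])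
        show "norm (\<Sum>i\<in>UNIV. (y - x) $ i *\<^sub>R ?D (?z t) $ i) \<le> d * norm (?D (?z t))"
          by (rule order_trans[OF norm_sum_scaleR_le mult_right_mono[OF d]]) simp
      qed (use Q1 in auto)
      finally have "ennreal (norm (?f t)) \<le> ennreal (d * (Q * norm (?D (?z t))))"
        by (intro ennreal_leI) (simp add: ac_simps)
      also have "\<dots> = ennreal d * (ennreal Q * ennreal (norm (?D (?z t))))"
        using d0 Q1 by (simp add: ennreal_mult)
      finally show ?thesis using True zB[OF True] by simp
    qed simp
  qed
  also have "\<dots> = ennreal d * (\<integral>\<^sup>+t. ?k t \<partial>lborel)"
  proof (rule nn_integral_cmult)
    have "(\<lambda>t. indicator {0..1} t *\<^sub>R ?D (?z t)) \<in> borel_measurable borel"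
      by (rule borel_measurable_continuous_on_indicator[OF _ Dc]) simp
    then have "(\<lambda>t. ennreal Q * ennreal (norm (indicator {0..1} t *\<^sub>R ?D (?z t)))) \<in> borel_measurable lborel" by measurable
    also have "(\<lambda>t. ennreal Q * ennreal (norm (indicator {0..1} t *\<^sub>R ?D (?z t)))) = ?k"
      using zB by (auto simp: fun_eq_iff split: split_indicator)
    finally show "?k \<in> borel_measurable lborel" .
  qed
  finally show ?thesis .
qed

text \<open>The defects of the smooth approximants tend in the mean to the defect of
  \<open>u\<close>, which is 0. So the quotients by \<open>p0\<close> have vanishing gradients in
  the limit, and \<open>poincare_limit\<close> makes the limit quotient constant on the
  ball.\<close>

lemma local_rigidity:
  assumes H: "in_H1 Om S2 S1 \<nu> u g v G" and z: "AE x in lebesgue_on Om. defect (beta ground) u g x = 0" and a: "a \<in> Om"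
  obtains \<delta> c where "\<delta> > 0" "ball a \<delta> \<subseteq> Om" "AE x in lebesgue. x \<in> ball a \<delta> \<longrightarrow> u x = c * of_real (p0 x)"
proof -
  \<comment> \<open>A closed ball inside the open annulus stays away from the outer sphere, where
    \<open>p0\<close> vanishes; on it \<open>1 / p0\<close> and the field are bounded.\<close>
  obtain \<delta> where \<delta>: "\<delta> > 0" "cball a \<delta> \<subseteq> Om" using open_contains_cball[of Om] open_Om a by blast
  let ?B = "ball a \<delta>"
  have BO: "?B \<subseteq> Om" using \<delta> ball_subset_cball by blast
  have Bm [measurable]: "?B \<in> sets borel" by simp
  have ne: "p0 x \<noteq> 0" if "x \<in> cball a \<delta>" for x using p0_pos[of x] \<delta>(2) that by auto
  have "continuous_on (cball a \<delta>) (\<lambda>x. 1 / p0 x)"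
    by (intro continuous_on_divide continuous_on_const continuous_p0 \<delta>) (use ne in auto)
  from compact_bound[OF compact_cball this] obtain Q where Q0: "\<And>x. x \<in> cball a \<delta> \<Longrightarrow> norm (1 / p0 x) \<le> Q" by blast
  have Q: "1 / p0 x \<le> Q" if "x \<in> ?B" for x
    using Q0[OF subsetD[OF ball_subset_cball that]] abs_ge_self[of "1 / p0 x"] unfolding real_norm_def by linarith
  have Qpos: "0 \<le> Q" by (rule order_trans[OF norm_ge_zero Q0[of a]]) (use \<delta> in simp)
  have Q': "0 < 1 / p0 x" if "x \<in> ?B" for x using p0_pos[OF subsetD[OF BO that]] by simp
  from compact_bound[OF compact_cball continuous_bfield_ground[OF \<delta>(2)]]
  obtain b where b0: "\<And>x. x \<in> cball a \<delta> \<Longrightarrow> norm (bfield (beta ground) x) \<le> b" by blast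
  have b: "norm (bfield (beta ground) x) \<le> b" if "x \<in> ?B" for x
    by (rule b0[OF subsetD[OF ball_subset_cball that]])
  obtain F where F: "\<And>n. smooth (F n)" "L2_tendsto (lebesgue_on Om) F u" "L2_tendsto (lebesgue_on Om) (\<lambda>n. grad (F n)) g"
    and Lu: "L2 (lebesgue_on Om) u" and Lg: "L2 (lebesgue_on Om) g"
    using H unfolding in_H1_def H1_dom_def has_trace_def by blast
  have um: "u \<in> borel_measurable (lebesgue_on Om)" and gm: "g \<in> borel_measurable (lebesgue_on Om)"
    using Lu Lg by (auto simp: L2_def)
  from um obtain u' where u' [measurable]: "u' \<in> borel_measurable borel" and uu': "AE x in lebesgue_on Om. u x = u' x"
    by (rule borel_version)
  define q where "q = (\<lambda>x. indicator ?B x *\<^sub>R (1 / p0 x))"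
  have [measurable]: "q \<in> borel_measurable borel"
    unfolding q_def
    by (rule borel_measurable_continuous_on_indicator)
       (use ne in \<open>auto intro!: continuous_on_divide continuous_p0 BO continuous_on_const\<close>)
  have Fm [measurable]: "F n \<in> borel_measurable borel" for n
    by (rule borel_measurable_continuous_onI[OF smooth_continuous[OF F(1)]])
  define D where "D n = (\<lambda>x. indicator ?B x *\<^sub>R defect (beta ground) (F n) (grad (F n)) x)" for n
  have Dm [measurable]: "D n \<in> borel_measurable borel" for n
    unfolding D_def by (rule borel_measurable_continuous_on_indicator[OF _ continuous_defect_ground[OF F(1) BO]]) simp
  have fin: "emeasure lborel ?B < \<infinity>" using \<delta>(1) by (simp add: emeasure_ball)
  have limF2: "(\<lambda>n. \<integral>\<^sup>+x. indicator ?B x * (ennreal (norm (F n x - u' x)))\<^sup>2 \<partial>lborel) \<longlonglongrightarrow> 0"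
  proof (rule tendsto_sandwich[OF _ _ tendsto_const F(2)[unfolded L2_tendsto_def]])
    show "\<forall>\<^sub>F n in sequentially. (\<integral>\<^sup>+x. indicator ?B x * (ennreal (norm (F n x - u' x)))\<^sup>2 \<partial>lborel)
        \<le> (\<integral>\<^sup>+x. ennreal ((norm (F n x - u x))\<^sup>2) \<partial>lebesgue_on Om)"
    proof (intro always_eventually allI, rule nn_integral_ball_le[OF _ Bm BO])
      fix n
      show "AE x in lebesgue_on Om. x \<in> ?B \<longrightarrow> (ennreal (norm (F n x - u' x)))\<^sup>2 \<le> ennreal ((norm (F n x - u x))\<^sup>2)"
        using uu' by eventually_elim (simp add: ennreal_power)
    qed measurable
  qed simp
  have limF: "(\<lambda>n. \<integral>\<^sup>+x. indicator ?B x * ennreal (norm (F n x - u' x)) \<partial>lborel) \<longlonglongrightarrow> 0"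
    by (rule nn_integral_tendsto_0_square[OF _ _ fin limF2]) measurable
  have limW: "(\<lambda>n. \<integral>\<^sup>+x. indicator ?B x * ennreal (norm (q x *\<^sub>R F n x - q x *\<^sub>R u' x)) \<partial>lborel) \<longlonglongrightarrow> 0"
  proof (rule tendsto_sandwich[OF _ _ tendsto_const])
    have "(\<lambda>n. ennreal Q * (\<integral>\<^sup>+x. indicator ?B x * ennreal (norm (F n x - u' x)) \<partial>lborel)) \<longlonglongrightarrow> ennreal Q * 0"
      by (rule ennreal_tendsto_cmult[OF _ limF]) simp
    then show "(\<lambda>n. ennreal Q * (\<integral>\<^sup>+x. indicator ?B x * ennreal (norm (F n x - u' x)) \<partial>lborel)) \<longlonglongrightarrow> 0" by simp
    show "\<forall>\<^sub>F n in sequentially. (\<integral>\<^sup>+x. indicator ?B x * ennreal (norm (q x *\<^sub>R F n x - q x *\<^sub>R u' x)) \<partial>lborel)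
        \<le> ennreal Q * (\<integral>\<^sup>+x. indicator ?B x * ennreal (norm (F n x - u' x)) \<partial>lborel)"
    proof (intro always_eventually allI)
      fix n
      have "(\<integral>\<^sup>+x. indicator ?B x * ennreal (norm (q x *\<^sub>R F n x - q x *\<^sub>R u' x)) \<partial>lborel)
        \<le> (\<integral>\<^sup>+x. ennreal Q * (indicator ?B x * ennreal (norm (F n x - u' x))) \<partial>lborel)"
      proof (intro nn_integral_mono)
        fix x
        show "indicator ?B x * ennreal (norm (q x *\<^sub>R F n x - q x *\<^sub>R u' x)) \<le> ennreal Q * (indicator ?B x * ennreal (norm (F n x - u' x)))"
        proof (cases "x \<in> ?B")
          case True
          have "norm (q x *\<^sub>R F n x - q x *\<^sub>R u' x) = 1 / p0 x * norm (F n x - u' x)"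
            using Q'[OF True] True by (simp add: q_def flip: scaleR_diff_right)
          also have "\<dots> \<le> Q * norm (F n x - u' x)" by (rule mult_right_mono[OF Q[OF True]]) simp
          finally have "ennreal (norm (q x *\<^sub>R F n x - q x *\<^sub>R u' x)) \<le> ennreal (Q * norm (F n x - u' x))" by (rule ennreal_leI)
          also have "\<dots> = ennreal Q * ennreal (norm (F n x - u' x))"
            using Qpos by (intro ennreal_mult) auto
          finally show ?thesis using True by simp
        qed simp
      qed
      also have "\<dots> = ennreal Q * (\<integral>\<^sup>+x. indicator ?B x * ennreal (norm (F n x - u' x)) \<partial>lborel)"
        by (rule nn_integral_cmult) measurable
      finally show "(\<integral>\<^sup>+x. indicator ?B x * ennreal (norm (q x *\<^sub>R F n x - q x *\<^sub>R u' x)) \<partial>lborel) \<le> \<dots>" .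
    qed
  qed simp
  define C where "C = 2 + 2 * b\<^sup>2"
  have C0: "0 \<le> C" by (simp add: C_def)
  have limD2: "(\<lambda>n. \<integral>\<^sup>+x. indicator ?B x * (ennreal (norm (D n x)))\<^sup>2 \<partial>lborel) \<longlonglongrightarrow> 0"
  proof (rule tendsto_sandwich[OF _ _ tendsto_const])
    have "(\<lambda>n. ennreal C * (\<integral>\<^sup>+x. ennreal ((norm (grad (F n) x - g x))\<^sup>2) \<partial>lebesgue_on Om)
        + ennreal C * (\<integral>\<^sup>+x. ennreal ((norm (F n x - u x))\<^sup>2) \<partial>lebesgue_on Om)) \<longlonglongrightarrow> ennreal C * 0 + ennreal C * 0"
      by (rule tendsto_add[OF ennreal_tendsto_cmult[OF _ F(3)[unfolded L2_tendsto_def]] ennreal_tendsto_cmult[OF _ F(2)[unfolded L2_tendsto_def]]]) auto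
    then show "(\<lambda>n. ennreal C * (\<integral>\<^sup>+x. ennreal ((norm (grad (F n) x - g x))\<^sup>2) \<partial>lebesgue_on Om)
        + ennreal C * (\<integral>\<^sup>+x. ennreal ((norm (F n x - u x))\<^sup>2) \<partial>lebesgue_on Om)) \<longlonglongrightarrow> 0" by simp
    show "\<forall>\<^sub>F n in sequentially. (\<integral>\<^sup>+x. indicator ?B x * (ennreal (norm (D n x)))\<^sup>2 \<partial>lborel)
      \<le> ennreal C * (\<integral>\<^sup>+x. ennreal ((norm (grad (F n) x - g x))\<^sup>2) \<partial>lebesgue_on Om)
        + ennreal C * (\<integral>\<^sup>+x. ennreal ((norm (F n x - u x))\<^sup>2) \<partial>lebesgue_on Om)"
    proof (intro always_eventually allI)
      fix n
      have [measurable]: "u \<in> borel_measurable (lebesgue_on Om)" "g \<in> borel_measurable (lebesgue_on Om)" by fact+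
      have [measurable]: "F n \<in> borel_measurable (lebesgue_on Om)" "grad (F n) \<in> borel_measurable (lebesgue_on Om)"
        using L2_annulus[OF smooth_continuous[OF F(1)]] L2_annulus[OF smooth_continuous_grad[OF F(1)]] by (auto simp: L2_def)
      have "(\<integral>\<^sup>+x. indicator ?B x * (ennreal (norm (D n x)))\<^sup>2 \<partial>lborel)
        \<le> (\<integral>\<^sup>+x. ennreal C * ennreal ((norm (grad (F n) x - g x))\<^sup>2) + ennreal C * ennreal ((norm (F n x - u x))\<^sup>2) \<partial>lebesgue_on Om)"
      proof (rule nn_integral_ball_le[OF _ Bm BO])
        show "AE x in lebesgue_on Om. x \<in> ?B \<longrightarrow> (ennreal (norm (D n x)))\<^sup>2
          \<le> ennreal C * ennreal ((norm (grad (F n) x - g x))\<^sup>2) + ennreal C * ennreal ((norm (F n x - u x))\<^sup>2)"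
          using z
        proof eventually_elim
          case (elim x)
          show ?case
          proof
            assume x: "x \<in> ?B"
            \<comment> \<open>Almost everywhere the defect of \<open>u\<close> is 0, so
              \<open>D n x\<close> is a difference of two defects and
              \<open>defect_diff_bound\<close> applies.\<close>
            have "(norm (D n x))\<^sup>2 \<le> C * (norm (grad (F n) x - g x))\<^sup>2 + C * (norm (F n x - u x))\<^sup>2"
              using defect_diff_bound[OF b[OF x], of "F n" "grad (F n)" u g] elim x unfolding C_def by (simp add: D_def)
            then have "ennreal ((norm (D n x))\<^sup>2) \<le> ennreal (C * (norm (grad (F n) x - g x))\<^sup>2 + C * (norm (F n x - u x))\<^sup>2)"
              by (rule ennreal_leI)
            also have "\<dots> = ennreal C * ennreal ((norm (grad (F n) x - g x))\<^sup>2) + ennreal C * ennreal ((norm (F n x - u x))\<^sup>2)"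
              using C0 by (simp add: ennreal_mult)
            finally show "(ennreal (norm (D n x)))\<^sup>2
              \<le> ennreal C * ennreal ((norm (grad (F n) x - g x))\<^sup>2) + ennreal C * ennreal ((norm (F n x - u x))\<^sup>2)"
              by (simp add: ennreal_power)
          qed
        qed
      qed measurable
      also have "\<dots> = ennreal C * (\<integral>\<^sup>+x. ennreal ((norm (grad (F n) x - g x))\<^sup>2) \<partial>lebesgue_on Om)
        + ennreal C * (\<integral>\<^sup>+x. ennreal ((norm (F n x - u x))\<^sup>2) \<partial>lebesgue_on Om)"
        by (simp add: nn_integral_add nn_integral_cmult)
      finally show "(\<integral>\<^sup>+x. indicator ?B x * (ennreal (norm (D n x)))\<^sup>2 \<partial>lborel) \<le> \<dots>" .
    qed
  qed simp
  have limD: "(\<lambda>n. \<integral>\<^sup>+x. indicator ?B x * ennreal (norm (D n x)) \<partial>lborel) \<longlonglongrightarrow> 0"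
    by (rule nn_integral_tendsto_0_square[OF _ _ fin limD2]) measurable
  define k where "k n x = ennreal Q * (indicator ?B x * ennreal (norm (D n x)))" for n x
  have km: "k n \<in> borel_measurable borel" for n unfolding k_def by measurable
  have "(\<lambda>n. ennreal Q * (\<integral>\<^sup>+x. indicator ?B x * ennreal (norm (D n x)) \<partial>lborel)) \<longlonglongrightarrow> ennreal Q * 0"
    by (rule ennreal_tendsto_cmult[OF _ limD]) simp
  moreover have "(\<integral>\<^sup>+x. k n x \<partial>lborel) = ennreal Q * (\<integral>\<^sup>+x. indicator ?B x * ennreal (norm (D n x)) \<partial>lborel)" for n
    unfolding k_def by (rule nn_integral_cmult) measurable
  ultimately have limk: "(\<lambda>n. \<integral>\<^sup>+x. k n x \<partial>lborel) \<longlonglongrightarrow> 0" by simp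
  have "\<exists>c. AE x in lborel. x \<in> ?B \<longrightarrow> q x *\<^sub>R u' x = c"
  proof (rule poincare_limit[OF \<delta>(1) _ _ km _ limW limk])
    fix n x y assume xy: "x \<in> ?B" "y \<in> ?B"
    have "dist y x \<le> dist a x + dist a y" by (metis dist_commute dist_triangle3)
    then have d: "norm (y - x) \<le> 2 * \<delta>" using xy by (simp add: dist_norm)
    have k: "k n z = ennreal Q * (indicator ?B z * ennreal (norm (defect (beta ground) (F n) (grad (F n)) z)))" for z
      by (auto simp: k_def D_def split: split_indicator)
    show "ennreal (norm (q y *\<^sub>R F n y - q x *\<^sub>R F n x))
      \<le> ennreal (2 * \<delta>) * (\<integral>\<^sup>+t. indicator {0..1} t * k n (x + t *\<^sub>R (y - x)) \<partial>lborel)"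
      using quotient_increment[OF F(1) convex_ball BO xy Q d] xy unfolding k by (simp add: q_def)
  qed measurable
  then obtain c where c: "AE x in lborel. x \<in> ?B \<longrightarrow> q x *\<^sub>R u' x = c" by blast
  have "AE x in lebesgue. x \<in> Om \<longrightarrow> u x = u' x" using uu' by (subst (asm) AE_restrict_space_iff) auto
  then have "AE x in lebesgue. x \<in> ?B \<longrightarrow> u x = c * of_real (p0 x)"
    using AE_completion[OF c]
  proof eventually_elim
    case (elim x)
    show ?case
    proof
      assume x: "x \<in> ?B"
      then have "u x = u' x" "c = (1 / p0 x) *\<^sub>R u' x" "p0 x \<noteq> 0"
        using elim subsetD[OF BO x] Q'[OF x] by (auto simp: q_def)
      then show "u x = c * of_real (p0 x)" by (simp add: scaleR_conv_of_real)
    qed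
  qed
  with \<delta>(1) BO show thesis by (rule that)
qed

section \<open>From balls to the whole annulus\<close>

lemma rigidity:
  assumes H: "in_H1 Om S2 S1 \<nu> u g v G" and z: "AE x in lebesgue_on Om. defect (beta ground) u g x = 0"
  obtains c where "AE x in lebesgue_on Om. u x = c * u0 x"
proof -
  define P where "P a \<delta> c \<longleftrightarrow> \<delta> > 0 \<and> ball a \<delta> \<subseteq> Om \<and> (AE x in lebesgue. x \<in> ball a \<delta> \<longrightarrow> u x = c * of_real (p0 x))" for a \<delta> c
  have "\<exists>\<delta> c. P a \<delta> c" if "a \<in> Om" for a
    unfolding P_def by (rule local_rigidity[OF H z that]) blast
  then obtain \<delta> c where P: "\<And>a. a \<in> Om \<Longrightarrow> P a (\<delta> a) (c a)" by metis
  have \<delta>: "\<delta> a > 0" "ball a (\<delta> a) \<subseteq> Om" if "a \<in> Om" for a using P[OF that] by (simp_all only: P_def)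
  have c: "AE x in lebesgue. x \<in> ball a (\<delta> a) \<longrightarrow> u x = c a * of_real (p0 x)" if "a \<in> Om" for a
    using P[OF that] by (simp only: P_def)
  \<comment> \<open>The two balls overlap in a nonempty open set. It has positive measure, hence
    contains a point where both representations of \<open>u\<close> hold.\<close>
  have agree: "c a = c a'" if a: "a \<in> Om" and a': "a' \<in> ball a (\<delta> a)" for a a'
  proof -
    let ?U = "ball a (\<delta> a) \<inter> ball a' (\<delta> a')"
    have a'': "a' \<in> Om" using \<delta>(2)[OF a] a' by blast
    have "a' \<in> ?U" using a' \<delta>(1)[OF a''] by simp
    then have pos: "emeasure lborel ?U > 0" by (intro emeasure_open_pos) auto
    have "AE x in lebesgue. x \<in> ?U \<longrightarrow> c a * of_real (p0 x) = c a' * of_real (p0 x)"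
      using c[OF a] c[OF a''] by eventually_elim auto
    from AE_imp_exists[OF this, of ?U] obtain x where x: "x \<in> ?U" "c a * of_real (p0 x) = c a' * of_real (p0 x)"
      using pos by auto
    then have "p0 x > 0" using \<delta>(2)[OF a] by (intro p0_pos) blast
    then show ?thesis using x(2) by simp
  qed
  \<comment> \<open>Here dimension at least 2 matters: on the line an annulus has two
    components.\<close>
  have "connected {x::real^'n. R1 < norm (x - 0) \<and> norm (x - 0) < R2}"
    using dim by (intro connected_annulus) simp
  also have "{x::real^'n. R1 < norm (x - 0) \<and> norm (x - 0) < R2} = Om" by auto
  finally have con: "connected Om" .
  obtain a0 where a0: "a0 \<in> Om" using Om_nonempty by blast
  have const: "c a = c a0" if "a \<in> Om" for a
  proof (rule connected_local_const[OF con that a0], intro ballI)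
    fix b assume b: "b \<in> Om"
    show "\<forall>\<^sub>F y in at b within Om. c b = c y"
      unfolding eventually_at using \<delta>(1)[OF b] agree[OF b] by (auto simp: dist_commute intro!: exI[of _ "\<delta> b"])
  qed
  \<comment> \<open>The exceptional null set depends on the centre of the ball, and there are
    uncountably many centres; the local characterisation of negligible sets deals with this.\<close>
  have "negligible {x \<in> Om. u x \<noteq> c a0 * u0 x}"
  proof (rule locally_negligible_alt[THEN iffD2, rule_format])
    fix a assume "a \<in> {x \<in> Om. u x \<noteq> c a0 * u0 x}"
    then have a: "a \<in> Om" by simp
    let ?N = "{x \<in> Om. u x \<noteq> c a0 * u0 x}"
    have "AE x in lebesgue. x \<notin> ?N \<inter> ball a (\<delta> a)"
      using c[OF a] const[OF a] by (auto simp: u0_def elim!: eventually_mono)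
    then have "negligible (?N \<inter> ball a (\<delta> a))" by (rule AE_not_in_imp_negligible)
    then show "\<exists>U. openin (top_of_set ?N) U \<and> a \<in> U \<and> negligible U"
      using \<delta>(1)[OF a] a \<open>a \<in> ?N\<close> by (intro exI[of _ "?N \<inter> ball a (\<delta> a)"]) (auto intro: openin_open_Int)
  qed
  then have "AE x in lebesgue. x \<notin> {x \<in> Om. u x \<noteq> c a0 * u0 x}"
    unfolding negligible_iff_null_sets by (rule AE_not_in)
  then have "AE x in lebesgue. x \<in> Om \<longrightarrow> u x = c a0 * u0 x" by eventually_elim auto
  then have "AE x in lebesgue_on Om. u x = c a0 * u0 x" by (subst AE_restrict_space_iff) auto
  then show thesis by (rule that)
qed

lemma weak_solutions_radial_decreasing:
  assumes \<mu>: "\<mu> \<le> ground"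
  shows "(\<forall>u v. weak_solution Om S2 S1 \<nu> (of_real \<mu>) u v \<longrightarrow>
            (\<exists>f :: real \<Rightarrow> complex. AE x in lebesgue_on Om. u x = f (norm x))) \<and>
         (\<forall>u1 v1 :: real^'n \<Rightarrow> real.
            eigenfunction Om S2 S1 \<nu> (of_real \<mu>) (\<lambda>x. of_real (u1 x)) (\<lambda>x. of_real (v1 x)) \<and>
            (AE x in lebesgue_on Om. 0 < u1 x) \<and> (AE x in surface_measure S1. 0 < v1 x) \<longrightarrow>
            (\<exists>w :: real^'n \<Rightarrow> real.
               continuous_on (closure Om) w \<and>
               (AE x in lebesgue_on Om. u1 x = w x) \<and>
               (\<forall>x\<in>closure Om. \<forall>y\<in>closure Om. norm x < norm y \<longrightarrow> w y < w x)))"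
proof -
  have key: "\<exists>c. AE x in lebesgue_on Om. u x = c * u0 x" if w: "weak_solution Om S2 S1 \<nu> (of_real \<mu>) u v" for u v
  proof -
    obtain g G where "in_H1 Om S2 S1 \<nu> u g v G" "AE x in lebesgue_on Om. defect (beta ground) u g x = 0"
      by (rule defect_zero[OF w \<mu>])
    from rigidity[OF this] show ?thesis by blast
  qed
  show ?thesis
  proof (intro conjI allI impI)
    fix u v assume "weak_solution Om S2 S1 \<nu> (of_real \<mu>) u v"
    from key[OF this] obtain c where "AE x in lebesgue_on Om. u x = c * u0 x" by blast
    then show "\<exists>f :: real \<Rightarrow> complex. AE x in lebesgue_on Om. u x = f (norm x)"
      by (intro exI[of _ "\<lambda>r. c * of_real (phi ground r)"]) (simp add: u0_def)
  next
    fix u1 v1 :: "real^'n \<Rightarrow> real"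
    assume *: "eigenfunction Om S2 S1 \<nu> (of_real \<mu>) (\<lambda>x. of_real (u1 x)) (\<lambda>x. of_real (v1 x)) \<and>
      (AE x in lebesgue_on Om. 0 < u1 x) \<and> (AE x in surface_measure S1. 0 < v1 x)"
    then have "weak_solution Om S2 S1 \<nu> (of_real \<mu>) (\<lambda>x. of_real (u1 x)) (\<lambda>x. of_real (v1 x))"
      by (simp add: eigenfunction_def)
    from key[OF this] obtain c where c: "AE x in lebesgue_on Om. of_real (u1 x) = c * u0 x" by blast
    \<comment> \<open>Both \<open>u1\<close> and \<open>p0\<close> are real, so taking real parts
      yields a real constant.\<close>
    have eq: "AE x in lebesgue_on Om. u1 x = Re c * p0 x"
      using c
    proof eventually_elim
      case (elim x)
      from arg_cong[OF elim, of Re] show ?case by (simp add: u0_def)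
    qed
    have pos: "AE x in lebesgue_on Om. 0 < Re c * p0 x"
      using eq conjunct1[OF conjunct2[OF *]] by eventually_elim simp
    then have "AE x in lebesgue. x \<in> Om \<longrightarrow> 0 < Re c * p0 x" by (subst (asm) AE_restrict_space_iff) auto
    \<comment> \<open>Positivity at one point of the annulus fixes the sign of the constant, and the
      monotonicity of \<open>phi ground\<close> then carries over to the continuous
      representative.\<close>
    from AE_imp_exists[OF this, of Om] obtain x where x: "x \<in> Om" "0 < Re c * p0 x"
      using emeasure_open_pos[OF open_Om Om_nonempty] by auto
    then have c_pos: "0 < Re c" using p0_pos[OF x(1)] by (simp add: zero_less_mult_iff)
    have "closed K" by (intro closed_Diff) auto
    then have cl: "closure Om \<subseteq> K" by (rule closure_minimal[OF Om_sub_K])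
    show "\<exists>w :: real^'n \<Rightarrow> real. continuous_on (closure Om) w \<and> (AE x in lebesgue_on Om. u1 x = w x) \<and>
       (\<forall>x\<in>closure Om. \<forall>y\<in>closure Om. norm x < norm y \<longrightarrow> w y < w x)"
    proof (intro exI[of _ "\<lambda>x. Re c * p0 x"] conjI ballI impI eq)
      show "continuous_on (closure Om) (\<lambda>x. Re c * p0 x)"
        by (intro continuous_on_mult continuous_on_const continuous_on_subset[OF continuous_on_K_norm[OF continuous_phi_ground] cl])
    next
      fix x y assume xy: "x \<in> closure Om" "y \<in> closure Om" "norm x < norm y"
      then have "R1 \<le> norm x" "norm y \<le> R2" using subsetD[OF cl xy(1)] subsetD[OF cl xy(2)] by auto
      then have "p0 y < p0 x" using xy(3) by (intro phi_ground_decreasing)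
      then show "Re c * p0 y < Re c * p0 x" using c_pos by simp
    qed
  qed
qed

end

theorem theorem5:
  fixes R\<^sub>1 R\<^sub>2 \<mu>\<^sub>1 :: real
    and \<Omega> \<Gamma>\<^sub>0 \<Gamma>\<^sub>1 :: "(real^'n) set"
    and \<nu> :: "real^'n \<Rightarrow> real^'n"
  assumes "CARD('n) \<ge> 2"
    and "0 < R\<^sub>1" and "R\<^sub>1 < R\<^sub>2"
    and "\<Omega> = ball 0 R\<^sub>2 - closure (ball 0 R\<^sub>1)"
    and "\<Gamma>\<^sub>0 = frontier (ball 0 R\<^sub>2)"
    and "\<Gamma>\<^sub>1 = frontier (ball 0 R\<^sub>1)"
    and "\<nu> = annulus_normal R\<^sub>1"
    and "smallest_eigenvalue \<Omega> \<Gamma>\<^sub>0 \<Gamma>\<^sub>1 \<nu> \<mu>\<^sub>1"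
  shows "(\<forall>u v. weak_solution \<Omega> \<Gamma>\<^sub>0 \<Gamma>\<^sub>1 \<nu> (of_real \<mu>\<^sub>1) u v \<longrightarrow>
            (\<exists>f :: real \<Rightarrow> complex. AE x in lebesgue_on \<Omega>. u x = f (norm x))) \<and>
         (\<forall>u\<^sub>1 v\<^sub>1 :: real^'n \<Rightarrow> real.
            eigenfunction \<Omega> \<Gamma>\<^sub>0 \<Gamma>\<^sub>1 \<nu> (of_real \<mu>\<^sub>1) (\<lambda>x. of_real (u\<^sub>1 x)) (\<lambda>x. of_real (v\<^sub>1 x)) \<and>
            (AE x in lebesgue_on \<Omega>. 0 < u\<^sub>1 x) \<and> (AE x in surface_measure \<Gamma>\<^sub>1. 0 < v\<^sub>1 x) \<longrightarrow>
            (\<exists>w :: real^'n \<Rightarrow> real.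
               continuous_on (closure \<Omega>) w \<and>
               (AE x in lebesgue_on \<Omega>. u\<^sub>1 x = w x) \<and>
               (\<forall>x\<in>closure \<Omega>. \<forall>y\<in>closure \<Omega>. norm x < norm y \<longrightarrow> w y < w x)))"
proof -
  interpret annulus_problem R\<^sub>1 R\<^sub>2 "TYPE('n)" "CARD('n) - 1"
    "real CARD('n) * R\<^sub>1 ^ (CARD('n) - 1) * sphere_ratio (sphere (0::real^'n) R\<^sub>1)"
    "real CARD('n) * R\<^sub>2 ^ (CARD('n) - 1) * sphere_ratio (sphere (0::real^'n) R\<^sub>2)"
    using assms(1-3) by unfold_locales simp_all
  have \<Omega>: "\<Omega> = Om" and \<Gamma>: "\<Gamma>\<^sub>0 = S2" "\<Gamma>\<^sub>1 = S1"
    using assms(2-6) by (simp_all add: frontier_ball)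
  have "\<mu>\<^sub>1 \<le> ground"
    using assms(8) ground_eigenvalue unfolding smallest_eigenvalue_def \<Omega> \<Gamma> assms(7) by blast
  then show ?thesis unfolding \<Omega> \<Gamma> by (rule weak_solutions_radial_decreasing)
qed

end
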